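(* Let $\mathcal{V}$ be a combinatorial vector field on a simplicial complex $\mathcal{X}$, let $d:=\#\mathcal{X}_0$ be the number of vertices, and let $X\subset\mathbb{R}^d$ be the underlying polytope of the standard geometric realization of $\mathcal{X}$. Suppose $\epsilon\in(0,1/(6d))$ and consider the mapping $\varphi$ explicitly constructed (in the context) by concatenating solutions of the differential equations $\dot x=f^\omega(x)$ on flow tiles. Then for every $x\in X$ the solution $\varphi(\cdot,x)$ is defined on all of $\mathbb{R}_0^+$ (that is, $T_x=\infty$), and the resulting map $\varphi:\mathbb{R}_0^+\times X\to X$ is continuous. In addition, $$\varphi(t,\varphi(s,x))=\varphi(t+s,x)\qquad\text{for all }t,s\in\mathbb{R}_0^+,\ x\in X,$$ and $\varphi$ is strongly admissible for $\mathcal{V}$.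
   Context: **Simplicial complexes.** A simplicial complex $\mathcal{X}$ is a finite collection of nonempty finite sets (simplices) such that every nonempty subset of a simplex is a simplex; $\dim\sigma=\#\sigma-1$; $\mathcal{X}_0=\bigcup\mathcal{X}$ is the vertex set. A facet of $\sigma$ is a nonempty subset $\tau\subset\sigma$ with $\dim\tau=\dim\sigma-1$. Index coordinates of $\mathbb{R}^d$ by $\mathcal{X}_0$; $X=\{x\in\mathbb{R}^d: x_v\ge 0,\ \sum_{v}x_v=1,\ \{v: x_v>0\}\in\mathcal{X}\}$; closures $\operatorname{cl}$ are taken in $X$. **Combinatorial vector field.** A combinatorial vector field $\mathcal{V}$ on $\mathcal{X}$ is a partition of $\mathcal{X}$ into singletons and doubletons such that each doubleton consists of a simplex and one of its facets. If $\{\sigma\}\in\mathcal{V}$, $\sigma$ is critical; a doubleton $\{\tau,\sigma\}\in\mathcal{V}$ with $\tau$ a facet of $\sigma$ is an arrow. For $\omega\in\mathcal{X}$: if $\omega$ is critical, $\omega^-=\omega^+=\omega$; if $\omega$ belongs to the arrow $\{\tau,\sigma\}$ ($\tau$ a facet of $\sigma$), $\omega^-=\tau$, $\omega^+=\sigma$. **Cells and tiles.** $\langle\sigma\rangle_\epsilon:=\{x\in X: x_v>\epsilon\ \forall v\in\sigma,\ x_v<\epsilon\ \forall v\notin\sigma\}$ for $\sigma\in\mathcal{X}$. Flow tiles: $C_\omega:=\operatorname{cl}\langle\omega^-\rangle_\epsilon\cup\operatorname{cl}\langle\omega^+\rangle_\epsilon$, one for each element of $\mathcal{V}$; an arrow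 flow tile is one with $\omega^-\ne\omega^+$. For $x\in X$: $\sigma^\epsilon_{\min}(x)=\{v: x_v>\epsilon\}$, $\sigma^\epsilon_{\max}(x)=\{v: x_v\ge\epsilon\}$. **Vector fields.** Let $g(s)=\sqrt[3]{\epsilon^2 s}$ (real cube root); $h(s)=1$ if $|s-\epsilon|\ge\epsilon/2$ and $h(s)=(1+\frac{\epsilon}{2})\frac{2}{\epsilon}|s-\epsilon|-\frac{\epsilon}{2}$ if $|s-\epsilon|\le\epsilon/2$. For $\omega\in\mathcal{X}$, $s\in\mathbb{R}$, $x\in\mathbb{R}^d$: $\theta^\omega(x)=\min(\{\epsilon\}\cup\{x_u-\epsilon: u\in\omega^-\})$; $\eta^\omega(s,x)=1$ if $\sum_{u\notin\omega^+}x_u^2=0$ or $|s|>\epsilon/4$, and $\eta^\omega(s,x)=4|s|/\epsilon$ if $\sum_{u\notin\omega^+}x_u^2>0$ and $|s|\le\epsilon/4$. The vector field $f^\omega:\mathbb{R}^d\to\mathbb{R}^d$ is - $f^\omega_v(x)=-g(x_v)$ for $v\notin\omega^+$; - $f^\omega_v(x)=\eta^\omega(x_v,x)\bigl(h(x_v)+\theta^\omega(x)-\sum_{u\notin\omega^+}x_u\bigr)$ for $v\in\omega^+\setminus\omega^-$; - $f^\omega_v(x)=x_v-\frac{1}{\#\omega^-}\bigl(\sum_{u\in\omega^-}x_u+\sum_{u\notin\omega^-}f^\omega_u(x)\bigr)$ for $v\in\omega^-$. For each $\xi\in\mathbb{R}^d$ there is a unique continuous $\varphi^\omega(\cdot,\xi):\mathbb{R}_0^+\to\mathbb{R}^d$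 with $\varphi^\omega(t,\xi)=\xi+\int_0^t f^\omega(\varphi^\omega(r,\xi))\,dr$ for all $t\ge0$; this defines a continuous semiflow $\varphi^\omega$ on $\mathbb{R}^d$. For $x\in C_\omega$ the exit time is $T^\omega(x)=\inf\{t>0:\varphi^\omega(t,x)\notin C_\omega\}$ ($\inf\emptyset=+\infty$). **Construction of $\varphi$.** Let $x\in X$. Set $t_0=0$, $x_0=x$ and recursively $\omega_k=\sigma^\epsilon_{\min}(x_k)$ (then $x_k\in C_{\omega_k}$ and $T^{\omega_k}(x_k)>0$). If $T^{\omega_k}(x_k)<\infty$, let $t_{k+1}=t_k+T^{\omega_k}(x_k)$, $x_{k+1}=\varphi^{\omega_k}(T^{\omega_k}(x_k),x_k)$, and $\varphi(t,x)=\varphi^{\omega_k}(t-t_k,x_k)$ for $t_k\le t\le t_{k+1}$. If $T^{\omega_k}(x_k)=\infty$, let $\varphi(t,x)=\varphi^{\omega_k}(t-t_k,x_k)$ for all $t\ge t_k$, stop, and put $T_x=\infty$. If the recursion never stops, put $T_x=\sup_k t_k$. Thus $\varphi(\cdot,x)$ is defined on $[0,T_x)$ with values in $X$. **Strong admissibility.** A solution of a semiflow $\varphi$ on $X$ is a map $\gamma:I\to X$ on an interval $I$ with $\varphi(s,\gamma(t))=\gamma(s+t)$ whenever $s\ge0$ and $t,s+t\in I$; it is through $x$ if $0\in I$ and $\gamma(0)=x$. A continuous semiflow $\varphi$ is admissible for $\mathcal{V}$ if for every $x\in X$ contained in at least two flow tiles and every solution $\gamma:[t_-,t_+]\to X$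 through $x$ with $t_-\le0<t_+$ there is an open neighborhood $U$ of $0$ in $[t_-,t_+]$ with $\gamma(t)\in\langle\sigma^\epsilon_{\max}(x)\rangle_\epsilon$ for all $t\in U$, $t<0$, and $\gamma(t)\in\langle\sigma^\epsilon_{\min}(x)\rangle_\epsilon$ for all $t\in U$, $t>0$. It is strongly admissible if in addition every forward solution originating in an arrow flow tile exits the tile in finite forward time, and every solution through a point of an arrow flow tile which exists for all negative times exits the tile in finite backward time. *)

theory Defs
  imports "HOL-Analysis.Analysis" "HOL-Library.Disjoint_Sets"
begin

section \<open>Simplicial complexes and combinatorial vector fields\<close>

text \<open>The library notion \<open>simplicial_complex\<close> is about geometric simplices; here complexes are abstract.\<close>

definition abstract_complex :: "'a set set \<Rightarrow> bool" where
  "abstract_complex K \<longleftrightarrow> finite K \<and> (\<forall>\<sigma>\<in>K. finite \<sigma> \<and> \<sigma> \<noteq> {}) \<and>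
     (\<forall>\<sigma>\<in>K. \<forall>\<tau>. \<tau> \<subseteq> \<sigma> \<and> \<tau> \<noteq> {} \<longrightarrow> \<tau> \<in> K)"

definition vertices :: "'a set set \<Rightarrow> 'a set" where
  "vertices K = \<Union>K"

definition simplex_dim :: "'a set \<Rightarrow> int" where
  "simplex_dim \<sigma> = int (card \<sigma>) - 1"

definition facet :: "'a set \<Rightarrow> 'a set \<Rightarrow> bool" where
  "facet \<tau> \<sigma> \<longleftrightarrow> \<tau> \<noteq> {} \<and> \<tau> \<subseteq> \<sigma> \<and> simplex_dim \<tau> = simplex_dim \<sigma> - 1"

definition combinatorial_vector_field :: "'a set set \<Rightarrow> 'a set set set \<Rightarrow> bool" where
  "combinatorial_vector_field K V \<longleftrightarrow> partition_on K V \<and>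
     (\<forall>A\<in>V. (\<exists>\<sigma>. A = {\<sigma>}) \<or> (\<exists>\<tau> \<sigma>. A = {\<tau>, \<sigma>} \<and> facet \<tau> \<sigma>))"

definition critical :: "'a set set set \<Rightarrow> 'a set \<Rightarrow> bool" where
  "critical V \<sigma> \<longleftrightarrow> {\<sigma>} \<in> V"

definition arrow :: "'a set set set \<Rightarrow> 'a set \<Rightarrow> 'a set \<Rightarrow> bool" where
  "arrow V \<tau> \<sigma> \<longleftrightarrow> {\<tau>, \<sigma>} \<in> V \<and> facet \<tau> \<sigma>"

text \<open>\<open>lower V \<omega>\<close> and \<open>upper V \<omega>\<close> are $\omega^-$ and $\omega^+$.\<close>

definition lower :: "'a set set set \<Rightarrow> 'a set \<Rightarrow> 'a set" where
  "lower V \<omega> = (if critical V \<omega> then \<omega> else (THE \<tau>. \<exists>\<sigma>. arrow V \<tau> \<sigma> \<and> \<omega> \<in> {\<tau>, \<sigma>}))"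

definition upper :: "'a set set set \<Rightarrow> 'a set \<Rightarrow> 'a set" where
  "upper V \<omega> = (if critical V \<omega> then \<omega> else (THE \<sigma>. \<exists>\<tau>. arrow V \<tau> \<sigma> \<and> \<omega> \<in> {\<tau>, \<sigma>}))"


section \<open>Geometric realization, cells and flow tiles\<close>

text \<open>Coordinates are indexed by the type \<open>'v\<close>; this is Euclidean \<open>d\<close>-space with coordinates indexed by the
  vertices exactly when \<open>vertices K = UNIV\<close>.\<close>

definition realization :: "'v::finite set set \<Rightarrow> (real ^ 'v) set" where
  "realization K = {x. (\<forall>v. x $ v \<ge> 0) \<and> (\<Sum>v\<in>UNIV. x $ v) = 1 \<and> {v. x $ v > 0} \<in> K}"

definition cell :: "'v::finite set set \<Rightarrow> real \<Rightarrow> 'v set \<Rightarrow> (real ^ 'v) set" where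
  "cell K \<epsilon> \<sigma> = {x \<in> realization K. (\<forall>v\<in>\<sigma>. x $ v > \<epsilon>) \<and> (\<forall>v. v \<notin> \<sigma> \<longrightarrow> x $ v < \<epsilon>)}"

definition closed_cell :: "'v::finite set set \<Rightarrow> real \<Rightarrow> 'v set \<Rightarrow> (real ^ 'v) set" where
  "closed_cell K \<epsilon> \<sigma> = (top_of_set (realization K)) closure_of (cell K \<epsilon> \<sigma>)"

definition tile :: "'v::finite set set \<Rightarrow> 'v set set set \<Rightarrow> real \<Rightarrow> 'v set \<Rightarrow> (real ^ 'v) set" where
  "tile K V \<epsilon> \<omega> = closed_cell K \<epsilon> (lower V \<omega>) \<union> closed_cell K \<epsilon> (upper V \<omega>)"

definition flow_tiles :: "'v::finite set set \<Rightarrow> 'v set set set \<Rightarrow> real \<Rightarrow> (real ^ 'v) set set" where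
  "flow_tiles K V \<epsilon> = tile K V \<epsilon> ` K"

definition arrow_flow_tiles :: "'v::finite set set \<Rightarrow> 'v set set set \<Rightarrow> real \<Rightarrow> (real ^ 'v) set set" where
  "arrow_flow_tiles K V \<epsilon> = tile K V \<epsilon> ` {\<omega> \<in> K. lower V \<omega> \<noteq> upper V \<omega>}"

definition sigma_min :: "real \<Rightarrow> real ^ 'v::finite \<Rightarrow> 'v set" where
  "sigma_min \<epsilon> x = {v. x $ v > \<epsilon>}"

definition sigma_max :: "real \<Rightarrow> real ^ 'v::finite \<Rightarrow> 'v set" where
  "sigma_max \<epsilon> x = {v. x $ v \<ge> \<epsilon>}"


section \<open>The vector fields on the tiles\<close>

text \<open>\<open>root 3\<close> is the odd real cube root, also for negative arguments.\<close>

definition g_fun :: "real \<Rightarrow> real \<Rightarrow> real" where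
  "g_fun \<epsilon> s = root 3 (\<epsilon>\<^sup>2 * s)"

definition h_fun :: "real \<Rightarrow> real \<Rightarrow> real" where
  "h_fun \<epsilon> s = (if \<bar>s - \<epsilon>\<bar> \<ge> \<epsilon> / 2 then 1
                 else (1 + \<epsilon> / 2) * (2 / \<epsilon>) * \<bar>s - \<epsilon>\<bar> - \<epsilon> / 2)"

definition theta :: "'v::finite set set set \<Rightarrow> real \<Rightarrow> 'v set \<Rightarrow> real ^ 'v \<Rightarrow> real" where
  "theta V \<epsilon> \<omega> x = Min ({\<epsilon>} \<union> {x $ u - \<epsilon> | u. u \<in> lower V \<omega>})"

definition eta :: "'v::finite set set set \<Rightarrow> real \<Rightarrow> 'v set \<Rightarrow> real \<Rightarrow> real ^ 'v \<Rightarrow> real" where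
  "eta V \<epsilon> \<omega> s x = (if (\<Sum>u\<in>- upper V \<omega>. (x $ u)\<^sup>2) = 0 \<or> \<bar>s\<bar> > \<epsilon> / 4 then 1 else 4 * \<bar>s\<bar> / \<epsilon>)"

text \<open>The components of the vector field for \<open>v \<notin> lower V \<omega>\<close>; the components for
  \<open>v \<in> lower V \<omega>\<close> in \<open>tile_field\<close> are defined in terms of these.\<close>

definition field_off_lower ::
    "'v::finite set set set \<Rightarrow> real \<Rightarrow> 'v set \<Rightarrow> real ^ 'v \<Rightarrow> 'v \<Rightarrow> real" where
  "field_off_lower V \<epsilon> \<omega> x v =
     (if v \<notin> upper V \<omega> then - g_fun \<epsilon> (x $ v)
      else eta V \<epsilon> \<omega> (x $ v) x * (h_fun \<epsilon> (x $ v) + theta V \<epsilon> \<omega> x - (\<Sum>u\<in>- upper V \<omega>. x $ u)))"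

definition tile_field ::
    "'v::finite set set set \<Rightarrow> real \<Rightarrow> 'v set \<Rightarrow> real ^ 'v \<Rightarrow> real ^ 'v" where
  "tile_field V \<epsilon> \<omega> x = (\<chi> v.
     if v \<in> lower V \<omega>
     then x $ v - 1 / real (card (lower V \<omega>)) *
            ((\<Sum>u\<in>lower V \<omega>. x $ u) + (\<Sum>u\<in>- lower V \<omega>. field_off_lower V \<epsilon> \<omega> x u))
     else field_off_lower V \<epsilon> \<omega> x v)"


section \<open>The semiflows of the tile fields\<close>

text \<open>The fields are discontinuous, so solutions are understood in the integral sense. Only the
  values \<open>u t\<close> for \<open>t \<ge> 0\<close> are constrained.\<close>

definition integral_solution ::
    "(real ^ 'v::finite \<Rightarrow> real ^ 'v) \<Rightarrow> real ^ 'v \<Rightarrow> (real \<Rightarrow> real ^ 'v) \<Rightarrow> bool" where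
  "integral_solution F \<xi> u \<longleftrightarrow> continuous_on {0..} u \<and>
     (\<forall>t\<ge>0. (\<lambda>r. F (u r)) integrable_on {0..t} \<and> u t = \<xi> + integral {0..t} (\<lambda>r. F (u r)))"

definition tile_flow ::
    "'v::finite set set set \<Rightarrow> real \<Rightarrow> 'v set \<Rightarrow> real \<Rightarrow> real ^ 'v \<Rightarrow> real ^ 'v" where
  "tile_flow V \<epsilon> \<omega> t \<xi> = (THE y. \<exists>u. integral_solution (tile_field V \<epsilon> \<omega>) \<xi> u \<and> u t = y)"

definition exit_time ::
    "'v::finite set set \<Rightarrow> 'v set set set \<Rightarrow> real \<Rightarrow> 'v set \<Rightarrow> real ^ 'v \<Rightarrow> ereal" where
  "exit_time K V \<epsilon> \<omega> x = Inf {ereal t | t. t > 0 \<and> tile_flow V \<epsilon> \<omega> t x \<notin> tile K V \<epsilon> \<omega>}"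


section \<open>Concatenation\<close>

text \<open>\<open>breakpoint K V \<epsilon> x k\<close> is \<open>Some (t\<^sub>k, x\<^sub>k)\<close>, or \<open>None\<close> if the recursion has stopped before
  step \<open>k\<close>.\<close>

primrec breakpoint ::
    "'v::finite set set \<Rightarrow> 'v set set set \<Rightarrow> real \<Rightarrow> real ^ 'v \<Rightarrow> nat \<Rightarrow> (real \<times> (real ^ 'v)) option" where
  "breakpoint K V \<epsilon> x 0 = Some (0, x)"
| "breakpoint K V \<epsilon> x (Suc k) =
     (case breakpoint K V \<epsilon> x k of
        None \<Rightarrow> None
      | Some (s, p) \<Rightarrow>
          (let \<omega> = sigma_min \<epsilon> p; T = exit_time K V \<epsilon> \<omega> p
           in if T < \<infinity> then Some (s + real_of_ereal T, tile_flow V \<epsilon> \<omega> (real_of_ereal T) p)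
              else None))"

text \<open>\<open>lifetime K V \<epsilon> x\<close> is $T_x$.\<close>

definition lifetime ::
    "'v::finite set set \<Rightarrow> 'v set set set \<Rightarrow> real \<Rightarrow> real ^ 'v \<Rightarrow> ereal" where
  "lifetime K V \<epsilon> x =
     (if \<exists>k. breakpoint K V \<epsilon> x k = None then \<infinity>
      else (SUP k. ereal (fst (the (breakpoint K V \<epsilon> x k)))))"

text \<open>For \<open>0 \<le> t < lifetime K V \<epsilon> x\<close>, some pair \<open>(s, p) = (t\<^sub>k, x\<^sub>k)\<close> has \<open>t \<in> [t\<^sub>k, t\<^sub>k + T]\<close> with \<open>T\<close>
  the exit time of \<open>x\<^sub>k\<close>; at a common end point two consecutive pieces have the same value.\<close>

definition concat_flow ::
    "'v::finite set set \<Rightarrow> 'v set set set \<Rightarrow> real \<Rightarrow> real \<Rightarrow> real ^ 'v \<Rightarrow> real ^ 'v" where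
  "concat_flow K V \<epsilon> t x =
     (THE y. \<exists>k s p. breakpoint K V \<epsilon> x k = Some (s, p) \<and> s \<le> t \<and>
        ereal (t - s) \<le> exit_time K V \<epsilon> (sigma_min \<epsilon> p) p \<and>
        y = tile_flow V \<epsilon> (sigma_min \<epsilon> p) (t - s) p)"


section \<open>Semiflows and strong admissibility\<close>

text \<open>Semiflows are functions on all of \<open>real\<close>; only times \<open>t \<ge> 0\<close> and points of \<open>X\<close> matter.\<close>

definition continuous_semiflow ::
    "'a::topological_space set \<Rightarrow> (real \<Rightarrow> 'a \<Rightarrow> 'a) \<Rightarrow> bool" where
  "continuous_semiflow X \<phi> \<longleftrightarrow>
     (\<forall>t\<ge>0. \<forall>x\<in>X. \<phi> t x \<in> X) \<and>
     continuous_on ({0..} \<times> X) (\<lambda>(t, x). \<phi> t x) \<and>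
     (\<forall>x\<in>X. \<phi> 0 x = x) \<and>
     (\<forall>t\<ge>0. \<forall>s\<ge>0. \<forall>x\<in>X. \<phi> t (\<phi> s x) = \<phi> (t + s) x)"

definition semiflow_solution ::
    "'a set \<Rightarrow> (real \<Rightarrow> 'a \<Rightarrow> 'a) \<Rightarrow> real set \<Rightarrow> (real \<Rightarrow> 'a) \<Rightarrow> bool" where
  "semiflow_solution X \<phi> I \<gamma> \<longleftrightarrow> is_interval I \<and> \<gamma> ` I \<subseteq> X \<and>
     (\<forall>s\<ge>0. \<forall>t\<in>I. s + t \<in> I \<longrightarrow> \<phi> s (\<gamma> t) = \<gamma> (s + t))"

definition solution_through ::
    "'a set \<Rightarrow> (real \<Rightarrow> 'a \<Rightarrow> 'a) \<Rightarrow> real set \<Rightarrow> (real \<Rightarrow> 'a) \<Rightarrow> 'a \<Rightarrow> bool" where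
  "solution_through X \<phi> I \<gamma> x \<longleftrightarrow> semiflow_solution X \<phi> I \<gamma> \<and> 0 \<in> I \<and> \<gamma> 0 = x"

definition admissible ::
    "'v::finite set set \<Rightarrow> 'v set set set \<Rightarrow> real \<Rightarrow> (real \<Rightarrow> real ^ 'v \<Rightarrow> real ^ 'v) \<Rightarrow> bool" where
  "admissible K V \<epsilon> \<phi> \<longleftrightarrow>
     continuous_semiflow (realization K) \<phi> \<and>
     (\<forall>x\<in>realization K. card {C \<in> flow_tiles K V \<epsilon>. x \<in> C} \<ge> 2 \<longrightarrow>
       (\<forall>a b \<gamma>. a \<le> 0 \<and> 0 < b \<and> solution_through (realization K) \<phi> {a..b} \<gamma> x \<longrightarrow>
         (\<exists>U. openin (top_of_set {a..b}) U \<and> 0 \<in> U \<and>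
              (\<forall>t\<in>U. t < 0 \<longrightarrow> \<gamma> t \<in> cell K \<epsilon> (sigma_max \<epsilon> x)) \<and>
              (\<forall>t\<in>U. t > 0 \<longrightarrow> \<gamma> t \<in> cell K \<epsilon> (sigma_min \<epsilon> x)))))"

definition strongly_admissible ::
    "'v::finite set set \<Rightarrow> 'v set set set \<Rightarrow> real \<Rightarrow> (real \<Rightarrow> real ^ 'v \<Rightarrow> real ^ 'v) \<Rightarrow> bool" where
  "strongly_admissible K V \<epsilon> \<phi> \<longleftrightarrow>
     admissible K V \<epsilon> \<phi> \<and>
     (\<forall>C\<in>arrow_flow_tiles K V \<epsilon>. \<forall>x\<in>C. \<forall>\<gamma>.
        solution_through (realization K) \<phi> {0..} \<gamma> x \<longrightarrow> (\<exists>t\<ge>0. \<gamma> t \<notin> C)) \<and>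
     (\<forall>C\<in>arrow_flow_tiles K V \<epsilon>. \<forall>x\<in>C. \<forall>I \<gamma>.
        solution_through (realization K) \<phi> I \<gamma> x \<and> {..0} \<subseteq> I \<longrightarrow> (\<exists>t\<le>0. \<gamma> t \<notin> C))"

end

(* The difficulty is that each tile field is discontinuous (through eta) and not Lipschitz (through the cube root).
   On the other hand it is almost explicitly solvable. The coordinates off the upper simplex obey a decoupled
   scalar equation, the deviations of the lower coordinates from their mean grow exactly like exp t, and the
   coordinate sum is preserved. What remains is one scalar equation for the coordinate of the arrow's extra vertex.
   It is Lipschitz in that coordinate, uniformly in the initial point, and jumps in time only once, when the
   coordinates off the simplex have died out. This gives existence, uniqueness and continuity of the tile flows.

   A tile can only be left through a face x_v = epsilon with v in the lower simplex. At a point of two tiles every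
   coordinate equal to epsilon decreases at a definite rate, with the same bound in all tiles nearby. Hence exit
   times cannot accumulate: near an accumulation point each such coordinate would cross epsilon at most once. For
   the same reason a trajectory starting near such a point x enters the tile of sigma_min x after a time
   proportional to the distance, which yields continuity, and admissibility is immediate.

   In an arrow tile either the deviations blow up or the point is almost balanced, forwards and backwards
   respectively; once balanced, the coordinate of the extra vertex grows at rate at least epsilon / 2. *)
theory Submission
  imports Defs
begin

section \<open>Integral equations\<close>

text \<open>The coordinate of an arrow's extra vertex must fall through \<open>\<epsilon>\<close> at
  a point of two tiles, yet it must be able to rise past \<open>\<epsilon>\<close> deep inside the
  tile. Two competing terms of the field arrange this. At \<open>\<epsilon>\<close> the function
  \<open>h_fun\<close> dips to \<open>- \<epsilon> / 2\<close>. In the tile, \<open>theta\<close>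
  minus the sum of the coordinates off the upper simplex equals \<open>\<epsilon>\<close> when those
  coordinates vanish and all lower coordinates are at least \<open>2 * \<epsilon>\<close>. It is at
  most 0 as soon as a lower coordinate equals \<open>\<epsilon>\<close> (then \<open>theta\<close>
  is at most 0) or a coordinate off the upper simplex does (then the sum is at least
  \<open>\<epsilon>\<close>, the cap of \<open>theta\<close>). So the sign of the motion at level
  \<open>\<epsilon>\<close> changes on the way to the boundary. The factor \<open>eta\<close> only
  concerns the support.

  The bound on \<open>\<epsilon>\<close> is consumed by the estimate on the lower faces, whose worst
  case needs five times the number of vertices times \<open>\<epsilon>\<close> to be at most 1.

  Solutions of the tile fields are studied from points of the unit cube: it is compact, which gives
  uniform constants, and its points are nonnegative, which gives the closed formula off the
  simplex.\<close>

lemma gronwall: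
  fixes u :: "real \<Rightarrow> real"
  assumes u: "continuous_on {0..T} u" and L: "0 \<le> L"
    and le: "\<And>t. t \<in> {0..T} \<Longrightarrow> u t \<le> a + L * integral {0..t} u"
    and t: "t \<in> {0..T}"
  shows "u t \<le> a * exp (L * t)"
proof -
  \<comment> \<open>The hypothesis says exactly that the derivative
    \<open>L * exp (- L * s) * (u s - (a + L * integral {0..s} u))\<close> of \<open>W\<close> is
    nonpositive.\<close>
  define W where "W s = exp (- L * s) * (a + L * integral {0..s} u)" for s
  have "W t \<le> W 0"
  proof (cases "t = 0")
    case False
    then have "0 < t" using t by auto
    then show ?thesis
    proof (rule DERIV_nonpos_imp_decreasing_open[OF less_imp_le])
      fix s assume s: "0 < s" "s < t"
      have "((\<lambda>x. integral {0..x} u) has_real_derivative u s) (at s within {0..T})"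
        using integral_has_real_derivative[OF u] s t by auto
      then have d: "((\<lambda>x. integral {0..x} u) has_real_derivative u s) (at s)"
        using s t by (simp add: at_within_Icc_at)
      have "(W has_real_derivative (exp (- L * s) * (L * (u s - (a + L * integral {0..s} u))))) (at s)"
        unfolding W_def by (rule derivative_eq_intros d refl)+ (simp add: algebra_simps)
      moreover have "exp (- L * s) * (L * (u s - (a + L * integral {0..s} u))) \<le> 0"
        using le[of s] s t L by (auto intro!: mult_nonneg_nonpos)
      ultimately show "\<exists>y. (W has_real_derivative y) (at s) \<and> y \<le> 0" by blast
    next
      have "continuous_on {0..T} (\<lambda>x. integral {0..x} u)"
        by (intro indefinite_integral_continuous_1 integrable_continuous_real u)
      then have "continuous_on {0..t} (\<lambda>x. integral {0..x} u)"
        by (rule continuous_on_subset) (use t in auto)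
      then show "continuous_on {0..t} W"
        unfolding W_def by (intro continuous_intros)
    qed
  qed simp
  then have "exp (- L * t) * (a + L * integral {0..t} u) \<le> a" by (simp add: W_def)
  then have "exp (L * t) * (exp (- L * t) * (a + L * integral {0..t} u)) \<le> exp (L * t) * a"
    by (intro mult_left_mono) auto
  then have "a + L * integral {0..t} u \<le> a * exp (L * t)"
    by (simp add: mult.assoc[symmetric] exp_add[symmetric] mult.commute)
  then show ?thesis using le[OF t] by linarith
qed

text \<open>The right-hand side may jump in time, so it is only required to be integrable along
  continuous curves. An exponential weight makes the integral operator a contraction on all of
  \<open>{0..T}\<close>, however large \<open>L * T\<close> is.\<close>

lemma picard_lindelof:
  fixes F :: "real \<Rightarrow> 'a::euclidean_space \<Rightarrow> 'a"
  assumes T: "0 \<le> T" and L: "0 \<le> L"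
    and lip: "\<And>t x y. t \<in> {0..T} \<Longrightarrow> norm (F t x - F t y) \<le> L * norm (x - y)"
    and int: "\<And>y. continuous_on {0..T} y \<Longrightarrow> (\<lambda>r. F r (y r)) integrable_on {0..T}"
  obtains y where "continuous_on {0..T} y"
    "\<And>t. t \<in> {0..T} \<Longrightarrow> y t = x0 + integral {0..t} (\<lambda>r. F r (y r))"
proof -
  \<comment> \<open>The unknown is rescaled by \<open>y t = exp (L * t) *\<^sub>R z t\<close>: the
    sup norm of \<open>z\<close> is a weighted norm of \<open>y\<close>, for which the contraction
    factor is \<open>1 - exp (- L * T)\<close>.\<close>
  define W where "W z t = exp (- L * t) *\<^sub>R (x0 + integral {0..t} (\<lambda>r. F r (exp (L * r) *\<^sub>R z r)))"
    for z :: "real \<Rightarrow> 'a" and t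
  have intz: "(\<lambda>r. F r (exp (L * r) *\<^sub>R apply_bcontfun z r)) integrable_on {0..T}" for z
    by (intro int continuous_intros continuous_on_apply_bcontfun)
  \<comment> \<open>Clamping the time turns a continuous function on \<open>{0..T}\<close> into a
    bounded continuous function on the line, so the fixed point is sought in a complete
    space.\<close>
  have "\<exists>g. \<forall>t. apply_bcontfun g t = W (apply_bcontfun z) (clamp 0 T t)" for z
  proof -
    have "continuous_on {0..T} (W z)"
      unfolding W_def by (intro continuous_intros indefinite_integral_continuous_1 intz)
    then have "continuous_on (cbox 0 T) (W z)" by simp
    then show ?thesis by (rule continuous_on_cbox_bcontfunE) metis
  qed
  then obtain G where G: "\<And>z t. apply_bcontfun (G z) t = W (apply_bcontfun z) (clamp 0 T t)"
    by metis
  have cl: "clamp 0 T t \<in> {0..T}" for t :: real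
    using clamp_in_interval[of 0 T t] T by simp
  have dist: "dist (G z) (G z') \<le> (1 - exp (- L * T)) * dist z z'" for z z'
  proof (rule dist_bound)
    fix t
    define s where "s = clamp 0 T t"
    have s: "s \<in> {0..T}" using cl s_def by simp
    have sub: "{0..s} \<subseteq> {0..T}" using s by auto
    note i = integrable_subinterval_real[OF intz sub]
    have fund: "((\<lambda>r. L * exp (L * r) * dist z z') has_integral (exp (L * s) * dist z z' - exp (L * 0) * dist z z')) {0..s}"
      using s by (intro fundamental_theorem_of_calculus)
        (auto intro!: derivative_eq_intros simp flip: has_real_derivative_iff_has_vector_derivative)
    have "norm (integral {0..s} (\<lambda>r. F r (exp (L * r) *\<^sub>R z r)) - integral {0..s} (\<lambda>r. F r (exp (L * r) *\<^sub>R z' r)))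
      = norm (integral {0..s} (\<lambda>r. F r (exp (L * r) *\<^sub>R z r) - F r (exp (L * r) *\<^sub>R z' r)))"
      using i by (subst integral_diff) auto
    also have "\<dots> \<le> integral {0..s} (\<lambda>r. L * exp (L * r) * dist z z')"
    proof (rule integral_norm_bound_integral)
      show "(\<lambda>r. L * exp (L * r) * dist z z') integrable_on {0..s}" using fund by blast
      show "(\<lambda>r. F r (exp (L * r) *\<^sub>R z r) - F r (exp (L * r) *\<^sub>R z' r)) integrable_on {0..s}"
        using i by (intro integrable_diff)
      fix r assume "r \<in> {0..s}"
      then have "norm (F r (exp (L * r) *\<^sub>R z r) - F r (exp (L * r) *\<^sub>R z' r))
        \<le> L * norm (exp (L * r) *\<^sub>R z r - exp (L * r) *\<^sub>R z' r)" using s by (intro lip) auto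
      also have "\<dots> = L * (exp (L * r) * dist (z r) (z' r))"
        by (simp add: dist_norm flip: scaleR_diff_right)
      also have "\<dots> \<le> L * (exp (L * r) * dist z z')"
        using L by (intro mult_left_mono dist_bounded) auto
      finally show "norm (F r (exp (L * r) *\<^sub>R z r) - F r (exp (L * r) *\<^sub>R z' r)) \<le> L * exp (L * r) * dist z z'"
        by (simp add: mult.assoc)
    qed
    also have "\<dots> = (exp (L * s) - 1) * dist z z'" using fund by (auto simp: algebra_simps dest: integral_unique)
    finally have *: "norm (integral {0..s} (\<lambda>r. F r (exp (L * r) *\<^sub>R z r)) - integral {0..s} (\<lambda>r. F r (exp (L * r) *\<^sub>R z' r)))
      \<le> (exp (L * s) - 1) * dist z z'" .
    have "dist (W z s) (W z' s) = exp (- L * s) *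
      norm (integral {0..s} (\<lambda>r. F r (exp (L * r) *\<^sub>R z r)) - integral {0..s} (\<lambda>r. F r (exp (L * r) *\<^sub>R z' r)))"
      by (simp add: W_def dist_norm flip: scaleR_diff_right)
    also have "\<dots> \<le> exp (- L * s) * ((exp (L * s) - 1) * dist z z')"
      by (intro mult_left_mono *) auto
    also have "\<dots> = (1 - exp (- L * s)) * dist z z'"
      by (simp add: algebra_simps exp_minus divide_simps)
    also have "\<dots> \<le> (1 - exp (- L * T)) * dist z z'"
      using s L by (intro mult_right_mono) (auto intro: mult_left_mono)
    finally show "dist (apply_bcontfun (G z) t) (apply_bcontfun (G z') t) \<le> (1 - exp (- L * T)) * dist z z'"
      by (simp add: G s_def)
  qed
  have "\<exists>!z\<in>UNIV. G z = z"
  proof (rule Banach_fix[where c = "1 - exp (- L * T)"])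
    show "0 \<le> 1 - exp (- L * T)" using L T by simp
  qed (use dist complete_UNIV in auto)
  then obtain z where z: "G z = z" by blast
  show ?thesis
  proof
    show "continuous_on {0..T} (\<lambda>t. exp (L * t) *\<^sub>R apply_bcontfun z t)"
      by (intro continuous_intros continuous_on_apply_bcontfun)
    fix t assume t: "t \<in> {0..T}"
    have "apply_bcontfun z t = W z (clamp 0 T t)" using G[of z t] z by simp
    also have "clamp 0 T t = t" using t by (intro clamp_cancel_cbox) auto
    finally show "exp (L * t) *\<^sub>R apply_bcontfun z t = x0 + integral {0..t} (\<lambda>r. F r (exp (L * r) *\<^sub>R apply_bcontfun z r))"
      by (simp add: W_def exp_minus)
  qed
qed

lemma continuous_on_atLeast:
  fixes y :: "real \<Rightarrow> 'a::topological_space"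
  assumes "\<And>T. continuous_on {a..T} y"
  shows "continuous_on {a..} y"
  unfolding continuous_on_eq_continuous_within
proof
  fix t assume t: "t \<in> {a..}"
  have "continuous (at t within {a..t + 1}) y"
    using assms[of "t + 1"] t by (simp add: continuous_on_eq_continuous_within)
  moreover have "at t within {a..} = at t within {a..t + 1}"
    by (rule at_within_nhd[of t "{..<t + 1}"]) auto
  ultimately show "continuous (at t within {a..}) y" by simp
qed

lemma has_integral_vec_iff:
  fixes f :: "real \<Rightarrow> real^'n"
  shows "(f has_integral I) S \<longleftrightarrow> (\<forall>i. ((\<lambda>x. f x $ i) has_integral I $ i) S)"
proof -
  have "(f has_integral I) S \<longleftrightarrow> (\<forall>b\<in>Basis. ((\<lambda>x. f x \<bullet> b) has_integral (I \<bullet> b)) S)"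
    by (rule has_integral_componentwise_iff)
  then show ?thesis by (simp add: Basis_vec_def inner_axis)
qed

lemma dist_le_card_cart:
  fixes a b :: "real^'n"
  assumes "\<And>v. \<bar>a $ v - b $ v\<bar> \<le> c" shows "dist a b \<le> real CARD('n) * c"
proof -
  have "dist a b \<le> (\<Sum>v\<in>UNIV. \<bar>(a - b) $ v\<bar>)" unfolding dist_norm by (rule norm_le_l1_cart)
  also have "\<dots> \<le> (\<Sum>v\<in>(UNIV::'n set). c)" using assms by (intro sum_mono) simp
  finally show ?thesis by simp
qed

section \<open>The scalar equation off the simplex\<close>

lemma g_fun_mono: "x \<le> y \<Longrightarrow> g_fun \<epsilon> x \<le> g_fun \<epsilon> y"
  by (simp add: g_fun_def mult_left_mono)

lemma g_fun_zero [simp]: "g_fun \<epsilon> 0 = 0" by (simp add: g_fun_def)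

lemma g_fun_nonneg: "0 \<le> x \<Longrightarrow> 0 \<le> g_fun \<epsilon> x" using g_fun_mono[of 0 x \<epsilon>] by simp

lemma g_fun_le: assumes "0 < \<epsilon>" "x \<le> \<epsilon>" shows "g_fun \<epsilon> x \<le> \<epsilon>"
proof -
  have "g_fun \<epsilon> x \<le> root 3 (\<epsilon> ^ 3)" using assms by (auto simp: g_fun_def power2_eq_square power3_eq_cube)
  then show ?thesis using assms by (simp add: real_root_power_cancel)
qed

lemma g_fun_ge_half: assumes "0 < \<epsilon>" "\<epsilon> / 8 \<le> x" shows "\<epsilon> / 2 \<le> g_fun \<epsilon> x"
proof -
  have "\<epsilon> / 2 = root 3 ((\<epsilon> / 2) ^ 3)" using assms by (simp add: real_root_power_cancel)
  also have "\<dots> \<le> g_fun \<epsilon> x" using assms by (simp add: g_fun_def power2_eq_square power3_eq_cube)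
  finally show ?thesis .
qed

lemma continuous_on_g_fun [continuous_intros]:
  "continuous_on S f \<Longrightarrow> continuous_on S (\<lambda>x. g_fun \<epsilon> (f x))"
  unfolding g_fun_def by (intro continuous_intros)

text \<open>The power 3/2, extended by 0 to negative arguments. The extension is differentiable
  everywhere, so \<open>decay\<close> needs no case distinction at the time of extinction.\<close>

definition pow32 :: "real \<Rightarrow> real" where
  "pow32 s = max 0 s * sqrt (max 0 s)"

lemma pow32_nonneg: "0 \<le> pow32 s" by (simp add: pow32_def)

lemma pow32_eq_0_iff: "pow32 s = 0 \<longleftrightarrow> s \<le> 0" by (auto simp: pow32_def max_def)

lemma pow32_less: assumes "s < s'" "0 < s'" shows "pow32 s < pow32 s'"
proof (cases "s \<le> 0")
  case False
  then show ?thesis using assms by (auto simp: pow32_def intro!: mult_strict_mono)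
qed (use assms in \<open>auto simp: pow32_def max_def\<close>)

lemma pow32_square: "0 \<le> s \<Longrightarrow> pow32 (s\<^sup>2) = s ^ 3"
  by (simp add: pow32_def max_def power3_eq_cube power2_eq_square)

lemma root3_pow32: "root 3 (pow32 s) = sqrt (max 0 s)"
proof -
  have "pow32 s = sqrt (max 0 s) ^ 3" by (simp add: pow32_def power3_eq_cube mult.assoc[symmetric])
  then show ?thesis by (simp add: real_root_power_cancel)
qed

lemma continuous_on_pow32 [continuous_intros]:
  "continuous_on S f \<Longrightarrow> continuous_on S (\<lambda>x. pow32 (f x))"
  unfolding pow32_def by (intro continuous_intros)

lemma has_derivative_pow32: "(pow32 has_real_derivative (3/2 * sqrt (max 0 s))) (at s)"
proof (cases s "0::real" rule: linorder_cases)
  case less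
  have "((\<lambda>_. 0) has_real_derivative 0) (at s)" by simp
  moreover have "eventually (\<lambda>x. (0::real) = pow32 x) (nhds s)"
    using eventually_nhds_in_open[of "{..<0::real}" s] less
    by (auto elim!: eventually_mono simp: pow32_def max_def)
  ultimately have "(pow32 has_real_derivative 0) (at s)"
    using DERIV_cong_ev[of s s "\<lambda>_. 0" pow32 0 0] by simp
  then show ?thesis using less by (simp add: max_def)
next
  case equal
  have "((\<lambda>h. sqrt (max 0 h)) \<longlongrightarrow> sqrt (max 0 0)) (at (0::real))"
    by (intro tendsto_intros)
  moreover have "eventually (\<lambda>h::real. sqrt (max 0 h) = (pow32 (0 + h) - pow32 0) / h) (at 0)"
    using eventually_neq_at_within[of "0::real" 0]
    by eventually_elim (auto simp: pow32_def max_def)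
  ultimately have "((\<lambda>h::real. (pow32 (0 + h) - pow32 0) / h) \<longlongrightarrow> 0) (at 0)"
    by (auto elim: Lim_transform_eventually)
  then show ?thesis using equal by (simp add: DERIV_def)
next
  case greater
  have "((\<lambda>s. s * sqrt s) has_real_derivative (3/2 * sqrt s)) (at s)"
    using greater by (auto intro!: derivative_eq_intros simp: divide_simps)
  moreover have "eventually (\<lambda>x. x * sqrt x = pow32 x) (nhds s)"
    using eventually_nhds_in_open[of "{0<..}" s] greater
    by (auto elim!: eventually_mono simp: pow32_def max_def)
  ultimately have "(pow32 has_real_derivative (3/2 * sqrt s)) (at s)"
    using DERIV_cong_ev[of s s "\<lambda>s. s * sqrt s" pow32 "3/2 * sqrt s" "3/2 * sqrt s"] by simp
  then show ?thesis using greater by (simp add: max_def)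
qed

text \<open>For \<open>z \<ge> 0\<close> this is the solution of \<open>x' = - g_fun \<epsilon> x\<close> with \<open>x 0 = z\<close>: the power \<open>x\<^bsup>2/3\<^esup>\<close> decays
  linearly until it vanishes.\<close>

definition decay :: "real \<Rightarrow> real \<Rightarrow> real \<Rightarrow> real" where
  "decay \<epsilon> z t = pow32 ((root 3 z)\<^sup>2 - 2/3 * (root 3 \<epsilon>)\<^sup>2 * t)"

lemma decay_0: "0 \<le> z \<Longrightarrow> decay \<epsilon> z 0 = z"
  by (simp add: decay_def pow32_square)

lemma decay_nonneg: "0 \<le> decay \<epsilon> z t" by (simp add: decay_def pow32_nonneg)

lemma decay_eq_0_iff: "decay \<epsilon> z t = 0 \<longleftrightarrow> (root 3 z)\<^sup>2 \<le> 2/3 * (root 3 \<epsilon>)\<^sup>2 * t"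
  by (simp add: decay_def pow32_eq_0_iff)

lemma decay_zero: "0 \<le> t \<Longrightarrow> decay \<epsilon> 0 t = 0" by (simp add: decay_eq_0_iff)

lemma decay_less: assumes "0 < \<epsilon>" "0 < z" "0 < t" shows "decay \<epsilon> z t < z"
proof -
  have "decay \<epsilon> z t < decay \<epsilon> z 0" unfolding decay_def using assms by (intro pow32_less) auto
  then show ?thesis using assms by (simp add: decay_0)
qed

lemma decay_le: assumes "0 < \<epsilon>" "0 \<le> z" "0 \<le> t" shows "decay \<epsilon> z t \<le> z"
  using assms decay_less[of \<epsilon> z t] by (cases "z = 0 \<or> t = 0") (auto simp: decay_0 decay_zero)

lemma continuous_on_decay [continuous_intros]:
  "continuous_on S f \<Longrightarrow> continuous_on S h \<Longrightarrow> continuous_on S (\<lambda>x. decay \<epsilon> (f x) (h x))"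
  unfolding decay_def by (intro continuous_intros)

lemma has_derivative_decay: "(decay \<epsilon> z has_real_derivative (- g_fun \<epsilon> (decay \<epsilon> z t))) (at t)"
proof -
  define q where "q t = (root 3 z)\<^sup>2 - 2/3 * (root 3 \<epsilon>)\<^sup>2 * t" for t
  have "(q has_real_derivative (- (2/3 * (root 3 \<epsilon>)\<^sup>2))) (at t)"
    unfolding q_def by (auto intro!: derivative_eq_intros)
  from DERIV_chain2[where f = pow32 and g = q, OF has_derivative_pow32 this]
  have "(decay \<epsilon> z has_real_derivative (3/2 * sqrt (max 0 (q t)) * (- (2/3 * (root 3 \<epsilon>)\<^sup>2)))) (at t)"
    by (simp add: q_def[abs_def] decay_def[abs_def])
  moreover have "g_fun \<epsilon> (decay \<epsilon> z t) = (root 3 \<epsilon>)\<^sup>2 * sqrt (max 0 (q t))"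
    by (simp add: g_fun_def decay_def q_def real_root_mult real_root_power root3_pow32)
  ultimately show ?thesis by (simp add: algebra_simps)
qed

text \<open>Since \<open>g_fun\<close> is not Lipschitz at 0, Gronwall does not apply. But
  \<open>g_fun\<close> is monotone, so two solutions cannot move apart: their squared distance
  \<open>w\<close> is nonincreasing and starts at 0.\<close>

lemma decay_unique:
  assumes u: "continuous_on {0..T} u" and z: "0 \<le> z"
    and eq: "\<And>t. t \<in> {0..T} \<Longrightarrow> u t = z + integral {0..t} (\<lambda>r. - g_fun \<epsilon> (u r))"
    and t: "t \<in> {0..T}"
  shows "u t = decay \<epsilon> z t"
proof (cases "t = 0")
  case True
  then show ?thesis using eq[of 0] t z by (simp add: decay_0)
next
  case False
  then have t0: "0 < t" using t by auto
  define w where "w t = (u t - decay \<epsilon> z t)\<^sup>2" for t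
  have "w t \<le> w 0"
  proof (rule DERIV_nonpos_imp_decreasing_open[where f = w])
    show "0 \<le> t" using t0 by simp
    have "continuous_on {0..t} u" by (rule continuous_on_subset[OF u]) (use t in auto)
    then show "continuous_on {0..t} w" unfolding w_def by (intro continuous_intros)
    fix s assume s: "0 < s" "s < t"
    have "continuous_on {0..T} (\<lambda>r. - g_fun \<epsilon> (u r))" by (intro continuous_intros u)
    then have "((\<lambda>x. integral {0..x} (\<lambda>r. - g_fun \<epsilon> (u r))) has_real_derivative - g_fun \<epsilon> (u s)) (at s within {0..T})"
      by (rule integral_has_real_derivative) (use s t in auto)
    with s t have "((\<lambda>x. integral {0..x} (\<lambda>r. - g_fun \<epsilon> (u r))) has_real_derivative - g_fun \<epsilon> (u s)) (at s)"
      by (simp add: at_within_Icc_at del: integral_neg)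
    from DERIV_add[OF DERIV_const[of z] this]
    have d: "((\<lambda>x. z + integral {0..x} (\<lambda>r. - g_fun \<epsilon> (u r))) has_real_derivative - g_fun \<epsilon> (u s)) (at s)"
      by (simp only: add_0_left)
    have eqx: "z + integral {0..x} (\<lambda>r. - g_fun \<epsilon> (u r)) = u x" if "x \<in> {0<..<t}" for x
      using that t eq[of x] by simp
    have "(u has_real_derivative - g_fun \<epsilon> (u s)) (at s)"
      by (rule has_field_derivative_transform_within_open[OF d, of "{0<..<t}"]) (use s in simp, use s in simp, rule eqx)
    then have "(w has_real_derivative (2 * (u s - decay \<epsilon> z s) * (- g_fun \<epsilon> (u s) - - g_fun \<epsilon> (decay \<epsilon> z s)))) (at s)"
      unfolding w_def by (auto intro!: derivative_eq_intros has_derivative_decay)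
    moreover have "2 * (u s - decay \<epsilon> z s) * (- g_fun \<epsilon> (u s) - - g_fun \<epsilon> (decay \<epsilon> z s)) \<le> 0"
      using g_fun_mono[of "u s" "decay \<epsilon> z s" \<epsilon>] g_fun_mono[of "decay \<epsilon> z s" "u s" \<epsilon>]
      by (cases "u s \<le> decay \<epsilon> z s") (auto intro: mult_nonpos_nonneg mult_nonneg_nonpos)
    ultimately show "\<exists>y. (w has_real_derivative y) (at s) \<and> y \<le> 0" by blast
  qed
  also have "\<dots> = 0" using eq[of 0] t z by (simp add: w_def decay_0)
  finally show ?thesis by (simp add: w_def)
qed

section \<open>Existence, uniqueness and continuity of the tile flows\<close>

lemma h_fun_eq: assumes "0 < \<epsilon>" shows "h_fun \<epsilon> s = min 1 ((1 + \<epsilon> / 2) * (2 / \<epsilon>) * \<bar>s - \<epsilon>\<bar> - \<epsilon> / 2)"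
proof -
  define c where "c = (1 + \<epsilon> / 2) * (2 / \<epsilon>)"
  \<comment> \<open>The slope is such that the linear branch reaches 1 exactly at distance
    \<open>\<epsilon> / 2\<close>; hence the case distinction is a minimum.\<close>
  have c: "c * (\<epsilon> / 2) - \<epsilon> / 2 = 1" "0 \<le> c" using assms by (simp_all add: c_def field_simps)
  show ?thesis
  proof (cases "\<epsilon> / 2 \<le> \<bar>s - \<epsilon>\<bar>")
    case True
    then have "c * (\<epsilon> / 2) \<le> c * \<bar>s - \<epsilon>\<bar>" by (intro mult_left_mono c)
    then have "1 \<le> c * \<bar>s - \<epsilon>\<bar> - \<epsilon> / 2" using c by linarith
    then show ?thesis using True unfolding h_fun_def c_def by (simp add: min_absorb1)
  next
    case False
    then have "c * \<bar>s - \<epsilon>\<bar> \<le> c * (\<epsilon> / 2)" by (intro mult_left_mono c) simp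
    then have "c * \<bar>s - \<epsilon>\<bar> - \<epsilon> / 2 \<le> 1" using c by linarith
    then show ?thesis using False unfolding h_fun_def c_def by (simp add: min_absorb2)
  qed
qed

lemma h_fun_le_1: "0 < \<epsilon> \<Longrightarrow> h_fun \<epsilon> s \<le> 1" by (simp add: h_fun_eq)

lemma h_fun_ge: assumes "0 < \<epsilon>" shows "- (\<epsilon> / 2) \<le> h_fun \<epsilon> s"
proof -
  have "0 \<le> (1 + \<epsilon> / 2) * (2 / \<epsilon>) * \<bar>s - \<epsilon>\<bar>" using assms by simp
  then show ?thesis unfolding h_fun_eq[OF assms] using assms by linarith
qed

lemma h_fun_lipschitz:
  assumes "0 < \<epsilon>" shows "\<bar>h_fun \<epsilon> s - h_fun \<epsilon> s'\<bar> \<le> (1 + \<epsilon> / 2) * (2 / \<epsilon>) * \<bar>s - s'\<bar>"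
proof -
  define c where "c = (1 + \<epsilon> / 2) * (2 / \<epsilon>)"
  have "0 \<le> c" using assms by (simp add: c_def)
  have "\<bar>c * \<bar>s - \<epsilon>\<bar> - c * \<bar>s' - \<epsilon>\<bar>\<bar> = c * \<bar>\<bar>s - \<epsilon>\<bar> - \<bar>s' - \<epsilon>\<bar>\<bar>"
    using \<open>0 \<le> c\<close> by (simp add: abs_mult flip: right_diff_distrib)
  also have "\<dots> \<le> c * \<bar>s - s'\<bar>" using \<open>0 \<le> c\<close> by (intro mult_left_mono) auto
  finally have "\<bar>c * \<bar>s - \<epsilon>\<bar> - c * \<bar>s' - \<epsilon>\<bar>\<bar> \<le> c * \<bar>s - s'\<bar>" .
  then show ?thesis unfolding h_fun_eq[OF assms] c_def[symmetric] by linarith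
qed

lemma continuous_on_h_fun:
  assumes "0 < \<epsilon>" "continuous_on S f" shows "continuous_on S (\<lambda>x. h_fun \<epsilon> (f x))"
  unfolding h_fun_eq[OF assms(1)] by (intro continuous_intros assms)

lemma theta_le: "theta V \<epsilon> \<omega> x \<le> \<epsilon>" for x :: "real^'v::finite"
  unfolding theta_def by (intro Min_le) auto

lemma theta_le_lower: "u \<in> lower V \<omega> \<Longrightarrow> theta V \<epsilon> \<omega> x \<le> x $ u - \<epsilon>" for x :: "real^'v::finite"
  unfolding theta_def by (intro Min_le) auto

lemma theta_ge:
  fixes x :: "real^'v::finite"
  assumes "c \<le> \<epsilon>" "\<And>u. u \<in> lower V \<omega> \<Longrightarrow> c \<le> x $ u - \<epsilon>" shows "c \<le> theta V \<epsilon> \<omega> x"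
  unfolding theta_def by (subst Min_ge_iff) (use assms in auto)

lemma theta_lipschitz: "\<bar>theta V \<epsilon> \<omega> x - theta V \<epsilon> \<omega> y\<bar> \<le> norm (x - y)" for x :: "real^'v::finite"
proof -
  have "theta V \<epsilon> \<omega> x - norm (x - y) \<le> theta V \<epsilon> \<omega> y" for x y :: "real^'v"
  proof (rule theta_ge)
    show "theta V \<epsilon> \<omega> x - norm (x - y) \<le> \<epsilon>" using theta_le[of V \<epsilon> \<omega> x] norm_ge_zero[of "x - y"] by linarith
    fix u assume "u \<in> lower V \<omega>"
    then have "theta V \<epsilon> \<omega> x \<le> x $ u - \<epsilon>" by (rule theta_le_lower)
    moreover have "\<bar>x $ u - y $ u\<bar> \<le> norm (x - y)" using component_le_norm_cart[of "x - y" u] by simp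
    ultimately show "theta V \<epsilon> \<omega> x - norm (x - y) \<le> y $ u - \<epsilon>" by linarith
  qed
  from this[of x y] this[of y x] show ?thesis by (simp add: norm_minus_commute abs_le_iff)
qed

lemma continuous_on_theta [continuous_intros]:
  fixes f :: "'a::topological_space \<Rightarrow> real^'v::finite"
  assumes "continuous_on S f" shows "continuous_on S (\<lambda>x. theta V \<epsilon> \<omega> (f x))"
proof -
  have "1-lipschitz_on UNIV (theta V \<epsilon> \<omega> :: real^'v \<Rightarrow> real)"
    by (rule lipschitz_onI) (auto simp: dist_norm theta_lipschitz)
  then have "continuous_on UNIV (theta V \<epsilon> \<omega> :: real^'v \<Rightarrow> real)" by (rule lipschitz_on_continuous_on)
  then show ?thesis by (rule continuous_on_compose2) (use assms in auto)
qed

lemma eta_bounds: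
  fixes x :: "real^'v::finite"
  assumes "0 < \<epsilon>" shows "0 \<le> eta V \<epsilon> \<omega> s x \<and> eta V \<epsilon> \<omega> s x \<le> 1"
  using assms by (auto simp: eta_def field_simps)

lemma eta_eq_1: "\<epsilon> / 4 < \<bar>s\<bar> \<Longrightarrow> eta V \<epsilon> \<omega> s x = 1" for x :: "real^'v::finite"
  by (simp add: eta_def)

lemma h_fun_eq_1: "\<epsilon> / 2 \<le> \<bar>s - \<epsilon>\<bar> \<Longrightarrow> h_fun \<epsilon> s = 1"
  by (simp add: h_fun_def)

section \<open>Reduction of a tile field to one scalar equation\<close>

locale tile_ode =
  fixes V :: "'v::finite set set set" and \<epsilon> :: real and \<omega> :: "'v set"
  assumes eps: "0 < \<epsilon>"
    and lower_ne: "lower V \<omega> \<noteq> {}"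
    and lower_upper: "lower V \<omega> \<subseteq> upper V \<omega>"
    and card_diff: "card (upper V \<omega> - lower V \<omega>) \<le> 1"
begin

abbreviation "L \<equiv> lower V \<omega>"
abbreviation "U \<equiv> upper V \<omega>"
abbreviation "f \<equiv> tile_field V \<epsilon> \<omega>"
abbreviation "f0 \<equiv> field_off_lower V \<epsilon> \<omega>"
definition m :: real where "m = real (card L)"

lemma m_pos: "0 < m" using lower_ne by (simp add: m_def card_gt_0_iff)
lemma m_ge_1: "1 \<le> m" using lower_ne by (simp add: m_def card_gt_0_iff Suc_le_eq)

lemma compl_lower: "- L = - U \<union> (U - L)" using lower_upper by auto

lemma sum_compl_lower: "(\<Sum>u\<in>-L. q u) = (\<Sum>u\<in>-U. q u) + (\<Sum>u\<in>U - L. q u)" for q :: "'v \<Rightarrow> real"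
  unfolding compl_lower by (rule sum.union_disjoint) auto

lemma sum_lower_compl: "(\<Sum>u\<in>UNIV. q u) = (\<Sum>u\<in>L. q u) + (\<Sum>u\<in>-L. q u)" for q :: "'v \<Rightarrow> real"
proof -
  have "(\<Sum>u\<in>L \<union> -L. q u) = (\<Sum>u\<in>L. q u) + (\<Sum>u\<in>-L. q u)" by (rule sum.union_disjoint) auto
  then show ?thesis by simp
qed

lemma diff_cases: obtains "U - L = {}" | w where "U - L = {w}"
  using card_diff by (metis One_nat_def card_0_eq card_1_singletonE finite le_Suc_eq le_zero_eq)

lemma tile_field_off: "v \<notin> U \<Longrightarrow> f x $ v = - g_fun \<epsilon> (x $ v)"
  using lower_upper by (auto simp: tile_field_def field_off_lower_def)

lemma tile_field_off_lower: "v \<notin> L \<Longrightarrow> f x $ v = f0 x v"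
  by (simp add: tile_field_def)

lemma tile_field_lower:
  "v \<in> L \<Longrightarrow> f x $ v = x $ v - (\<Sum>u\<in>L. x $ u) / m - (\<Sum>u\<in>-L. f0 x u) / m"
  by (simp add: tile_field_def m_def field_simps add_divide_distrib)

lemma tile_field_sum: "(\<Sum>v\<in>UNIV. f x $ v) = 0"
proof -
  have "(\<Sum>v\<in>L. f x $ v) = (\<Sum>v\<in>L. x $ v - (\<Sum>u\<in>L. x $ u) / m - (\<Sum>u\<in>-L. f0 x u) / m)"
    by (rule sum.cong) (auto simp: tile_field_lower)
  also have "\<dots> = - (\<Sum>u\<in>-L. f0 x u)"
    using lower_ne by (simp add: sum_subtractf m_def)
  finally show ?thesis by (simp add: sum_lower_compl tile_field_off_lower)
qed

text \<open>The condition on the sum of squares in \<open>eta\<close>, expressed by the starting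
  point and the time alone. This is possible because the coordinates off \<open>U\<close> follow
  \<open>decay\<close> whatever the others do.\<close>

definition off_zero :: "real^'v \<Rightarrow> real \<Rightarrow> bool" where
  "off_zero \<xi> t \<longleftrightarrow> (\<forall>u\<in>-U. decay \<epsilon> (\<xi> $ u) t = 0)"

definition off_sum :: "real^'v \<Rightarrow> real \<Rightarrow> real" where
  "off_sum \<xi> t = (\<Sum>u\<in>-U. decay \<epsilon> (\<xi> $ u) t)"

text \<open>The point with coordinate \<open>y\<close> at the vertex of \<open>U - L\<close> on the solution starting at \<open>\<xi>\<close>, at time \<open>t\<close>. The
  coordinates off \<open>U\<close> are known in closed form, the coordinate sum is preserved, and the deviations from the mean
  of the coordinates in \<open>L\<close> grow exactly like \<open>exp t\<close>.\<close>

definition assemble :: "real^'v \<Rightarrow> real \<Rightarrow> real \<Rightarrow> real^'v" where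
  "assemble \<xi> t y = (\<chi> v. if v \<notin> U then decay \<epsilon> (\<xi> $ v) t else if v \<notin> L then y
     else ((\<Sum>u\<in>UNIV. \<xi> $ u) - off_sum \<xi> t - y) / m + exp t * (\<xi> $ v - (\<Sum>u\<in>L. \<xi> $ u) / m))"

definition G :: "real^'v \<Rightarrow> real \<Rightarrow> real \<Rightarrow> real" where
  "G \<xi> t y = h_fun \<epsilon> y + theta V \<epsilon> \<omega> (assemble \<xi> t y) - off_sum \<xi> t"

text \<open>The value of \<open>eta\<close> while some coordinate off \<open>U\<close> is nonzero.
  Its two cases agree at \<open>\<bar>s\<bar> = \<epsilon> / 4\<close>, so this branch is
  continuous.\<close>

definition damp :: "real \<Rightarrow> real" where
  "damp y = min 1 (4 * \<bar>y\<bar> / \<epsilon>)"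

text \<open>The right-hand side for the coordinate of the extra vertex. The factor
  \<open>card (U - L)\<close> is 0 or 1; when there is no extra vertex, the equation becomes trivial
  and needs no separate treatment.\<close>

definition F :: "real^'v \<Rightarrow> real \<Rightarrow> real \<Rightarrow> real" where
  "F \<xi> t y = real (card (U - L)) * (if off_zero \<xi> t then 1 else damp y) * G \<xi> t y"

text \<open>The power 2/3 of each coordinate off \<open>U\<close> decreases linearly until it
  vanishes, and then the coordinate stays 0. The threshold is the largest of these finitely many
  extinction times, or 0.\<close>

lemma off_zero_threshold:
  obtains T where "0 \<le> T" "\<And>t. 0 \<le> t \<Longrightarrow> off_zero \<xi> t \<longleftrightarrow> T \<le> t"
proof
  define b where "b = 2/3 * (root 3 \<epsilon>)\<^sup>2"
  have "0 < b" using eps by (simp add: b_def)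
  define A where "A = insert 0 ((\<lambda>u. (root 3 (\<xi> $ u))\<^sup>2 / b) ` (-U))"
  have A: "finite A" "A \<noteq> {}" "0 \<in> A" by (auto simp: A_def)
  show "0 \<le> Max A" using A by (auto intro: Max_ge)
  fix t :: real assume "0 \<le> t"
  have "decay \<epsilon> (\<xi> $ u) t = 0 \<longleftrightarrow> (root 3 (\<xi> $ u))\<^sup>2 / b \<le> t" for u
    unfolding decay_eq_0_iff b_def[symmetric] using \<open>0 < b\<close> by (simp add: pos_divide_le_eq mult.commute)
  then show "off_zero \<xi> t \<longleftrightarrow> Max A \<le> t"
    using A \<open>0 \<le> t\<close> by (simp add: off_zero_def Max_le_iff A_def)
qed

lemma continuous_on_assemble [continuous_intros]:
  assumes "continuous_on S a" "continuous_on S b" "continuous_on S c"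
  shows "continuous_on S (\<lambda>x. assemble (a x) (b x) (c x))"
  unfolding assemble_def off_sum_def
proof (rule continuous_on_vec_lambda)
  fix v
  show "continuous_on S (\<lambda>x. if v \<notin> U then decay \<epsilon> (a x $ v) (b x) else if v \<notin> L then c x
     else ((\<Sum>u\<in>UNIV. a x $ u) - (\<Sum>u\<in>-U. decay \<epsilon> (a x $ u) (b x)) - c x) / m
       + exp (b x) * (a x $ v - (\<Sum>u\<in>L. a x $ u) / m))"
  proof (cases "v \<in> U")
    case U: True
    show ?thesis
    proof (cases "v \<in> L")
      case True
      have "continuous_on S (\<lambda>x. ((\<Sum>u\<in>UNIV. a x $ u) - (\<Sum>u\<in>-U. decay \<epsilon> (a x $ u) (b x)) - c x) / m
          + exp (b x) * (a x $ v - (\<Sum>u\<in>L. a x $ u) / m))"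
        using m_pos by (intro continuous_intros assms) auto
      then show ?thesis using U True by simp
    qed (use U assms in simp)
  next
    case False
    have "continuous_on S (\<lambda>x. decay \<epsilon> (a x $ v) (b x))" by (intro continuous_intros assms)
    then show ?thesis using False by simp
  qed
qed

lemma continuous_on_G [continuous_intros]:
  assumes "continuous_on S a" "continuous_on S b" "continuous_on S c"
  shows "continuous_on S (\<lambda>x. G (a x) (b x) (c x))"
  unfolding G_def off_sum_def by (intro continuous_intros continuous_on_h_fun eps assms)

lemma continuous_on_damp [continuous_intros]:
  "continuous_on S a \<Longrightarrow> continuous_on S (\<lambda>x. damp (a x))"
  unfolding damp_def using eps by (intro continuous_intros) auto

lemma damp_bounds: "0 \<le> damp y" "damp y \<le> 1" using eps by (auto simp: damp_def)

lemma damp_lipschitz: "\<bar>damp y - damp y'\<bar> \<le> 4 / \<epsilon> * \<bar>y - y'\<bar>"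
proof -
  have "\<bar>4 / \<epsilon> * \<bar>y\<bar> - 4 / \<epsilon> * \<bar>y'\<bar>\<bar> = 4 / \<epsilon> * \<bar>\<bar>y\<bar> - \<bar>y'\<bar>\<bar>"
    unfolding right_diff_distrib[symmetric] abs_mult using eps by simp
  also have "\<dots> \<le> 4 / \<epsilon> * \<bar>y - y'\<bar>" using eps by (intro mult_left_mono) auto
  finally have "\<bar>4 / \<epsilon> * \<bar>y\<bar> - 4 / \<epsilon> * \<bar>y'\<bar>\<bar> \<le> 4 / \<epsilon> * \<bar>y - y'\<bar>" .
  moreover have "\<bar>min 1 a - min 1 b\<bar> \<le> \<bar>a - b\<bar>" for a b :: real by (simp add: min_def)
  ultimately show ?thesis unfolding damp_def times_divide_eq_left[symmetric] by (meson order_trans)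
qed

lemma damp_eq_1: "\<epsilon> / 4 \<le> \<bar>y\<bar> \<Longrightarrow> damp y = 1"
  using eps by (simp add: damp_def field_simps)

lemma norm_assemble_diff: "norm (assemble \<xi> t y - assemble \<xi> t y') \<le> real CARD('v) * \<bar>y - y'\<bar>"
proof -
  have c: "\<bar>(assemble \<xi> t y - assemble \<xi> t y') $ v\<bar> \<le> \<bar>y - y'\<bar>" for v
  proof -
    have "\<bar>a - y - (a - y')\<bar> / m \<le> \<bar>y - y'\<bar>" for a
    proof -
      have "\<bar>y - y'\<bar> \<le> \<bar>y - y'\<bar> * m" using m_ge_1 mult_left_mono[of 1 m "\<bar>y - y'\<bar>"] by simp
      moreover have "\<bar>a - y - (a - y')\<bar> = \<bar>y - y'\<bar>" by linarith
      ultimately show ?thesis using m_pos by (simp add: field_simps)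
    qed
    moreover have "(assemble \<xi> t y - assemble \<xi> t y') $ v =
      ((\<Sum>u\<in>UNIV. \<xi> $ u) - off_sum \<xi> t - y - ((\<Sum>u\<in>UNIV. \<xi> $ u) - off_sum \<xi> t - y')) / m" if "v \<in> L"
      using that lower_upper by (auto simp: assemble_def diff_divide_distrib)
    ultimately show ?thesis using m_pos by (cases "v \<in> L") (auto simp: assemble_def abs_divide)
  qed
  have "norm (assemble \<xi> t y - assemble \<xi> t y') \<le> (\<Sum>v\<in>UNIV. \<bar>(assemble \<xi> t y - assemble \<xi> t y') $ v\<bar>)"
    by (rule norm_le_l1_cart)
  also have "\<dots> \<le> (\<Sum>v\<in>(UNIV::'v set). \<bar>y - y'\<bar>)" by (intro sum_mono c)
  finally show ?thesis by simp
qed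

definition lip_G :: real where
  "lip_G = (1 + \<epsilon> / 2) * (2 / \<epsilon>) + real CARD('v)"

lemma lip_G_nonneg: "0 \<le> lip_G" using eps by (simp add: lip_G_def)

lemma G_lipschitz: "\<bar>G \<xi> t y - G \<xi> t y'\<bar> \<le> lip_G * \<bar>y - y'\<bar>"
  using h_fun_lipschitz[OF eps, of y y'] theta_lipschitz[of V \<epsilon> \<omega> "assemble \<xi> t y" "assemble \<xi> t y'"]
    norm_assemble_diff[of \<xi> t y y']
  unfolding G_def lip_G_def distrib_right by linarith

text \<open>Through \<open>theta\<close> the function \<open>G\<close> is unbounded in
  \<open>y\<close>, so the product is not Lipschitz for general reasons. A bound on \<open>G\<close>
  is needed only where \<open>damp\<close> varies, that is for
  \<open>\<bar>y\<bar> \<le> \<epsilon> / 4\<close>; if both arguments lie outside, the product is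
  just \<open>G\<close>.\<close>

lemma damp_G_lipschitz:
  assumes B: "\<And>y. \<bar>y\<bar> \<le> \<epsilon> / 4 \<Longrightarrow> \<bar>G \<xi> t y\<bar> \<le> B"
  shows "\<bar>damp y * G \<xi> t y - damp y' * G \<xi> t y'\<bar> \<le> (lip_G + 4 / \<epsilon> * B) * \<bar>y - y'\<bar>"
proof -
  have "0 \<le> B" using B[of 0] eps by simp
  have *: "\<bar>damp a * G \<xi> t a - damp b * G \<xi> t b\<bar> \<le> (lip_G + 4 / \<epsilon> * B) * \<bar>a - b\<bar>" if "\<bar>b\<bar> \<le> \<epsilon> / 4" for a b
  proof -
    have "\<bar>damp a * G \<xi> t a - damp b * G \<xi> t b\<bar> = \<bar>damp a * (G \<xi> t a - G \<xi> t b) + (damp a - damp b) * G \<xi> t b\<bar>"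
      by (simp add: algebra_simps)
    also have "\<dots> \<le> \<bar>damp a * (G \<xi> t a - G \<xi> t b)\<bar> + \<bar>(damp a - damp b) * G \<xi> t b\<bar>" by (rule abs_triangle_ineq)
    also have "\<dots> \<le> 1 * (lip_G * \<bar>a - b\<bar>) + (4 / \<epsilon> * \<bar>a - b\<bar>) * B"
      unfolding abs_mult using damp_bounds[of a] G_lipschitz[of \<xi> t a b] damp_lipschitz[of a b] B[OF that] eps
      by (intro add_mono mult_mono) auto
    finally show ?thesis by (simp add: algebra_simps)
  qed
  consider "\<bar>y'\<bar> \<le> \<epsilon> / 4" | "\<bar>y\<bar> \<le> \<epsilon> / 4" | "\<epsilon> / 4 \<le> \<bar>y\<bar>" "\<epsilon> / 4 \<le> \<bar>y'\<bar>" by linarith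
  then show ?thesis
  proof cases
    case 2
    then show ?thesis using *[of y y'] by (simp add: abs_minus_commute)
  next
    case 3
    have "0 \<le> 4 / \<epsilon> * B * \<bar>y - y'\<bar>" using \<open>0 \<le> B\<close> eps by simp
    then show ?thesis using 3 G_lipschitz[of \<xi> t y y'] by (simp add: damp_eq_1 distrib_right)
  qed (rule *)
qed

text \<open>One constant serves all starting points in the unit cube: \<open>G\<close> is
  continuous, hence bounded on the compact set \<open>D\<close>, and \<open>off_zero\<close> merely
  selects one of two functions that are both Lipschitz.\<close>

lemma F_lipschitz:
  obtains c where "0 \<le> c"
    "\<And>\<xi> t y y'. \<xi> \<in> cbox 0 1 \<Longrightarrow> t \<in> {0..T} \<Longrightarrow> \<bar>F \<xi> t y - F \<xi> t y'\<bar> \<le> c * \<bar>y - y'\<bar>"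
proof -
  define D where "D = (cbox 0 1 :: (real^'v) set) \<times> {0..T} \<times> {-\<epsilon>/4..\<epsilon>/4}"
  have "compact ((\<lambda>(\<xi>, t, y). G \<xi> t y) ` D)"
    unfolding D_def case_prod_unfold
    by (intro compact_continuous_image continuous_intros compact_Times) auto
  then have "bounded ((\<lambda>(\<xi>, t, y). G \<xi> t y) ` D)" by (rule compact_imp_bounded)
  then obtain B where B0: "0 < B" and B1: "\<And>p. p \<in> (\<lambda>(\<xi>, t, y). G \<xi> t y) ` D \<Longrightarrow> norm p \<le> B"
    unfolding bounded_pos by blast
  define c where "c = lip_G + 4 / \<epsilon> * B"
  have c0: "0 \<le> c" using lip_G_nonneg B0 eps by (simp add: c_def)
  have "\<bar>F \<xi> t y - F \<xi> t y'\<bar> \<le> c * \<bar>y - y'\<bar>" if "\<xi> \<in> cbox 0 1" "t \<in> {0..T}" for \<xi> t y y'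
  proof -
    have Bt: "\<bar>G \<xi> t z\<bar> \<le> B" if "\<bar>z\<bar> \<le> \<epsilon> / 4" for z
      proof -
      have "G \<xi> t z \<in> (\<lambda>(\<xi>, t, y). G \<xi> t y) ` D"
        by (rule rev_image_eqI[of "(\<xi>, t, z)"]) (use that \<open>\<xi> \<in> cbox 0 1\<close> \<open>t \<in> {0..T}\<close> in \<open>auto simp: D_def abs_le_iff\<close>)
      from B1[OF this] show ?thesis by simp
    qed
    have d: "\<bar>damp y * G \<xi> t y - damp y' * G \<xi> t y'\<bar> \<le> c * \<bar>y - y'\<bar>"
      unfolding c_def by (rule damp_G_lipschitz) (rule Bt)
    have "lip_G * \<bar>y - y'\<bar> \<le> c * \<bar>y - y'\<bar>" using B0 eps by (intro mult_right_mono) (auto simp: c_def)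
    then have g: "\<bar>G \<xi> t y - G \<xi> t y'\<bar> \<le> c * \<bar>y - y'\<bar>" using G_lipschitz[of \<xi> t y y'] by linarith
    define e where "e z = (if off_zero \<xi> t then 1 else damp z) * G \<xi> t z" for z
    have e: "\<bar>e y - e y'\<bar> \<le> c * \<bar>y - y'\<bar>" using d g by (simp add: e_def)
    have "\<bar>F \<xi> t y - F \<xi> t y'\<bar> = real (card (U - L)) * \<bar>e y - e y'\<bar>"
      by (simp add: F_def e_def abs_mult mult.assoc flip: right_diff_distrib)
    also have "\<dots> \<le> 1 * (c * \<bar>y - y'\<bar>)" using e card_diff by (intro mult_mono) auto
    finally show ?thesis by simp
  qed
  then show ?thesis using c0 that by blast
qed

text \<open>Along a continuous curve the integrand is continuous on either side of the threshold of
  \<open>off_zero\<close>, up to its value at one end point.\<close>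

lemma F_integrable:
  assumes "continuous_on {0..T} y"
  shows "(\<lambda>r. F \<xi> r (y r)) integrable_on {0..T}"
proof (cases "0 \<le> T")
  case True
  obtain T0 where T0: "0 \<le> T0" "\<And>t. 0 \<le> t \<Longrightarrow> off_zero \<xi> t \<longleftrightarrow> T0 \<le> t" using off_zero_threshold[of \<xi>] by blast
  define S where "S = min T T0"
  have S: "0 \<le> S" "S \<le> T" using T0 True by (auto simp: S_def)
  have "continuous_on {0..S} y" "continuous_on {S..T} y"
    using S by (auto intro: continuous_on_subset[OF assms])
  then have i: "(\<lambda>r. real (card (U - L)) * damp (y r) * G \<xi> r (y r)) integrable_on {0..S}"
    "(\<lambda>r. real (card (U - L)) * G \<xi> r (y r)) integrable_on {S..T}"
    by (auto intro!: integrable_continuous_real continuous_intros)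
  have "(\<lambda>r. F \<xi> r (y r)) integrable_on {0..S}"
    by (rule integrable_spike_finite[OF _ _ i(1), of "{S}"]) (use T0 in \<open>auto simp: F_def S_def\<close>)
  moreover have "(\<lambda>r. F \<xi> r (y r)) integrable_on {S..T}"
    \<comment> \<open>If the threshold lies beyond \<open>T\<close>, then \<open>S = T\<close> and
      the exceptional point is the whole interval.\<close>
    by (rule integrable_spike_finite[OF _ _ i(2), of "{T}"]) (use T0 in \<open>auto simp: F_def S_def\<close>)
  ultimately show ?thesis using Henstock_Kurzweil_Integration.integrable_combine S by blast
qed (simp add: integrable_on_empty)

lemma diff_eq: assumes "v \<in> U" "v \<notin> L" shows "U - L = {v}"
proof (rule diff_cases)
  assume "U - L = {}"
  then show ?thesis using assms by blast
next
  fix w assume "U - L = {w}"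
  then show ?thesis using assms by (metis DiffI singletonD)
qed

section \<open>The scalar equation: stability, uniqueness, existence\<close>

definition y_start :: "real^'v \<Rightarrow> real" where
  "y_start \<xi> = (\<Sum>u\<in>U - L. \<xi> $ u)"

definition y_solution :: "real^'v \<Rightarrow> real \<Rightarrow> (real \<Rightarrow> real) \<Rightarrow> bool" where
  "y_solution \<xi> T y \<longleftrightarrow> continuous_on {0..T} y \<and>
     (\<forall>t\<in>{0..T}. y t = y_start \<xi> + integral {0..t} (\<lambda>r. F \<xi> r (y r)))"

lemma y_solution_subinterval: assumes "y_solution \<xi> T y" "T' \<le> T" shows "y_solution \<xi> T' y"
proof -
  have "{0..T'} \<subseteq> {0..T}" using assms by auto
  then show ?thesis using assms unfolding y_solution_def by (meson continuous_on_subset subsetD)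
qed

text \<open>The difference of the right-hand sides is split at \<open>F \<xi>' r (y r)\<close>. The
  change of starting point is thus measured along the first solution only, and the rest is absorbed
  by the Lipschitz constant at \<open>\<xi>'\<close>. When \<open>\<xi>'\<close> varies, the error
  integral involves a fixed curve, as dominated convergence requires.\<close>

lemma y_solution_stability:
  assumes y: "y_solution \<xi> T y" and y': "y_solution \<xi>' T y'" and t: "t \<in> {0..T}"
    and c: "0 \<le> c" "\<And>t y y'. t \<in> {0..T} \<Longrightarrow> \<bar>F \<xi>' t y - F \<xi>' t y'\<bar> \<le> c * \<bar>y - y'\<bar>"
    and d: "(\<lambda>r. \<bar>F \<xi> r (y r) - F \<xi>' r (y r)\<bar>) integrable_on {0..T}"
  shows "\<bar>y t - y' t\<bar> \<le>
    (\<bar>y_start \<xi> - y_start \<xi>'\<bar> + integral {0..T} (\<lambda>r. \<bar>F \<xi> r (y r) - F \<xi>' r (y r)\<bar>)) * exp (c * t)"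
proof (rule gronwall[OF _ c(1) _ t])
  have cy: "continuous_on {0..T} y" "continuous_on {0..T} y'" using y y' by (auto simp: y_solution_def)
  then show "continuous_on {0..T} (\<lambda>t. \<bar>y t - y' t\<bar>)" by (intro continuous_intros)
  fix s assume s: "s \<in> {0..T}"
  have sub: "{0..s} \<subseteq> {0..T}" using s by auto
  have i1: "(\<lambda>r. F \<xi> r (y r)) integrable_on {0..s}" "(\<lambda>r. F \<xi>' r (y' r)) integrable_on {0..s}"
    using cy sub by (auto intro!: F_integrable intro: continuous_on_subset)
  have i2: "(\<lambda>r. \<bar>F \<xi> r (y r) - F \<xi>' r (y r)\<bar>) integrable_on {0..s}"
    by (rule integrable_subinterval_real[OF d sub])
  have "continuous_on {0..s} (\<lambda>r. \<bar>y r - y' r\<bar>)"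
    using cy sub by (auto intro!: continuous_intros intro: continuous_on_subset)
  then have i3: "(\<lambda>r. \<bar>y r - y' r\<bar>) integrable_on {0..s}" by (rule integrable_continuous_real)
  have "y s - y' s = y_start \<xi> - y_start \<xi>' + integral {0..s} (\<lambda>r. F \<xi> r (y r) - F \<xi>' r (y' r))"
    using y y' s i1 by (simp add: y_solution_def integral_diff)
  then have "\<bar>y s - y' s\<bar> \<le> \<bar>y_start \<xi> - y_start \<xi>'\<bar> + \<bar>integral {0..s} (\<lambda>r. F \<xi> r (y r) - F \<xi>' r (y' r))\<bar>"
    by linarith
  also have "\<bar>integral {0..s} (\<lambda>r. F \<xi> r (y r) - F \<xi>' r (y' r))\<bar>
    \<le> integral {0..s} (\<lambda>r. \<bar>F \<xi> r (y r) - F \<xi>' r (y r)\<bar> + c * \<bar>y r - y' r\<bar>)"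
    unfolding real_norm_def[symmetric]
  proof (rule integral_norm_bound_integral)
    show "(\<lambda>r. F \<xi> r (y r) - F \<xi>' r (y' r)) integrable_on {0..s}" by (intro integrable_diff i1)
    show "(\<lambda>r. norm (F \<xi> r (y r) - F \<xi>' r (y r)) + c * norm (y r - y' r)) integrable_on {0..s}"
      unfolding real_norm_def by (intro integrable_add i2 integrable_on_mult_right i3)
    fix r assume "r \<in> {0..s}"
    then have "\<bar>F \<xi>' r (y r) - F \<xi>' r (y' r)\<bar> \<le> c * \<bar>y r - y' r\<bar>" using sub by (intro c) auto
    then show "norm (F \<xi> r (y r) - F \<xi>' r (y' r)) \<le> norm (F \<xi> r (y r) - F \<xi>' r (y r)) + c * norm (y r - y' r)"
      unfolding real_norm_def by linarith
  qed
  also have "\<dots> = integral {0..s} (\<lambda>r. \<bar>F \<xi> r (y r) - F \<xi>' r (y r)\<bar>) + c * integral {0..s} (\<lambda>r. \<bar>y r - y' r\<bar>)"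
    using i2 i3 by (subst integral_add) (auto intro: integrable_on_mult_right)
  also have "integral {0..s} (\<lambda>r. \<bar>F \<xi> r (y r) - F \<xi>' r (y r)\<bar>) \<le> integral {0..T} (\<lambda>r. \<bar>F \<xi> r (y r) - F \<xi>' r (y r)\<bar>)"
    by (rule integral_subset_le[OF sub i2 d]) auto
  finally show "\<bar>y s - y' s\<bar> \<le> \<bar>y_start \<xi> - y_start \<xi>'\<bar> + integral {0..T} (\<lambda>r. \<bar>F \<xi> r (y r) - F \<xi>' r (y r)\<bar>)
      + c * integral {0..s} (\<lambda>r. \<bar>y r - y' r\<bar>)" by simp
qed

lemma y_solution_unique:
  assumes "\<xi> \<in> cbox 0 1" "y_solution \<xi> T y" "y_solution \<xi> T y'" "t \<in> {0..T}"
  shows "y t = y' t"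
proof -
  obtain c where c: "0 \<le> c"
    "\<And>\<xi> t y y'. \<xi> \<in> cbox 0 1 \<Longrightarrow> t \<in> {0..T} \<Longrightarrow> \<bar>F \<xi> t y - F \<xi> t y'\<bar> \<le> c * \<bar>y - y'\<bar>"
    using F_lipschitz[of T] by blast
  have "\<bar>y t - y' t\<bar> \<le> (\<bar>y_start \<xi> - y_start \<xi>\<bar> + integral {0..T} (\<lambda>r. \<bar>F \<xi> r (y r) - F \<xi> r (y r)\<bar>)) * exp (c * t)"
    by (rule y_solution_stability[OF assms(2-4) c(1)]) (use c(2) assms(1) in auto)
  then show ?thesis by simp
qed

lemma y_solution_exists:
  assumes "\<xi> \<in> cbox 0 1"
  obtains y where "\<And>T. y_solution \<xi> T y"
proof -
  have ex: "\<exists>y. y_solution \<xi> (real n) y" for n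
  proof -
    obtain c where c: "0 \<le> c"
      "\<And>\<xi> t y y'. \<xi> \<in> cbox 0 1 \<Longrightarrow> t \<in> {0..real n} \<Longrightarrow> \<bar>F \<xi> t y - F \<xi> t y'\<bar> \<le> c * \<bar>y - y'\<bar>"
      using F_lipschitz[of "real n"] by blast
    show ?thesis
    proof (rule picard_lindelof[of "real n" c "F \<xi>" "y_start \<xi>"])
      fix t x y assume "t \<in> {0..real n}"
      then show "norm (F \<xi> t x - F \<xi> t y) \<le> c * norm (x - y)" using c(2)[OF assms] by simp
    qed (use c(1) F_integrable in \<open>auto simp: y_solution_def\<close>)
  qed
  then obtain Y where Y: "\<And>n. y_solution \<xi> (real n) (Y n)" by metis
  \<comment> \<open>By uniqueness the value at \<open>t\<close> is the same for every solution whose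
    interval contains \<open>t\<close>, so the shortest integer interval may be used.\<close>
  define y where "y t = Y (nat \<lceil>t\<rceil>) t" for t
  have yY: "y t = Y n t" if "0 \<le> t" "t \<le> real n" for t n
  proof -
    have "nat \<lceil>t\<rceil> \<le> n" using that by (simp add: nat_le_iff ceiling_le_iff)
    then have "y_solution \<xi> (real (nat \<lceil>t\<rceil>)) (Y n)" by (intro y_solution_subinterval[OF Y]) simp
    moreover have "t \<in> {0..real (nat \<lceil>t\<rceil>)}" using that by (simp add: real_nat_ceiling_ge)
    ultimately show ?thesis unfolding y_def by (intro y_solution_unique[OF assms Y])
  qed
  have sol: "y_solution \<xi> (real n) y" for n
    unfolding y_solution_def
  proof (intro conjI ballI)
    have "continuous_on {0..real n} (Y n)" using Y by (simp add: y_solution_def)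
    then show "continuous_on {0..real n} y" by (rule continuous_on_eq) (rule yY[symmetric], auto)
    fix t assume t: "t \<in> {0..real n}"
    have "y t = y_start \<xi> + integral {0..t} (\<lambda>r. F \<xi> r (Y n r))"
      using Y[of n] t yY[of t n] by (simp add: y_solution_def)
    also have "integral {0..t} (\<lambda>r. F \<xi> r (Y n r)) = integral {0..t} (\<lambda>r. F \<xi> r (y r))"
      by (rule integral_cong) (use t in \<open>simp add: yY[of _ n]\<close>)
    finally show "y t = y_start \<xi> + integral {0..t} (\<lambda>r. F \<xi> r (y r))" .
  qed
  have "y_solution \<xi> T y" for T
    by (rule y_solution_subinterval[OF sol[of "nat \<lceil>T\<rceil>"]]) (simp add: real_nat_ceiling_ge)
  then show ?thesis using that by blast
qed

section \<open>Correspondence between the scalar equation and the tile field\<close>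

lemma sum_lower_assemble:
  "(\<Sum>u\<in>L. assemble \<xi> t y $ u) = (\<Sum>u\<in>UNIV. \<xi> $ u) - off_sum \<xi> t - y"
proof -
  have "(\<Sum>u\<in>L. assemble \<xi> t y $ u) =
    (\<Sum>u\<in>L. ((\<Sum>u\<in>UNIV. \<xi> $ u) - off_sum \<xi> t - y) / m + exp t * (\<xi> $ u - (\<Sum>u\<in>L. \<xi> $ u) / m))"
    using lower_upper by (intro sum.cong) (auto simp: assemble_def)
  also have "\<dots> = m * (((\<Sum>u\<in>UNIV. \<xi> $ u) - off_sum \<xi> t - y) / m) + exp t * ((\<Sum>u\<in>L. \<xi> $ u) - m * ((\<Sum>u\<in>L. \<xi> $ u) / m))"
    by (simp add: sum.distrib sum_subtractf m_def flip: sum_distrib_left)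
  finally show ?thesis using m_pos by simp
qed

lemma off_sum_eq: "off_sum \<xi> t = (\<Sum>u\<in>-U. assemble \<xi> t y $ u)"
  by (auto simp: off_sum_def assemble_def intro!: sum.cong)

lemma off_zero_eq: "off_zero \<xi> t \<longleftrightarrow> (\<Sum>u\<in>-U. (assemble \<xi> t y $ u)\<^sup>2) = 0"
  by (subst sum_nonneg_eq_0_iff) (auto simp: off_zero_def assemble_def)

lemma eta_assemble: "eta V \<epsilon> \<omega> s (assemble \<xi> t y) = (if off_zero \<xi> t then 1 else damp s)"
proof -
  have "damp s = (if \<bar>s\<bar> > \<epsilon> / 4 then 1 else 4 * \<bar>s\<bar> / \<epsilon>)"
    using eps by (auto simp: damp_def min_def field_simps)
  then show ?thesis unfolding eta_def off_zero_eq[of \<xi> t y] by auto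
qed

lemma sum_diff_field: "(\<Sum>w\<in>U - L. f0 (assemble \<xi> t y) w) = F \<xi> t y"
proof (rule diff_cases)
  assume "U - L = {}"
  then show ?thesis unfolding F_def by (simp only: sum.empty card.empty of_nat_0 mult_zero_left)
next
  fix w assume w: "U - L = {w}"
  then have "w \<in> U" "w \<notin> L" by auto
  then have aw: "assemble \<xi> t y $ w = y" by (simp add: assemble_def)
  have "f0 (assemble \<xi> t y) w = (if off_zero \<xi> t then 1 else damp y) * G \<xi> t y"
    using \<open>w \<in> U\<close> by (simp add: field_off_lower_def eta_assemble G_def off_sum_eq[of \<xi> t y, symmetric] aw)
  then show ?thesis using w by (simp add: F_def)
qed

lemma field_lower_assemble:
  assumes "v \<in> L"
  shows "f (assemble \<xi> t y) $ v =
    exp t * (\<xi> $ v - (\<Sum>u\<in>L. \<xi> $ u) / m) - ((\<Sum>u\<in>-U. - g_fun \<epsilon> (decay \<epsilon> (\<xi> $ u) t)) + F \<xi> t y) / m"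
proof -
  have "(\<Sum>u\<in>-U. f0 (assemble \<xi> t y) u) = (\<Sum>u\<in>-U. - g_fun \<epsilon> (decay \<epsilon> (\<xi> $ u) t))"
    by (rule sum.cong) (auto simp: field_off_lower_def assemble_def)
  then have "(\<Sum>u\<in>-L. f0 (assemble \<xi> t y) u) = (\<Sum>u\<in>-U. - g_fun \<epsilon> (decay \<epsilon> (\<xi> $ u) t)) + F \<xi> t y"
    by (simp add: sum_compl_lower sum_diff_field)
  moreover have "assemble \<xi> t y $ v - (\<Sum>u\<in>L. assemble \<xi> t y $ u) / m = exp t * (\<xi> $ v - (\<Sum>u\<in>L. \<xi> $ u) / m)"
    unfolding sum_lower_assemble using assms lower_upper by (auto simp: assemble_def)
  ultimately show ?thesis using tile_field_lower[OF assms, of "assemble \<xi> t y"] by (simp add: add_divide_distrib)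
qed

lemma decay_has_integral:
  assumes "0 \<le> z" "0 \<le> t"
  shows "((\<lambda>r. - g_fun \<epsilon> (decay \<epsilon> z r)) has_integral (decay \<epsilon> z t - z)) {0..t}"
proof -
  have "((\<lambda>r. - g_fun \<epsilon> (decay \<epsilon> z r)) has_integral (decay \<epsilon> z t - decay \<epsilon> z 0)) {0..t}"
    using assms(2) has_derivative_decay[of \<epsilon> z]
    by (intro fundamental_theorem_of_calculus)
      (auto simp: has_real_derivative_iff_has_vector_derivative[symmetric] intro: has_field_derivative_at_within)
  then show ?thesis using assms by (simp add: decay_0)
qed

lemma y_solution_has_integral:
  assumes "y_solution \<xi> T y" "t \<in> {0..T}"
  shows "((\<lambda>r. F \<xi> r (y r)) has_integral (y t - y_start \<xi>)) {0..t}"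
proof -
  have "continuous_on {0..t} y"
    using assms by (auto simp: y_solution_def intro: continuous_on_subset)
  from integrable_integral[OF F_integrable[OF this]] show ?thesis
    using assms by (simp add: y_solution_def)
qed

lemma sum_split: "(\<Sum>u\<in>UNIV. \<xi> $ u) = (\<Sum>u\<in>L. \<xi> $ u) + (\<Sum>u\<in>-U. \<xi> $ u) + y_start \<xi>" for \<xi> :: "real^'v"
  by (simp add: sum_lower_compl sum_compl_lower y_start_def)

lemma assemble_integral_solution:
  assumes \<xi>: "\<xi> \<in> cbox 0 1" and y: "\<And>T. y_solution \<xi> T y"
  shows "integral_solution f \<xi> (\<lambda>t. assemble \<xi> t (y t))"
proof -
  have nn: "0 \<le> \<xi> $ v" for v using \<xi> by (simp add: mem_box_cart)
  have cont: "continuous_on {0..} y"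
    by (rule continuous_on_atLeast) (use y in \<open>simp add: y_solution_def\<close>)
  have main: "((\<lambda>r. f (assemble \<xi> r (y r))) has_integral (assemble \<xi> t (y t) - \<xi>)) {0..t}" if t: "0 \<le> t" for t
    unfolding has_integral_vec_iff
  proof
    fix v
    have Fi: "((\<lambda>r. F \<xi> r (y r)) has_integral (y t - y_start \<xi>)) {0..t}"
      using t by (intro y_solution_has_integral[OF y]) auto
    consider "v \<notin> U" | "v \<in> U" "v \<notin> L" | "v \<in> L" by blast
    then show "((\<lambda>r. f (assemble \<xi> r (y r)) $ v) has_integral ((assemble \<xi> t (y t) - \<xi>) $ v)) {0..t}"
    proof cases
      case 1
      then show ?thesis
        using decay_has_integral[OF nn[of v] t] lower_upper by (auto simp: tile_field_off assemble_def)
    next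
      case 2
      then have w: "U - L = {v}" by (rule diff_eq)
      then have "f (assemble \<xi> r (y r)) $ v = F \<xi> r (y r)" for r
        using sum_diff_field[of \<xi> r "y r"] 2 by (simp add: tile_field_off_lower)
      then show ?thesis using Fi w 2 by (simp add: assemble_def y_start_def)
    next
      case 3
      have e: "((\<lambda>r. exp r) has_integral (exp t - exp 0)) {0..t}"
        using t by (intro fundamental_theorem_of_calculus)
          (auto intro!: derivative_eq_intros simp flip: has_real_derivative_iff_has_vector_derivative)
      have s: "((\<lambda>r. \<Sum>u\<in>-U. - g_fun \<epsilon> (decay \<epsilon> (\<xi> $ u) r)) has_integral (\<Sum>u\<in>-U. decay \<epsilon> (\<xi> $ u) t - \<xi> $ u)) {0..t}"
        by (intro has_integral_sum decay_has_integral nn t) simp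
      have "((\<lambda>r. exp r * (\<xi> $ v - (\<Sum>u\<in>L. \<xi> $ u) / m) - ((\<Sum>u\<in>-U. - g_fun \<epsilon> (decay \<epsilon> (\<xi> $ u) r)) + F \<xi> r (y r)) / m)
        has_integral ((exp t - exp 0) * (\<xi> $ v - (\<Sum>u\<in>L. \<xi> $ u) / m)
          - ((\<Sum>u\<in>-U. decay \<epsilon> (\<xi> $ u) t - \<xi> $ u) + (y t - y_start \<xi>)) / m)) {0..t}"
        by (intro has_integral_diff has_integral_mult_left has_integral_divide has_integral_add e s Fi)
      moreover have "(exp t - exp 0) * (\<xi> $ v - (\<Sum>u\<in>L. \<xi> $ u) / m)
          - ((\<Sum>u\<in>-U. decay \<epsilon> (\<xi> $ u) t - \<xi> $ u) + (y t - y_start \<xi>)) / m = (assemble \<xi> t (y t) - \<xi>) $ v"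
        using 3 lower_upper m_pos
        by (auto simp: assemble_def sum_split[of \<xi>] off_sum_def sum_subtractf field_simps)
      ultimately show ?thesis unfolding field_lower_assemble[OF 3] by simp
    qed
  qed
  show ?thesis
    unfolding integral_solution_def
  proof (intro conjI allI impI)
    show "continuous_on {0..} (\<lambda>t. assemble \<xi> t (y t))" by (intro continuous_intros cont)
    fix t :: real assume "0 \<le> t"
    from main[OF this] show "(\<lambda>r. f (assemble \<xi> r (y r))) integrable_on {0..t}"
      "assemble \<xi> t (y t) = \<xi> + integral {0..t} (\<lambda>r. f (assemble \<xi> r (y r)))"
      by (auto simp: integral_unique)
  qed
qed

lemma integral_solution_component:
  assumes "integral_solution f \<xi> u" "0 \<le> t"
  shows "((\<lambda>r. f (u r) $ v) has_integral (u t $ v - \<xi> $ v)) {0..t}"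
proof -
  have "((\<lambda>r. f (u r)) has_integral (u t - \<xi>)) {0..t}"
    using assms by (auto simp: integral_solution_def intro: integrable_integral)
  then show ?thesis by (simp add: has_integral_vec_iff)
qed

lemma integral_solution_continuous:
  assumes "integral_solution f \<xi> u" shows "continuous_on {0..T} (\<lambda>r. u r $ v)"
  using assms by (auto simp: integral_solution_def intro!: continuous_intros intro: continuous_on_subset)

lemma integral_solution_off:
  assumes u: "integral_solution f \<xi> u" and "0 \<le> \<xi> $ v" "v \<notin> U" "0 \<le> t"
  shows "u t $ v = decay \<epsilon> (\<xi> $ v) t"
proof (rule decay_unique[OF integral_solution_continuous[OF u, of t] assms(2)])
  fix s assume "s \<in> {0..t}"
  then have "((\<lambda>r. - g_fun \<epsilon> (u r $ v)) has_integral (u s $ v - \<xi> $ v)) {0..s}"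
    using integral_solution_component[OF u, of s v] by (simp add: tile_field_off[OF assms(3)])
  from integral_unique[OF this] show "u s $ v = \<xi> $ v + integral {0..s} (\<lambda>r. - g_fun \<epsilon> (u r $ v))" by simp
qed (use assms in auto)

lemma integral_solution_sum:
  assumes u: "integral_solution f \<xi> u" and t: "0 \<le> t"
  shows "(\<Sum>v\<in>UNIV. u t $ v) = (\<Sum>v\<in>UNIV. \<xi> $ v)"
proof -
  have "((\<lambda>r. \<Sum>v\<in>UNIV. f (u r) $ v) has_integral (\<Sum>v\<in>UNIV. u t $ v - \<xi> $ v)) {0..t}"
    by (intro has_integral_sum integral_solution_component[OF u t]) simp
  then have "((\<lambda>r. 0) has_integral (\<Sum>v\<in>UNIV. u t $ v - \<xi> $ v)) {0..t}" by (simp only: tile_field_sum)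
  then have "(\<Sum>v\<in>UNIV. u t $ v - \<xi> $ v) = 0" using has_integral_0 has_integral_unique by blast
  then show ?thesis by (simp add: sum_subtractf)
qed

text \<open>The field components over \<open>L\<close> add up to minus the sum of all others, so the
  correction common to the lower components is their mean. Subtracting the mean leaves the equation
  \<open>D' = D\<close> in integral form, and Gronwall compares \<open>D\<close> with the
  exponential.\<close>

lemma integral_solution_deviation:
  assumes u: "integral_solution f \<xi> u" and t: "0 \<le> t" and v: "v \<in> L"
  shows "u t $ v - (\<Sum>w\<in>L. u t $ w) / m = exp t * (\<xi> $ v - (\<Sum>w\<in>L. \<xi> $ w) / m)"
proof -
  define D where "D r = u r $ v - (\<Sum>w\<in>L. u r $ w) / m" for r
  define D0 where "D0 = \<xi> $ v - (\<Sum>w\<in>L. \<xi> $ w) / m"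
  have D: "(D has_integral (D s - D0)) {0..s}" if s: "0 \<le> s" for s
  proof -
    have "((\<lambda>r. f (u r) $ v - (\<Sum>w\<in>L. f (u r) $ w) / m) has_integral
        ((u s $ v - \<xi> $ v) - (\<Sum>w\<in>L. u s $ w - \<xi> $ w) / m)) {0..s}"
      by (intro has_integral_diff has_integral_divide has_integral_sum integral_solution_component[OF u s]) simp
    moreover have "f x $ v - (\<Sum>w\<in>L. f x $ w) / m = x $ v - (\<Sum>w\<in>L. x $ w) / m" for x
    proof -
      have "(\<Sum>w\<in>L. f x $ w) = - (\<Sum>w\<in>-L. f0 x w)"
        using tile_field_sum[of x] by (simp add: sum_lower_compl tile_field_off_lower)
      then show ?thesis using tile_field_lower[OF v, of x] by simp
    qed
    ultimately show ?thesis
      by (simp add: D_def[abs_def] D0_def sum_subtractf diff_divide_distrib algebra_simps)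
  qed
  have e: "((\<lambda>r. exp r * D0) has_integral (exp s * D0 - D0)) {0..s}" if "0 \<le> s" for s
  proof -
    have "((\<lambda>r. exp r * D0) has_integral (exp s * D0 - exp 0 * D0)) {0..s}"
      using that by (intro fundamental_theorem_of_calculus)
        (auto intro!: derivative_eq_intros simp flip: has_real_derivative_iff_has_vector_derivative)
    then show ?thesis by simp
  qed
  have cont: "continuous_on {0..t} (\<lambda>r. \<bar>D r - exp r * D0\<bar>)"
    unfolding D_def using m_pos by (intro continuous_intros integral_solution_continuous[OF u]) auto
  have "\<bar>D t - exp t * D0\<bar> \<le> 0 * exp (1 * t)"
  proof (rule gronwall[OF cont])
    fix s assume s: "s \<in> {0..t}"
    have i: "((\<lambda>r. D r - exp r * D0) has_integral (D s - D0 - (exp s * D0 - D0))) {0..s}"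
      using s by (intro has_integral_diff D e) auto
    have "norm (integral {0..s} (\<lambda>r. D r - exp r * D0)) \<le> integral {0..s} (\<lambda>r. \<bar>D r - exp r * D0\<bar>)"
    proof (rule integral_norm_bound_integral)
      show "(\<lambda>r. D r - exp r * D0) integrable_on {0..s}" using i by blast
      have "continuous_on {0..s} (\<lambda>r. \<bar>D r - exp r * D0\<bar>)"
        by (rule continuous_on_subset[OF cont]) (use s in auto)
      then show "(\<lambda>r. \<bar>D r - exp r * D0\<bar>) integrable_on {0..s}" by (rule integrable_continuous_real)
    qed simp
    then show "\<bar>D s - exp s * D0\<bar> \<le> 0 + 1 * integral {0..s} (\<lambda>r. \<bar>D r - exp r * D0\<bar>)"
      using integral_unique[OF i] by simp
  qed (use t in auto)
  then show ?thesis by (simp add: D_def D0_def)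
qed

text \<open>The coordinates off \<open>U\<close>, the total mass and the deviations obey equations
  that are uniquely solvable without knowledge of the coordinate at the extra vertex. Uniqueness for
  the discontinuous field thereby reduces to the scalar equation.\<close>

lemma integral_solution_assemble:
  assumes u: "integral_solution f \<xi> u" and \<xi>: "\<xi> \<in> cbox 0 1" and t: "0 \<le> t"
  shows "u t = assemble \<xi> t (\<Sum>w\<in>U - L. u t $ w)"
proof (rule vec_eq_iff[THEN iffD2], rule)
  fix v
  have nn: "0 \<le> \<xi> $ v" for v using \<xi> by (simp add: mem_box_cart)
  consider "v \<notin> U" | "v \<in> U" "v \<notin> L" | "v \<in> L" by blast
  then show "u t $ v = assemble \<xi> t (\<Sum>w\<in>U - L. u t $ w) $ v"
  proof cases
    case 1
    then show ?thesis using integral_solution_off[OF u nn 1 t] by (simp add: assemble_def)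
  next
    case 2
    then show ?thesis using diff_eq[OF 2] by (simp add: assemble_def)
  next
    case 3
    have "(\<Sum>w\<in>-U. u t $ w) = off_sum \<xi> t"
      unfolding off_sum_def by (intro sum.cong integral_solution_off[OF u nn _ t]) auto
    then have "(\<Sum>w\<in>L. u t $ w) = (\<Sum>w\<in>UNIV. \<xi> $ w) - off_sum \<xi> t - (\<Sum>w\<in>U - L. u t $ w)"
      using integral_solution_sum[OF u t] sum_split[of "u t"] by (simp add: y_start_def)
    then show ?thesis using integral_solution_deviation[OF u t 3] 3 lower_upper by (auto simp: assemble_def)
  qed
qed

lemma integral_solution_y:
  assumes u: "integral_solution f \<xi> u" and \<xi>: "\<xi> \<in> cbox 0 1"
  shows "y_solution \<xi> T (\<lambda>t. \<Sum>w\<in>U - L. u t $ w)"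
  unfolding y_solution_def
proof (intro conjI ballI)
  show "continuous_on {0..T} (\<lambda>t. \<Sum>w\<in>U - L. u t $ w)"
    by (intro continuous_intros integral_solution_continuous[OF u])
  fix t assume "t \<in> {0..T}"
  then have t: "0 \<le> t" by simp
  have "((\<lambda>r. \<Sum>w\<in>U - L. f (u r) $ w) has_integral (\<Sum>w\<in>U - L. u t $ w - \<xi> $ w)) {0..t}"
    by (intro has_integral_sum integral_solution_component[OF u t]) simp
  moreover have "(\<Sum>w\<in>U - L. f (u r) $ w) = F \<xi> r (\<Sum>w\<in>U - L. u r $ w)" if "r \<in> {0..t}" for r
  proof -
    have "(\<Sum>w\<in>U - L. f (u r) $ w) = (\<Sum>w\<in>U - L. f0 (u r) w)" by (intro sum.cong) (auto simp: tile_field_off_lower)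
    also have "\<dots> = (\<Sum>w\<in>U - L. f0 (assemble \<xi> r (\<Sum>w\<in>U - L. u r $ w)) w)"
      using integral_solution_assemble[OF u \<xi>, of r] that by simp
    finally show ?thesis by (simp only: sum_diff_field)
  qed
  ultimately have "((\<lambda>r. F \<xi> r (\<Sum>w\<in>U - L. u r $ w)) has_integral (\<Sum>w\<in>U - L. u t $ w - \<xi> $ w)) {0..t}"
    by (rule has_integral_eq[rotated]) simp
  then show "(\<Sum>w\<in>U - L. u t $ w) = y_start \<xi> + integral {0..t} (\<lambda>r. F \<xi> r (\<Sum>w\<in>U - L. u r $ w))"
    by (simp add: integral_unique y_start_def sum_subtractf)
qed

lemma integral_solution_unique:
  assumes "\<xi> \<in> cbox 0 1" "integral_solution f \<xi> u" "integral_solution f \<xi> u'" "0 \<le> t"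
  shows "u t = u' t"
proof -
  have "(\<Sum>w\<in>U - L. u t $ w) = (\<Sum>w\<in>U - L. u' t $ w)"
    by (rule y_solution_unique[OF assms(1) integral_solution_y integral_solution_y, where T = t]) (use assms in auto)
  then show ?thesis using assms integral_solution_assemble by metis
qed

section \<open>The tile flow and its semigroup law\<close>

abbreviation "\<psi> \<equiv> tile_flow V \<epsilon> \<omega>"

lemma tile_flow_eqI:
  assumes "\<xi> \<in> cbox 0 1" "integral_solution f \<xi> u" "0 \<le> t"
  shows "\<psi> t \<xi> = u t"
  unfolding tile_flow_def
  by (rule the_equality) (use assms integral_solution_unique in blast)+

lemma tile_flow_assemble:
  assumes "\<xi> \<in> cbox 0 1"
  obtains y where "\<And>T. y_solution \<xi> T y" "\<And>t. 0 \<le> t \<Longrightarrow> \<psi> t \<xi> = assemble \<xi> t (y t)"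
  using y_solution_exists[OF assms] tile_flow_eqI[OF assms assemble_integral_solution[OF assms]] by metis

lemma integral_solution_cong:
  assumes "integral_solution f \<xi> u" "\<And>t. 0 \<le> t \<Longrightarrow> u t = u' t"
  shows "integral_solution f \<xi> u'"
  unfolding integral_solution_def
proof (intro conjI allI impI)
  show "continuous_on {0..} u'"
    using assms by (auto simp: integral_solution_def intro: continuous_on_eq)
  fix t :: real assume t: "0 \<le> t"
  have "(\<lambda>r. f (u r)) integrable_on {0..t}" "u t = \<xi> + integral {0..t} (\<lambda>r. f (u r))"
    using assms(1) t by (auto simp: integral_solution_def)
  moreover have "f (u r) = f (u' r)" if "r \<in> {0..t}" for r using assms(2) that by simp
  ultimately show "(\<lambda>r. f (u' r)) integrable_on {0..t}" "u' t = \<xi> + integral {0..t} (\<lambda>r. f (u' r))"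
    using assms(2)[OF t] integrable_cong[of "{0..t}" "\<lambda>r. f (u r)" "\<lambda>r. f (u' r)"]
      integral_cong[of "{0..t}" "\<lambda>r. f (u r)" "\<lambda>r. f (u' r)"] by auto
qed

lemma tile_flow_solution:
  assumes "\<xi> \<in> cbox 0 1" shows "integral_solution f \<xi> (\<lambda>t. \<psi> t \<xi>)"
proof -
  obtain y where y: "\<And>T. y_solution \<xi> T y" using y_solution_exists[OF assms] by blast
  from assemble_integral_solution[OF assms this] show ?thesis
    by (rule integral_solution_cong) (rule tile_flow_eqI[OF assms assemble_integral_solution[OF assms y], symmetric])
qed

lemma tile_flow_0: assumes "\<xi> \<in> cbox 0 1" shows "\<psi> 0 \<xi> = \<xi>"
  using tile_flow_solution[OF assms] by (simp add: integral_solution_def)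

lemma tile_flow_increment:
  assumes "\<xi> \<in> cbox 0 1" "0 \<le> s" "s \<le> t"
  shows "((\<lambda>r. f (\<psi> r \<xi>) $ v) has_integral (\<psi> t \<xi> $ v - \<psi> s \<xi> $ v)) {s..t}"
proof -
  note c = integral_solution_component[OF tile_flow_solution[OF assms(1)], of _ v]
  have t: "((\<lambda>r. f (\<psi> r \<xi>) $ v) has_integral (\<psi> t \<xi> $ v - \<xi> $ v)) {0..t}" using c[of t] assms by simp
  have s: "((\<lambda>r. f (\<psi> r \<xi>) $ v) has_integral (\<psi> s \<xi> $ v - \<xi> $ v)) {0..s}" using c[of s] assms by simp
  have "(\<lambda>r. f (\<psi> r \<xi>) $ v) integrable_on {s..t}"
    by (rule integrable_subinterval_real[OF has_integral_integrable[OF t]]) (use assms in auto)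
  then obtain I where I: "((\<lambda>r. f (\<psi> r \<xi>) $ v) has_integral I) {s..t}" by blast
  have "((\<lambda>r. f (\<psi> r \<xi>) $ v) has_integral (\<psi> s \<xi> $ v - \<xi> $ v + I)) {0..t}"
    by (rule has_integral_combine[OF _ _ s I]) (use assms in auto)
  from has_integral_unique[OF this t] have "I = \<psi> t \<xi> $ v - \<psi> s \<xi> $ v" by simp
  then show ?thesis using I by simp
qed

text \<open>The shifted curve solves the equation from \<open>\<psi> s \<xi>\<close>. That point is
  required to lie in the unit cube because uniqueness is established only from there; on the tiles
  this holds as long as the orbit is in the realization.\<close>

lemma tile_flow_add:
  assumes "\<xi> \<in> cbox 0 1" "\<psi> s \<xi> \<in> cbox 0 1" "0 \<le> s" "0 \<le> t"
  shows "\<psi> t (\<psi> s \<xi>) = \<psi> (t + s) \<xi>"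
proof (rule tile_flow_eqI[OF assms(2) _ assms(4)])
  show "integral_solution f (\<psi> s \<xi>) (\<lambda>t. \<psi> (t + s) \<xi>)"
    unfolding integral_solution_def
  proof (intro conjI allI impI)
    have "continuous_on {0..} (\<lambda>t. \<psi> t \<xi>)" using tile_flow_solution[OF assms(1)] by (simp add: integral_solution_def)
    then show "continuous_on {0..} (\<lambda>t. \<psi> (t + s) \<xi>)"
      by (rule continuous_on_compose2) (use assms in \<open>auto intro!: continuous_intros\<close>)
    fix t :: real assume t: "0 \<le> t"
    have "((\<lambda>r. f (\<psi> r \<xi>)) has_integral (\<psi> (t + s) \<xi> - \<psi> s \<xi>)) {s..t + s}"
      unfolding has_integral_vec_iff using tile_flow_increment[OF assms(1,3), of "t + s"] t by simp
    then have "((\<lambda>r. f (\<psi> (r + s) \<xi>)) has_integral (\<psi> (t + s) \<xi> - \<psi> s \<xi>)) {0..t}"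
      using has_integral_shift_Icc_real[of "\<lambda>r. f (\<psi> r \<xi>)" s "\<psi> (t + s) \<xi> - \<psi> s \<xi>" 0 t]
      by (simp add: o_def add.commute)
    then show "(\<lambda>r. f (\<psi> (r + s) \<xi>)) integrable_on {0..t}"
      "\<psi> (t + s) \<xi> = \<psi> s \<xi> + integral {0..t} (\<lambda>r. f (\<psi> (r + s) \<xi>))"
      by (auto simp: integral_unique)
  qed
qed

section \<open>Continuous dependence on the starting point\<close>

lemma off_zero_eventually_eq:
  assumes \<xi>: "(\<lambda>n. \<Xi> n) \<longlonglongrightarrow> \<xi>"
    and T0: "\<And>t. 0 \<le> t \<Longrightarrow> off_zero \<xi> t \<longleftrightarrow> T0 \<le> t" and "0 \<le> T0" and r: "0 \<le> r" "r \<noteq> T0"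
  shows "eventually (\<lambda>n. off_zero (\<Xi> n) r \<longleftrightarrow> off_zero \<xi> r) sequentially"
proof -
  define b where "b = 2/3 * (root 3 \<epsilon>)\<^sup>2"
  have "0 < b" using eps by (simp add: b_def)
  have lim: "(\<lambda>n. (root 3 (\<Xi> n $ u))\<^sup>2) \<longlonglongrightarrow> (root 3 (\<xi> $ u))\<^sup>2" for u
    by (intro tendsto_intros \<xi>)
  show ?thesis
  \<comment> \<open>After \<open>T0\<close> every extinction condition of the limit holds strictly,
    and before \<open>T0\<close> one of them fails strictly; both persist for nearby starting
    points. At \<open>T0\<close> itself there is no margin.\<close>
  proof (cases "T0 < r")
    case True
    have "eventually (\<lambda>n. (root 3 (\<Xi> n $ u))\<^sup>2 < b * r) sequentially" if "u \<in> -U" for u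
    proof (rule order_tendstoD(2)[OF lim])
      have "off_zero \<xi> T0" using T0 \<open>0 \<le> T0\<close> by simp
      then have "(root 3 (\<xi> $ u))\<^sup>2 \<le> b * T0" using that by (simp add: off_zero_def decay_eq_0_iff b_def)
      also have "\<dots> < b * r" using True \<open>0 < b\<close> by simp
      finally show "(root 3 (\<xi> $ u))\<^sup>2 < b * r" .
    qed
    then have "eventually (\<lambda>n. \<forall>u\<in>-U. (root 3 (\<Xi> n $ u))\<^sup>2 < b * r) sequentially"
      by (intro eventually_ball_finite) auto
    then show ?thesis
    proof eventually_elim
      case (elim n)
      then have "off_zero (\<Xi> n) r" unfolding off_zero_def decay_eq_0_iff b_def[symmetric] by (simp add: less_imp_le)
      then show ?case using T0[of r] r True by simp
    qed
  next
    case False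
    then have "\<not> off_zero \<xi> r" using T0[of r] r by simp
    then obtain u where u: "u \<in> -U" "\<not> (root 3 (\<xi> $ u))\<^sup>2 \<le> b * r" by (auto simp: off_zero_def decay_eq_0_iff b_def)
    then have "eventually (\<lambda>n. b * r < (root 3 (\<Xi> n $ u))\<^sup>2) sequentially"
      by (intro order_tendstoD(1)[OF lim]) simp
    then show ?thesis
    proof eventually_elim
      case (elim n)
      then have "\<not> decay \<epsilon> (\<Xi> n $ u) r = 0" unfolding decay_eq_0_iff b_def[symmetric] by simp
      then show ?case using u \<open>\<not> off_zero \<xi> r\<close> by (auto simp: off_zero_def)
    qed
  qed
qed

lemma abs_F_le: "\<bar>F \<xi> t y\<bar> \<le> \<bar>G \<xi> t y\<bar>"
proof -
  have "\<bar>real (card (U - L)) * (if off_zero \<xi> t then 1 else damp y)\<bar> \<le> 1 * 1"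
    unfolding abs_mult using card_diff damp_bounds[of y] by (intro mult_mono) auto
  then have "\<bar>F \<xi> t y\<bar> \<le> 1 * \<bar>G \<xi> t y\<bar>" unfolding F_def abs_mult[of _ "G \<xi> t y"] by (intro mult_right_mono) auto
  then show ?thesis by simp
qed

text \<open>For a fixed curve the integrand tends to 0 at every time except the threshold
  \<open>T0\<close>, where the switches may disagree. Compactness of the unit cube times
  \<open>{0..T}\<close> supplies the bound for dominated convergence.\<close>

lemma F_difference_integral_tendsto_0:
  assumes y: "continuous_on {0..T} y" and \<xi>: "\<Xi> \<longlonglongrightarrow> \<xi>" and box: "\<And>n. \<Xi> n \<in> cbox 0 1" "\<xi> \<in> cbox 0 1"
  shows "(\<lambda>r. \<bar>F (\<Xi> n) r (y r) - F \<xi> r (y r)\<bar>) integrable_on {0..T}"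
    and "(\<lambda>n. integral {0..T} (\<lambda>r. \<bar>F (\<Xi> n) r (y r) - F \<xi> r (y r)\<bar>)) \<longlonglongrightarrow> 0"
proof -
  have "compact ((\<lambda>p. G (fst p) (snd p) (y (snd p))) ` (cbox 0 1 \<times> {0..T}))"
    by (intro compact_continuous_image continuous_intros compact_Times continuous_on_compose2[OF y]) auto
  then have "bounded ((\<lambda>p. G (fst p) (snd p) (y (snd p))) ` (cbox 0 1 \<times> {0..T}))" by (rule compact_imp_bounded)
  then obtain B where B: "\<And>p. p \<in> (\<lambda>p. G (fst p) (snd p) (y (snd p))) ` (cbox 0 1 \<times> {0..T}) \<Longrightarrow> norm p \<le> B"
    unfolding bounded_iff by blast
  have FB: "\<bar>F \<zeta> r (y r)\<bar> \<le> B" if "\<zeta> \<in> cbox 0 1" "r \<in> {0..T}" for \<zeta> r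
  proof -
    have "G \<zeta> r (y r) \<in> (\<lambda>p. G (fst p) (snd p) (y (snd p))) ` (cbox 0 1 \<times> {0..T})"
      by (rule rev_image_eqI[of "(\<zeta>, r)"]) (use that in auto)
    from B[OF this] show ?thesis using abs_F_le[of \<zeta> r "y r"] by simp
  qed
  have bound: "\<bar>F (\<Xi> n) r (y r) - F \<xi> r (y r)\<bar> \<le> 2 * B" if "r \<in> {0..T}" for n r
    using FB[OF box(1)[of n] that] FB[OF box(2) that] by linarith
  have int: "(\<lambda>r. \<bar>F (\<Xi> n) r (y r) - F \<xi> r (y r)\<bar>) integrable_on {0..T}" for n
  proof -
    have "(\<lambda>r. F (\<Xi> n) r (y r) - F \<xi> r (y r)) absolutely_integrable_on {0..T}"
      by (rule absolutely_integrable_integrable_bound[where g = "\<lambda>_. 2 * B"])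
        (use bound in \<open>auto intro!: integrable_diff F_integrable y\<close>)
    then show ?thesis by (simp add: absolutely_integrable_on_def)
  qed
  then show "(\<lambda>r. \<bar>F (\<Xi> n) r (y r) - F \<xi> r (y r)\<bar>) integrable_on {0..T}" .
  obtain T0 where T0: "0 \<le> T0" "\<And>t. 0 \<le> t \<Longrightarrow> off_zero \<xi> t \<longleftrightarrow> T0 \<le> t" using off_zero_threshold[of \<xi>] by blast
  \<comment> \<open>Overwriting the value at \<open>T0\<close> gives convergence at every point
    without changing the integral.\<close>
  define q where "q n r = (if r = T0 then 0 else \<bar>F (\<Xi> n) r (y r) - F \<xi> r (y r)\<bar>)" for n r
  have qint: "q n integrable_on {0..T}" "integral {0..T} (q n) = integral {0..T} (\<lambda>r. \<bar>F (\<Xi> n) r (y r) - F \<xi> r (y r)\<bar>)" for n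
    by (rule integrable_spike_finite[OF _ _ int, of "{T0}"], simp_all add: q_def)
      (rule integral_spike[of "{T0}"], simp_all add: q_def)
  have "(\<lambda>n. integral {0..T} (q n)) \<longlonglongrightarrow> integral {0..T} (\<lambda>_. 0)"
  proof (rule dominated_convergence(2)[where h = "\<lambda>_. 2 * B"])
    fix r assume r: "r \<in> {0..T}"
    show "norm (q n r) \<le> 2 * B" for n using bound[OF r, of n] FB[OF box(2) r] by (auto simp: q_def)
    show "(\<lambda>n. q n r) \<longlonglongrightarrow> 0"
    proof (cases "r = T0")
      case False
      define k where "k = real (card (U - L)) * (if off_zero \<xi> r then 1 else damp (y r))"
      have "(\<lambda>n. G (\<Xi> n) r (y r)) \<longlonglongrightarrow> G \<xi> r (y r)"
        by (rule continuous_on_tendsto_compose[of UNIV "\<lambda>z. G z r (y r)"]) (auto intro!: continuous_intros \<xi>)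
      then have "(\<lambda>n. \<bar>k * G (\<Xi> n) r (y r) - k * G \<xi> r (y r)\<bar>) \<longlonglongrightarrow> \<bar>k * G \<xi> r (y r) - k * G \<xi> r (y r)\<bar>"
        by (intro tendsto_intros)
      moreover have "eventually (\<lambda>n. \<bar>k * G (\<Xi> n) r (y r) - k * G \<xi> r (y r)\<bar> = q n r) sequentially"
      proof -
        have "0 \<le> r" using r by simp
        then have "eventually (\<lambda>n. off_zero (\<Xi> n) r \<longleftrightarrow> off_zero \<xi> r) sequentially"
          by (intro off_zero_eventually_eq[OF \<xi> _ T0(1) _ False] T0(2))
        then show ?thesis
          by eventually_elim (simp add: q_def False k_def F_def)
      qed
      ultimately show ?thesis by (auto elim: Lim_transform_eventually)
    qed (simp add: q_def)
  qed (auto intro: qint)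
  then show "(\<lambda>n. integral {0..T} (\<lambda>r. \<bar>F (\<Xi> n) r (y r) - F \<xi> r (y r)\<bar>)) \<longlonglongrightarrow> 0" by (simp add: qint)
qed

lemma tile_flow_tendsto:
  assumes \<xi>: "\<Xi> \<longlonglongrightarrow> \<xi>" "\<And>n. \<Xi> n \<in> cbox 0 1" and s: "s \<longlonglongrightarrow> t" "\<And>n. 0 \<le> s n"
  shows "(\<lambda>n. \<psi> (s n) (\<Xi> n)) \<longlonglongrightarrow> \<psi> t \<xi>"
proof -
  have box: "\<xi> \<in> cbox 0 1" using closed_sequentially[OF closed_cbox] \<xi> by blast
  have t: "0 \<le> t" using s by (intro LIMSEQ_le_const) auto
  have "Bseq s" using s(1) by (intro convergent_imp_Bseq) (auto simp: convergent_def)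
  then obtain T where T: "\<And>n. \<bar>s n\<bar> \<le> T" by (auto simp: Bseq_def)
  have sT: "s n \<in> {0..T}" for n using s(2)[of n] T[of n] by simp
  then have tT: "t \<in> {0..T}" using closed_sequentially[OF closed_real_atLeastAtMost _ s(1)] by blast
  obtain y where y: "\<And>T. y_solution \<xi> T y" "\<And>t. 0 \<le> t \<Longrightarrow> \<psi> t \<xi> = assemble \<xi> t (y t)"
    using tile_flow_assemble[OF box] by blast
  have "\<exists>y. (\<forall>T. y_solution (\<Xi> n) T y) \<and> (\<forall>t\<ge>0. \<psi> t (\<Xi> n) = assemble (\<Xi> n) t (y t))" for n
  proof (rule tile_flow_assemble[OF \<xi>(2)[of n]])
    fix y assume "\<And>T. y_solution (\<Xi> n) T y" "\<And>t. 0 \<le> t \<Longrightarrow> \<psi> t (\<Xi> n) = assemble (\<Xi> n) t (y t)"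
    then show ?thesis by (intro exI[of _ y] conjI allI impI)
  qed
  then have "\<exists>Y. \<forall>n. (\<forall>T. y_solution (\<Xi> n) T (Y n)) \<and> (\<forall>t\<ge>0. \<psi> t (\<Xi> n) = assemble (\<Xi> n) t (Y n t))"
    by (intro choice allI)
  then obtain Y where Y: "\<And>n T. y_solution (\<Xi> n) T (Y n)" "\<And>n t. 0 \<le> t \<Longrightarrow> \<psi> t (\<Xi> n) = assemble (\<Xi> n) t (Y n t)"
    by blast
  obtain c where c: "0 \<le> c"
    "\<And>\<xi> t y y'. \<xi> \<in> cbox 0 1 \<Longrightarrow> t \<in> {0..T} \<Longrightarrow> \<bar>F \<xi> t y - F \<xi> t y'\<bar> \<le> c * \<bar>y - y'\<bar>"
    using F_lipschitz[of T] by blast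
  have cy: "continuous_on {0..T} y" using y(1) by (simp add: y_solution_def)
  define I where "I n = integral {0..T} (\<lambda>r. \<bar>F (\<Xi> n) r (y r) - F \<xi> r (y r)\<bar>)" for n
  have I: "I \<longlonglongrightarrow> 0" unfolding I_def by (rule F_difference_integral_tendsto_0(2)[OF cy \<xi> box])
  have est: "\<bar>y (s n) - Y n (s n)\<bar> \<le> (\<bar>y_start \<xi> - y_start (\<Xi> n)\<bar> + I n) * exp (c * s n)" for n
  proof -
    have I_eq: "I n = integral {0..T} (\<lambda>r. \<bar>F \<xi> r (y r) - F (\<Xi> n) r (y r)\<bar>)"
      unfolding I_def by (simp only: abs_minus_commute)
    show ?thesis
      unfolding I_eq
    proof (rule y_solution_stability[where \<xi>' = "\<Xi> n" and y' = "Y n"])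
      show "(\<lambda>r. \<bar>F \<xi> r (y r) - F (\<Xi> n) r (y r)\<bar>) integrable_on {0..T}"
        using F_difference_integral_tendsto_0(1)[OF cy \<xi> box, of n] by (simp only: abs_minus_commute)
      show "\<bar>F (\<Xi> n) t z - F (\<Xi> n) t z'\<bar> \<le> c * \<bar>z - z'\<bar>" if "t \<in> {0..T}" for t z z'
        by (rule c(2)[OF \<xi>(2) that])
    qed (rule y(1) Y(1) sT c(1))+
  qed
  have "(\<lambda>n. (\<bar>y_start \<xi> - y_start (\<Xi> n)\<bar> + I n) * exp (c * s n)) \<longlonglongrightarrow> (\<bar>y_start \<xi> - y_start \<xi>\<bar> + 0) * exp (c * t)"
    unfolding y_start_def by (intro tendsto_intros \<xi> I s)
  then have "(\<lambda>n. (\<bar>y_start \<xi> - y_start (\<Xi> n)\<bar> + I n) * exp (c * s n)) \<longlonglongrightarrow> 0" by simp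
  then have "(\<lambda>n. y (s n) - Y n (s n)) \<longlonglongrightarrow> 0"
    by (rule Lim_null_comparison[rotated]) (simp add: est)
  moreover have "(\<lambda>n. y (s n)) \<longlonglongrightarrow> y t"
    by (rule continuous_on_tendsto_compose[OF cy s(1) tT]) (use sT in auto)
  ultimately have "(\<lambda>n. y (s n) - (y (s n) - Y n (s n))) \<longlonglongrightarrow> y t - 0" by (intro tendsto_diff)
  then have Yn: "(\<lambda>n. Y n (s n)) \<longlonglongrightarrow> y t" by simp
  have "continuous_on UNIV (\<lambda>p. assemble (fst p) (fst (snd p)) (snd (snd p)))" by (intro continuous_intros)
  from continuous_on_tendsto_compose[OF this tendsto_Pair[OF \<xi>(1) tendsto_Pair[OF s(1) Yn]]]
  have "(\<lambda>n. assemble (\<Xi> n) (s n) (Y n (s n))) \<longlonglongrightarrow> assemble \<xi> t (y t)" by simp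
  then show ?thesis using y(2)[OF t] Y(2)[OF s(2)] by simp
qed

end

section \<open>Geometry of the flow tiles\<close>

locale tiled_complex =
  fixes K :: "'v::finite set set" and V :: "'v set set set" and \<epsilon> :: real
  assumes complex: "abstract_complex K"
    and cvf: "combinatorial_vector_field K V"
    and eps_pos: "0 < \<epsilon>"
    and eps_small: "\<epsilon> < 1 / (6 * real CARD('v))"
begin

abbreviation "X \<equiv> realization K"
abbreviation "lo \<equiv> lower V"
abbreviation "up \<equiv> upper V"
abbreviation "Tile \<equiv> tile K V \<epsilon>"
abbreviation "\<sigma>min \<equiv> sigma_min \<epsilon>"
abbreviation "\<sigma>max \<equiv> sigma_max \<epsilon>"

lemma eps_card: "6 * real CARD('v) * \<epsilon> < 1"
  using eps_small by (simp add: field_simps)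

lemma eps_le: "6 * \<epsilon> < 1"
proof -
  have "6 * \<epsilon> \<le> 6 * real CARD('v) * \<epsilon>" using eps_pos by simp
  then show ?thesis using eps_card by linarith
qed

lemma card_eps: "6 * (real (card S) * \<epsilon>) < 1" for S :: "'v set"
proof -
  have "real (card S) * \<epsilon> \<le> real CARD('v) * \<epsilon>"
    using eps_pos by (intro mult_right_mono) (auto intro: card_mono)
  then show ?thesis using eps_card by linarith
qed

lemma in_K_nonempty: "\<sigma> \<in> K \<Longrightarrow> \<sigma> \<noteq> {}"
  using complex unfolding abstract_complex_def by blast

lemma in_K_subset: "\<sigma> \<in> K \<Longrightarrow> \<tau> \<subseteq> \<sigma> \<Longrightarrow> \<tau> \<noteq> {} \<Longrightarrow> \<tau> \<in> K"
  using complex unfolding abstract_complex_def by blast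

section \<open>The pairing of simplices given by the vector field\<close>

lemma partition: "partition_on K V"
  using cvf by (simp add: combinatorial_vector_field_def)

lemma vector_unique: "A \<in> V \<Longrightarrow> B \<in> V \<Longrightarrow> \<omega> \<in> A \<Longrightarrow> \<omega> \<in> B \<Longrightarrow> A = B"
  using disjointD[OF partition_onD2[OF partition], of A B] by blast

lemma facet_card: "facet \<tau> \<sigma> \<Longrightarrow> card \<sigma> = Suc (card \<tau>)" for \<tau> \<sigma> :: "'v set"
  by (auto simp: facet_def simplex_dim_def)

lemma facet_neq: "facet \<tau> \<sigma> \<Longrightarrow> \<tau> \<noteq> \<sigma>" for \<tau> \<sigma> :: "'v set"
  using facet_card[of \<tau> \<sigma>] by auto

lemma lower_upper_critical: "critical V \<omega> \<Longrightarrow> lo \<omega> = \<omega> \<and> up \<omega> = \<omega>"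
  by (simp add: lower_def upper_def)

text \<open>The definite descriptions in \<open>lower\<close> and \<open>upper\<close> have unique
  solutions: a simplex lies in only one member of \<open>V\<close>, and the two simplices of an
  arrow differ in size, so the pair can be read in one order only.\<close>

lemma lower_upper_arrow:
  assumes "arrow V \<tau> \<sigma>" "\<omega> \<in> {\<tau>, \<sigma>}"
  shows "lo \<omega> = \<tau> \<and> up \<omega> = \<sigma>"
proof -
  have A: "{\<tau>, \<sigma>} \<in> V" "facet \<tau> \<sigma>" using assms by (auto simp: arrow_def)
  have "\<not> critical V \<omega>"
  proof
    assume "critical V \<omega>"
    then have "{\<omega>} = {\<tau>, \<sigma>}"
      using A(1) assms(2) vector_unique[of "{\<omega>}" "{\<tau>, \<sigma>}" \<omega>] unfolding critical_def by blast
    then have "\<tau> = \<sigma>" by blast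
    then show False using facet_neq[OF A(2)] by blast
  qed
  moreover have uniq: "\<tau>' = \<tau> \<and> \<sigma>' = \<sigma>" if t: "arrow V \<tau>' \<sigma>'" "\<omega> \<in> {\<tau>', \<sigma>'}" for \<tau>' \<sigma>'
  proof -
    have A': "{\<tau>', \<sigma>'} \<in> V" "facet \<tau>' \<sigma>'" using t by (auto simp: arrow_def)
    have "{\<tau>', \<sigma>'} = {\<tau>, \<sigma>}" by (rule vector_unique[OF A'(1) A(1) t(2) assms(2)])
    then show ?thesis
      using facet_card[OF A(2)] facet_card[OF A'(2)] by (auto simp: doubleton_eq_iff)
  qed
  moreover have "(THE \<tau>. \<exists>\<sigma>. arrow V \<tau> \<sigma> \<and> \<omega> \<in> {\<tau>, \<sigma>}) = \<tau>"
    by (rule the_equality) (use assms uniq in blast)+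
  moreover have "(THE \<sigma>. \<exists>\<tau>. arrow V \<tau> \<sigma> \<and> \<omega> \<in> {\<tau>, \<sigma>}) = \<sigma>"
    by (rule the_equality) (use assms uniq in blast)+
  ultimately show ?thesis by (simp add: lower_def upper_def)
qed

lemma vector_cases:
  assumes "\<omega> \<in> K"
  obtains "critical V \<omega>" | \<tau> \<sigma> where "arrow V \<tau> \<sigma>" "\<omega> \<in> {\<tau>, \<sigma>}"
proof -
  obtain A where A: "A \<in> V" "\<omega> \<in> A" using assms partition by (auto simp: partition_on_def)
  then consider \<sigma> where "A = {\<sigma>}" | \<tau> \<sigma> where "A = {\<tau>, \<sigma>}" "facet \<tau> \<sigma>"
    using cvf by (auto simp: combinatorial_vector_field_def)
  then show ?thesis using A that by cases (auto simp: critical_def arrow_def)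
qed

lemma arrow_in_K: "arrow V \<tau> \<sigma> \<Longrightarrow> \<tau> \<in> K \<and> \<sigma> \<in> K"
  using partition by (auto simp: arrow_def partition_on_def)

lemma lower_upper_props:
  assumes "\<omega> \<in> K"
  shows "lo \<omega> \<in> K \<and> up \<omega> \<in> K \<and> lo \<omega> \<subseteq> \<omega> \<and> \<omega> \<subseteq> up \<omega> \<and> card (up \<omega>) \<le> Suc (card (lo \<omega>))"
  using assms
proof (cases rule: vector_cases)
  case 1
  then show ?thesis using assms lower_upper_critical[of \<omega>] by simp
next
  case (2 \<tau> \<sigma>)
  then have "lo \<omega> = \<tau>" "up \<omega> = \<sigma>" "\<tau> \<subseteq> \<sigma>" "card \<sigma> = Suc (card \<tau>)"
    using lower_upper_arrow[of \<tau> \<sigma> \<omega>] facet_card[of \<tau> \<sigma>] by (auto simp: arrow_def facet_def)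
  then show ?thesis using 2 arrow_in_K[of \<tau> \<sigma>] by auto
qed

lemma lower_in_K: "\<omega> \<in> K \<Longrightarrow> lo \<omega> \<in> K"
  and upper_in_K: "\<omega> \<in> K \<Longrightarrow> up \<omega> \<in> K"
  and lower_subset: "\<omega> \<in> K \<Longrightarrow> lo \<omega> \<subseteq> \<omega>"
  and subset_upper: "\<omega> \<in> K \<Longrightarrow> \<omega> \<subseteq> up \<omega>"
  and card_upper: "\<omega> \<in> K \<Longrightarrow> card (up \<omega>) \<le> Suc (card (lo \<omega>))"
  using lower_upper_props by blast+

lemma lower_subset_upper: "\<omega> \<in> K \<Longrightarrow> lo \<omega> \<subseteq> up \<omega>"
  using lower_upper_props by blast

lemma lower_upper_same:
  assumes "\<omega> \<in> K" "\<omega>' = lo \<omega> \<or> \<omega>' = up \<omega>"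
  shows "lo \<omega>' = lo \<omega> \<and> up \<omega>' = up \<omega>"
  using assms(1)
proof (cases rule: vector_cases)
  case 1
  then show ?thesis using assms lower_upper_critical[of \<omega>] by auto
next
  case (2 \<tau> \<sigma>)
  then have "\<omega>' \<in> {\<tau>, \<sigma>}" using assms(2) lower_upper_arrow[of \<tau> \<sigma> \<omega>] by auto
  then show ?thesis using 2 lower_upper_arrow[of \<tau> \<sigma>] by simp
qed

lemma lower_nonempty: "\<omega> \<in> K \<Longrightarrow> lo \<omega> \<noteq> {}"
  using lower_in_K in_K_nonempty by blast

lemma card_upper_diff: "\<omega> \<in> K \<Longrightarrow> card (up \<omega> - lo \<omega>) \<le> 1"
  using card_upper lower_subset_upper by (simp add: card_Diff_subset le_diff_conv)

lemma upper_diff_eq: assumes "\<omega> \<in> K" "w \<in> up \<omega>" "w \<notin> lo \<omega>" shows "up \<omega> = insert w (lo \<omega>)"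
proof -
  have "card (up \<omega> - lo \<omega>) \<le> Suc 0" using card_upper_diff[OF assms(1)] by simp
  then have "\<forall>a\<in>up \<omega> - lo \<omega>. \<forall>b\<in>up \<omega> - lo \<omega>. a = b"
    by (subst (asm) card_le_Suc0_iff_eq) auto
  then show ?thesis using assms lower_subset_upper[OF assms(1)] by blast
qed

lemma between_lower_upper:
  assumes "\<omega> \<in> K" "lo \<omega> \<subseteq> \<rho>" "\<rho> \<subseteq> up \<omega>"
  shows "\<rho> = lo \<omega> \<or> \<rho> = up \<omega>"
proof (cases "\<rho> \<subseteq> lo \<omega>")
  case False
  then obtain w where w: "w \<in> \<rho>" "w \<notin> lo \<omega>" by blast
  then have "up \<omega> = insert w (lo \<omega>)" using assms by (intro upper_diff_eq) auto
  then have "up \<omega> \<subseteq> \<rho>" using assms(2) w(1) by simp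
  then show ?thesis using assms(3) by simp
qed (use assms in blast)

section \<open>The realization, closed cells and tiles in coordinates\<close>

lemma X_nonneg: "x \<in> X \<Longrightarrow> 0 \<le> x $ v" by (simp add: realization_def)

lemma X_sum: "x \<in> X \<Longrightarrow> (\<Sum>v\<in>UNIV. x $ v) = 1" by (simp add: realization_def)

lemma X_support: "x \<in> X \<Longrightarrow> {v. x $ v > 0} \<in> K" by (simp add: realization_def)

lemma X_sum_le: assumes "x \<in> X" shows "(\<Sum>v\<in>S. x $ v) \<le> 1"
  using sum_mono2[of UNIV S "($) x"] X_nonneg[OF assms] X_sum[OF assms] by simp

lemma X_le_1: "x \<in> X \<Longrightarrow> x $ v \<le> 1" using X_sum_le[of x "{v}"] by simp

lemma X_big_coordinate: assumes "x \<in> X" obtains v where "\<epsilon> < x $ v"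
proof -
  have "\<exists>v. \<epsilon> < x $ v"
  proof (rule ccontr)
    assume "\<not> ?thesis"
    then have "(\<Sum>v\<in>UNIV. x $ v) \<le> (\<Sum>v\<in>(UNIV::'v set). \<epsilon>)" by (intro sum_mono) (auto simp: not_less)
    then show False using X_sum[OF assms] card_eps[of UNIV] by simp
  qed
  then show ?thesis using that by blast
qed

lemma sigma_min_in_K: assumes "x \<in> X" shows "\<sigma>min x \<in> K"
proof -
  obtain v where "\<epsilon> < x $ v" using X_big_coordinate[OF assms] .
  then have "\<sigma>min x \<noteq> {}" by (auto simp: sigma_min_def)
  moreover have "\<sigma>min x \<subseteq> {v. 0 < x $ v}" using eps_pos by (auto simp: sigma_min_def)
  ultimately show ?thesis using in_K_subset[OF X_support[OF assms]] by blast
qed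

text \<open>The support condition in the definition is not of a closed form; as a finite union of
  closed faces the realization is visibly closed.\<close>

lemma realization_eq:
  "X = (\<Union>\<sigma>\<in>K. {x. (\<forall>v. 0 \<le> x $ v) \<and> (\<Sum>v\<in>UNIV. x $ v) = 1 \<and> (\<forall>v\<in>-\<sigma>. x $ v = 0)})"
proof (intro equalityI subsetI)
  fix x assume x: "x \<in> X"
  then have "x $ v = 0" if "\<not> 0 < x $ v" for v
    using X_nonneg[of x v] that by linarith
  then show "x \<in> (\<Union>\<sigma>\<in>K. {x. (\<forall>v. 0 \<le> x $ v) \<and> (\<Sum>v\<in>UNIV. x $ v) = 1 \<and> (\<forall>v\<in>-\<sigma>. x $ v = 0)})"
    using X_nonneg[OF x] X_sum[OF x] X_support[OF x] by (intro UN_I[of "{v. x $ v > 0}"]) auto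
next
  fix x :: "real^'v" assume "x \<in> (\<Union>\<sigma>\<in>K. {x. (\<forall>v. 0 \<le> x $ v) \<and> (\<Sum>v\<in>UNIV. x $ v) = 1 \<and> (\<forall>v\<in>-\<sigma>. x $ v = 0)})"
  then obtain \<sigma> where s: "\<sigma> \<in> K" "\<And>v. 0 \<le> x $ v" "(\<Sum>v\<in>UNIV. x $ v) = 1" "\<And>v. v \<notin> \<sigma> \<Longrightarrow> x $ v = 0" by auto
  have "{v. 0 < x $ v} \<noteq> {}"
  proof
    assume "{v. 0 < x $ v} = {}"
    then have n: "\<not> 0 < x $ v" for v by blast
    have "x $ v = 0" for v using s(2)[of v] n[of v] by linarith
    then show False using s(3) by simp
  qed
  moreover have "{v. 0 < x $ v} \<subseteq> \<sigma>" using s(4) by force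
  ultimately show "x \<in> X" using s in_K_subset[OF s(1)] by (simp add: realization_def)
qed

lemma closed_X: "closed X"
proof -
  have "finite K" using complex by (simp add: abstract_complex_def)
  moreover have "closed {x::real^'v. (\<forall>v. 0 \<le> x $ v) \<and> (\<Sum>v\<in>UNIV. x $ v) = 1 \<and> (\<forall>v\<in>-\<sigma>. x $ v = 0)}" for \<sigma>
    unfolding Ball_def
    by (intro closed_Collect_conj closed_Collect_all closed_Collect_imp open_Collect_const closed_Collect_le
        closed_Collect_eq continuous_intros)
  ultimately show ?thesis unfolding realization_eq by auto
qed

text \<open>For the harder inclusion the point is moved towards the barycentre \<open>b\<close> of
  \<open>\<sigma>\<close>. All vertices of \<open>\<sigma>\<close> already lie in its support, so
  the support is unchanged and the segment stays in \<open>X\<close>. The inequalities become strict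
  because the coordinates of \<open>b\<close> exceed \<open>\<epsilon>\<close> on
  \<open>\<sigma>\<close> and vanish elsewhere.\<close>

lemma closed_cell_eq:
  assumes "\<sigma> \<noteq> {}"
  shows "closed_cell K \<epsilon> \<sigma> = {x \<in> X. (\<forall>v\<in>\<sigma>. \<epsilon> \<le> x $ v) \<and> (\<forall>v\<in>-\<sigma>. x $ v \<le> \<epsilon>)}" (is "_ = ?R")
proof
  have "closed ({x. (\<forall>v\<in>\<sigma>. \<epsilon> \<le> x $ v) \<and> (\<forall>v\<in>-\<sigma>. x $ v \<le> \<epsilon>)})"
    unfolding Ball_def
    by (intro closed_Collect_conj closed_Collect_all closed_Collect_imp open_Collect_const closed_Collect_le
        continuous_intros)
  then have "closedin (top_of_set X) (X \<inter> {x. (\<forall>v\<in>\<sigma>. \<epsilon> \<le> x $ v) \<and> (\<forall>v\<in>-\<sigma>. x $ v \<le> \<epsilon>)})"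
    by (rule closedin_closed_Int)
  then show "closed_cell K \<epsilon> \<sigma> \<subseteq> ?R"
    unfolding closed_cell_def by (intro closure_of_minimal) (auto simp: cell_def less_imp_le Int_def)
next
  show "?R \<subseteq> closed_cell K \<epsilon> \<sigma>"
  proof
    fix x assume x: "x \<in> ?R"
    define b :: "real^'v" where "b = (\<chi> v. if v \<in> \<sigma> then 1 / real (card \<sigma>) else 0)"
    \<comment> \<open>The weights start at 1/2, so that they lie strictly between 0 and 1 for every
      \<open>n\<close>.\<close>
    define y where "y n = (1 - 1 / real (Suc (Suc n))) *\<^sub>R x + (1 / real (Suc (Suc n))) *\<^sub>R b" for n
    have cpos: "0 < real (card \<sigma>)" using assms by (simp add: card_gt_0_iff)
    have "\<epsilon> < 1 / real (card \<sigma>)" using card_eps[of \<sigma>] cpos eps_pos by (simp add: field_simps)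
    have bsum: "(\<Sum>v\<in>UNIV. b $ v) = 1" using cpos assms by (simp add: b_def flip: sum.If_cases sum.inter_filter)
    have bnn: "0 \<le> b $ v" for v using cpos by (simp add: b_def)
    have yin: "y n \<in> cell K \<epsilon> \<sigma>" for n
    proof -
      define t where "t = 1 / real (Suc (Suc n))"
      have t: "0 < t" "t < 1" by (auto simp: t_def)
      have yv: "y n $ v = (1 - t) * x $ v + t * b $ v" for v by (simp add: y_def t_def)
      have xX: "x \<in> X" using x by simp
      have "{v. 0 < y n $ v} = {v. 0 < x $ v}"
      proof (intro Collect_cong)
        fix v
        show "0 < y n $ v \<longleftrightarrow> 0 < x $ v"
        proof (cases "v \<in> \<sigma>")
          case True
          then have "0 < x $ v" using x eps_pos by force
          then show ?thesis unfolding yv using t bnn[of v] by (simp add: add_pos_nonneg)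
        next
          case False
          then show ?thesis unfolding yv using t by (simp add: b_def zero_less_mult_iff)
        qed
      qed
      moreover have "0 \<le> y n $ v" for v unfolding yv using t bnn[of v] X_nonneg[OF xX] by simp
      moreover have "(\<Sum>v\<in>UNIV. y n $ v) = 1"
        unfolding yv by (simp add: sum.distrib bsum X_sum[OF xX] flip: sum_distrib_left)
      ultimately have "y n \<in> X" using X_support[OF xX] by (simp add: realization_def)
      moreover have "\<epsilon> < y n $ v" if "v \<in> \<sigma>" for v
      proof -
        have "(1 - t) * \<epsilon> + t * \<epsilon> < (1 - t) * x $ v + t * b $ v"
          using that x t \<open>\<epsilon> < 1 / real (card \<sigma>)\<close>
          by (intro add_le_less_mono mult_left_mono mult_strict_left_mono) (auto simp: b_def)
        then show ?thesis unfolding yv by (simp add: algebra_simps)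
      qed
      moreover have "y n $ v < \<epsilon>" if "v \<notin> \<sigma>" for v
      proof -
        have "(1 - t) * x $ v \<le> (1 - t) * \<epsilon>" using that x t by (intro mult_left_mono) auto
        also have "\<dots> < \<epsilon>" using t eps_pos by simp
        finally show ?thesis using that by (simp add: yv b_def)
      qed
      ultimately show ?thesis by (simp add: cell_def)
    qed
    have "(\<lambda>n. 1 / real (Suc (Suc n))) \<longlonglongrightarrow> 0"
      using LIMSEQ_Suc[OF LIMSEQ_inverse_real_of_nat] by (simp add: inverse_eq_divide)
    then have "y \<longlonglongrightarrow> (1 - 0) *\<^sub>R x + 0 *\<^sub>R b" unfolding y_def by (intro tendsto_intros)
    then have "y \<longlonglongrightarrow> x" by simp
    then have "x \<in> closure (cell K \<epsilon> \<sigma>)" using yin closure_sequential by blast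
    then show "x \<in> closed_cell K \<epsilon> \<sigma>"
      using x by (simp add: closed_cell_def closure_of_subtopology) (metis (no_types, lifting) Int_absorb1 cell_def mem_Collect_eq subsetI)
  qed
qed

text \<open>Lower and upper simplex differ by at most one vertex, and its coordinate lies on one
  side of \<open>\<epsilon>\<close> or the other; the two closed cells together therefore leave it
  unconstrained.\<close>

lemma tile_iff:
  assumes "\<omega> \<in> K"
  shows "x \<in> Tile \<omega> \<longleftrightarrow> x \<in> X \<and> (\<forall>v\<in>lo \<omega>. \<epsilon> \<le> x $ v) \<and> (\<forall>v\<in>-up \<omega>. x $ v \<le> \<epsilon>)"
proof -
  have "(\<forall>v\<in>up \<omega> - lo \<omega>. \<epsilon> \<le> x $ v) \<or> (\<forall>v\<in>up \<omega> - lo \<omega>. x $ v \<le> \<epsilon>)"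
  proof (cases "up \<omega> - lo \<omega> = {}")
    case False
    then obtain w where "w \<in> up \<omega>" "w \<notin> lo \<omega>" by blast
    then have "up \<omega> - lo \<omega> = {w}" using upper_diff_eq[OF assms, of w] by blast
    then show ?thesis by auto
  qed auto
  note dich = this
  have sub: "lo \<omega> \<subseteq> up \<omega>" by (rule lower_subset_upper[OF assms])
  have "x \<in> Tile \<omega> \<longleftrightarrow> x \<in> X \<and> ((\<forall>v\<in>lo \<omega>. \<epsilon> \<le> x $ v) \<and> (\<forall>v\<in>-lo \<omega>. x $ v \<le> \<epsilon>) \<or>
      (\<forall>v\<in>up \<omega>. \<epsilon> \<le> x $ v) \<and> (\<forall>v\<in>-up \<omega>. x $ v \<le> \<epsilon>))"
    unfolding tile_def Un_iff closed_cell_eq[OF in_K_nonempty[OF lower_in_K[OF assms]]]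
      closed_cell_eq[OF in_K_nonempty[OF upper_in_K[OF assms]]] by blast
  also have "\<dots> \<longleftrightarrow> x \<in> X \<and> (\<forall>v\<in>lo \<omega>. \<epsilon> \<le> x $ v) \<and> (\<forall>v\<in>-up \<omega>. x $ v \<le> \<epsilon>)"
    using dich sub by blast
  finally show ?thesis .
qed

text \<open>The interior of a flow tile relative to \<open>X\<close>: its points lie in no other flow tile.\<close>

definition inner :: "'v set \<Rightarrow> (real^'v) set" where
  "inner \<omega> = {x \<in> X. (\<forall>v\<in>lo \<omega>. \<epsilon> < x $ v) \<and> (\<forall>v\<in>-up \<omega>. x $ v < \<epsilon>)}"

text \<open>Comparing coordinates gives \<open>lo \<omega>' \<subseteq> up \<omega>\<close> and
  \<open>lo \<omega> \<subseteq> up \<omega>'\<close>. As an upper simplex has at most one extra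
  vertex, \<open>lo \<omega>\<close> or \<open>up \<omega>\<close> then lies between
  \<open>lo \<omega>'\<close> and \<open>up \<omega>'\<close> and equals one of them. So the two
  vectors share a simplex and coincide.\<close>

lemma tile_inner_unique:
  assumes "\<omega> \<in> K" "\<omega>' \<in> K" "x \<in> Tile \<omega>" "x \<in> inner \<omega>'"
  shows "lo \<omega> = lo \<omega>' \<and> up \<omega> = up \<omega>'"
proof -
  have x: "\<forall>v\<in>lo \<omega>. \<epsilon> \<le> x $ v" "\<forall>v\<in>-up \<omega>. x $ v \<le> \<epsilon>"
    "\<forall>v\<in>lo \<omega>'. \<epsilon> < x $ v" "\<forall>v\<in>-up \<omega>'. x $ v < \<epsilon>"
    using assms by (auto simp: tile_iff inner_def)
  have "lo \<omega>' \<subseteq> up \<omega>" "lo \<omega> \<subseteq> up \<omega>'" using x by force+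
  moreover have "lo \<omega>' \<subseteq> lo \<omega> \<or> up \<omega> \<subseteq> up \<omega>'"
  proof (cases "lo \<omega>' \<subseteq> lo \<omega>")
    case False
    then obtain w where w: "w \<in> lo \<omega>'" "w \<notin> lo \<omega>" by blast
    then have "up \<omega> = insert w (lo \<omega>)" using \<open>lo \<omega>' \<subseteq> up \<omega>\<close> assms by (intro upper_diff_eq) auto
    moreover have "w \<in> up \<omega>'" using w lower_subset_upper[OF assms(2)] by blast
    ultimately show ?thesis using \<open>lo \<omega> \<subseteq> up \<omega>'\<close> by simp
  qed blast
  ultimately have "lo \<omega> = lo \<omega>' \<or> lo \<omega> = up \<omega>' \<or> up \<omega> = lo \<omega>' \<or> up \<omega> = up \<omega>'"
    using between_lower_upper[OF assms(2), of "lo \<omega>"] between_lower_upper[OF assms(2), of "up \<omega>"]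
      lower_subset_upper[OF assms(1)] by blast
  then show ?thesis
    using lower_upper_same[OF assms(1), of "lo \<omega>"] lower_upper_same[OF assms(1), of "up \<omega>"]
      lower_upper_same[OF assms(2), of "lo \<omega>'"] lower_upper_same[OF assms(2), of "up \<omega>'"] by auto
qed

lemma in_tile_sigma_min: assumes "x \<in> X" shows "x \<in> Tile (\<sigma>min x)"
proof -
  note k = sigma_min_in_K[OF assms]
  have "\<epsilon> \<le> x $ v" if "v \<in> lo (\<sigma>min x)" for v
    using lower_subset[OF k] that by (auto simp: sigma_min_def)
  moreover have "x $ v \<le> \<epsilon>" if "v \<notin> up (\<sigma>min x)" for v
  proof -
    have "v \<notin> \<sigma>min x" using subset_upper[OF k] that by blast
    then show ?thesis by (simp add: sigma_min_def)
  qed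
  ultimately show ?thesis using assms by (simp add: tile_iff[OF k])
qed

lemma lower_sigma_min: "x \<in> X \<Longrightarrow> v \<in> lo (\<sigma>min x) \<Longrightarrow> \<epsilon> < x $ v"
  using lower_subset[OF sigma_min_in_K[of x]] unfolding sigma_min_def by blast

lemma two_tiles_not_inner:
  assumes "x \<in> X" "2 \<le> card {C \<in> flow_tiles K V \<epsilon>. x \<in> C}"
  shows "x \<notin> inner (\<sigma>min x)"
proof
  assume i: "x \<in> inner (\<sigma>min x)"
  have "C = Tile (\<sigma>min x)" if C: "C \<in> flow_tiles K V \<epsilon>" "x \<in> C" for C
  proof -
    obtain \<omega> where "\<omega> \<in> K" "C = Tile \<omega>" using C by (auto simp: flow_tiles_def)
    moreover have "lo \<omega> = lo (\<sigma>min x) \<and> up \<omega> = up (\<sigma>min x)"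
      using \<open>\<omega> \<in> K\<close> \<open>C = Tile \<omega>\<close> C(2) i by (intro tile_inner_unique sigma_min_in_K assms) simp_all
    ultimately show ?thesis by (simp only: tile_def)
  qed
  then have "{C \<in> flow_tiles K V \<epsilon>. x \<in> C} \<subseteq> {Tile (\<sigma>min x)}" by blast
  then have "card {C \<in> flow_tiles K V \<epsilon>. x \<in> C} \<le> 1"
    using card_mono[of "{Tile (\<sigma>min x)}" "{C \<in> flow_tiles K V \<epsilon>. x \<in> C}"] by simp
  then show False using assms(2) by simp
qed

section \<open>Transversality\<close>

abbreviation "fld \<equiv> tile_field V \<epsilon>"
abbreviation "off_fld \<equiv> field_off_lower V \<epsilon>"
abbreviation "\<theta> \<equiv> theta V \<epsilon>"

lemma tile_ode: "\<omega> \<in> K \<Longrightarrow> tile_ode V \<epsilon> \<omega>"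
  by (rule tile_ode.intro[OF eps_pos lower_nonempty lower_subset_upper card_upper_diff])

lemma X_box: "x \<in> X \<Longrightarrow> x \<in> cbox 0 1"
  using X_nonneg X_le_1 by (simp add: mem_box_cart)

lemma tile_in_X: "\<omega> \<in> K \<Longrightarrow> x \<in> Tile \<omega> \<Longrightarrow> x \<in> X"
  by (simp add: tile_iff)

lemma tile_bounds:
  assumes w: "\<omega> \<in> K" and y: "y \<in> Tile \<omega>"
  shows "0 \<le> \<theta> \<omega> y" "0 \<le> (\<Sum>u\<in>-up \<omega>. y $ u)" "(\<Sum>u\<in>-up \<omega>. y $ u) \<le> real (card (-up \<omega>)) * \<epsilon>"
    "0 \<le> (\<Sum>u\<in>-up \<omega>. g_fun \<epsilon> (y $ u))" "(\<Sum>u\<in>-up \<omega>. g_fun \<epsilon> (y $ u)) \<le> real (card (-up \<omega>)) * \<epsilon>"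
proof -
  have b: "y $ u \<le> \<epsilon>" "0 \<le> y $ u" if "u \<in> -up \<omega>" for u
    using y that X_nonneg by (auto simp: tile_iff[OF w])
  show "0 \<le> \<theta> \<omega> y" using y eps_pos by (intro theta_ge) (auto simp: tile_iff[OF w])
  show "0 \<le> (\<Sum>u\<in>-up \<omega>. y $ u)" using b by (intro sum_nonneg) auto
  show "(\<Sum>u\<in>-up \<omega>. y $ u) \<le> real (card (-up \<omega>)) * \<epsilon>" by (rule sum_bounded_above) (rule b)
  show "0 \<le> (\<Sum>u\<in>-up \<omega>. g_fun \<epsilon> (y $ u))" using b by (intro sum_nonneg g_fun_nonneg) auto
  show "(\<Sum>u\<in>-up \<omega>. g_fun \<epsilon> (y $ u)) \<le> real (card (-up \<omega>)) * \<epsilon>"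
    by (rule sum_bounded_above) (intro g_fun_le eps_pos b)
qed

lemma off_fld_diff:
  "w \<in> up \<omega> \<Longrightarrow> off_fld \<omega> y w = eta V \<epsilon> \<omega> (y $ w) y * (h_fun \<epsilon> (y $ w) + \<theta> \<omega> y - (\<Sum>u\<in>-up \<omega>. y $ u))"
  by (simp add: field_off_lower_def)

lemma off_fld_ge:
  assumes w: "\<omega> \<in> K" and y: "y \<in> Tile \<omega>" and "w \<in> up \<omega>"
  shows "- (\<epsilon> / 2) - (\<Sum>u\<in>-up \<omega>. y $ u) \<le> off_fld \<omega> y w"
proof -
  define q where "q = h_fun \<epsilon> (y $ w) + \<theta> \<omega> y - (\<Sum>u\<in>-up \<omega>. y $ u)"
  define b where "b = - (\<epsilon> / 2) - (\<Sum>u\<in>-up \<omega>. y $ u)"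
  have "b \<le> q" using h_fun_ge[OF eps_pos, of "y $ w"] tile_bounds[OF w y] by (simp add: q_def b_def)
  have "b \<le> 0" using tile_bounds[OF w y] eps_pos by (simp add: b_def)
  have e: "0 \<le> eta V \<epsilon> \<omega> (y $ w) y" "eta V \<epsilon> \<omega> (y $ w) y \<le> 1" using eta_bounds[OF eps_pos] by blast+
  have "b \<le> eta V \<epsilon> \<omega> (y $ w) y * b" using e(2) \<open>b \<le> 0\<close> mult_right_mono_neg[of "eta V \<epsilon> \<omega> (y $ w) y" 1 b] by simp
  also have "\<dots> \<le> eta V \<epsilon> \<omega> (y $ w) y * q" using e(1) \<open>b \<le> q\<close> by (intro mult_left_mono)
  finally show ?thesis using assms(3) by (simp add: off_fld_diff q_def b_def)
qed

lemma abs_off_fld_le: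
  assumes w: "\<omega> \<in> K" and y: "y \<in> Tile \<omega>" and "w \<in> up \<omega>"
  shows "\<bar>off_fld \<omega> y w\<bar> \<le> 2"
proof -
  define q where "q = h_fun \<epsilon> (y $ w) + \<theta> \<omega> y - (\<Sum>u\<in>-up \<omega>. y $ u)"
  have "\<bar>q\<bar> \<le> 2"
    using h_fun_ge[OF eps_pos, of "y $ w"] h_fun_le_1[OF eps_pos, of "y $ w"] tile_bounds[OF w y]
      theta_le[of V \<epsilon> \<omega> y] X_sum_le[OF tile_in_X[OF w y], of "-up \<omega>"] eps_le
    by (simp add: q_def abs_le_iff)
  moreover have "0 \<le> eta V \<epsilon> \<omega> (y $ w) y" "eta V \<epsilon> \<omega> (y $ w) y \<le> 1" using eta_bounds[OF eps_pos] by blast+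
  ultimately have "\<bar>eta V \<epsilon> \<omega> (y $ w) y\<bar> * \<bar>q\<bar> \<le> 1 * 2" by (intro mult_mono) auto
  then show ?thesis using assms(3) by (simp add: off_fld_diff q_def abs_mult)
qed

text \<open>The form used for linear estimates: multiplied by the number of lower vertices to avoid
  divisions, with the lower mass expressed by the remaining coordinates.\<close>

lemma fld_lower:
  assumes w: "\<omega> \<in> K" and y: "y \<in> X" and v: "v \<in> lo \<omega>"
  shows "real (card (lo \<omega>)) * fld \<omega> y $ v = real (card (lo \<omega>)) * y $ v
    - (1 - (\<Sum>u\<in>-up \<omega>. y $ u) - (\<Sum>u\<in>up \<omega> - lo \<omega>. y $ u))
    + (\<Sum>u\<in>-up \<omega>. g_fun \<epsilon> (y $ u)) - (\<Sum>u\<in>up \<omega> - lo \<omega>. off_fld \<omega> y u)"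
proof -
  interpret O: tile_ode V \<epsilon> \<omega> by (rule tile_ode[OF w])
  have "(\<Sum>u\<in>-up \<omega>. off_fld \<omega> y u) = (\<Sum>u\<in>-up \<omega>. - g_fun \<epsilon> (y $ u))"
    by (rule sum.cong) (auto simp: field_off_lower_def)
  then have "(\<Sum>u\<in>-lo \<omega>. off_fld \<omega> y u) = - (\<Sum>u\<in>-up \<omega>. g_fun \<epsilon> (y $ u)) + (\<Sum>u\<in>up \<omega> - lo \<omega>. off_fld \<omega> y u)"
    by (simp add: O.sum_compl_lower sum_negf)
  moreover have "(\<Sum>u\<in>lo \<omega>. y $ u) = 1 - (\<Sum>u\<in>-up \<omega>. y $ u) - (\<Sum>u\<in>up \<omega> - lo \<omega>. y $ u)"
    using X_sum[OF y] O.sum_split[of y] by (simp add: O.y_start_def)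
  moreover have "c * (a - s / c - n / c) = c * a - s - n" if "0 < c" for a s n c :: real
    using that by (simp add: field_simps)
  ultimately show ?thesis
    using O.tile_field_lower[OF v, of y] O.m_pos by (simp add: O.m_def)
qed

text \<open>A lower coordinate of size at most \<open>2 * \<epsilon>\<close> cannot hold its own. If
  the extra vertex has at most \<open>3 * \<epsilon> / 2\<close>, or is absent, nearly all mass is
  on the lower vertices and their mean is much larger. Otherwise \<open>h_fun\<close> and
  \<open>eta\<close> are 1 and the extra vertex draws mass at a rate of at least
  \<open>1 - P\<close>. The first case is the tighter one: it needs
  \<open>3 * (m + k) * \<epsilon> + 2 * \<epsilon> \<le> 1\<close>, and the left side is at most
  \<open>5 * d * \<epsilon>\<close>.\<close>

lemma fld_lower_decreasing:
  assumes w: "\<omega> \<in> K" and y: "y \<in> Tile \<omega>" and v: "v \<in> lo \<omega>" and yv: "y $ v \<le> 2 * \<epsilon>"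
  shows "fld \<omega> y $ v \<le> - \<epsilon>"
proof -
  interpret O: tile_ode V \<epsilon> \<omega> by (rule tile_ode[OF w])
  define m where "m = real (card (lo \<omega>))"
  define k where "k = real (card (-up \<omega>))"
  define d where "d = real CARD('v)"
  define P where "P = (\<Sum>u\<in>-up \<omega>. y $ u)"
  define Q where "Q = (\<Sum>u\<in>-up \<omega>. g_fun \<epsilon> (y $ u))"
  define W where "W = (\<Sum>u\<in>up \<omega> - lo \<omega>. y $ u)"
  define \<Phi> where "\<Phi> = (\<Sum>u\<in>up \<omega> - lo \<omega>. off_fld \<omega> y u)"
  have yX: "y \<in> X" by (rule tile_in_X[OF w y])
  have "card (lo \<omega>) + card (-up \<omega>) = card (lo \<omega> \<union> -up \<omega>)"
    using lower_subset_upper[OF w] by (subst card_Un_disjoint) auto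
  also have "\<dots> \<le> CARD('v)" by (rule card_mono) auto
  finally have mk: "m + k \<le> d" unfolding m_def k_def d_def by linarith
  then have mke: "m * \<epsilon> + k * \<epsilon> \<le> d * \<epsilon>" using eps_pos mult_right_mono[of "m + k" d \<epsilon>] by (simp add: distrib_right)
  have "0 < m" using O.m_pos by (simp add: m_def O.m_def)
  have me: "\<epsilon> \<le> m * \<epsilon>" using O.m_ge_1 eps_pos by (simp add: m_def O.m_def)
  have ke: "0 \<le> k * \<epsilon>" using eps_pos by (simp add: k_def)
  have d6: "6 * (d * \<epsilon>) < 1" using eps_card by (simp add: d_def)
  have mv: "m * y $ v \<le> 2 * (m * \<epsilon>)" using yv \<open>0 < m\<close> mult_left_mono[of "y $ v" "2 * \<epsilon>" m] by simp
  have b: "0 \<le> P" "P \<le> k * \<epsilon>" "0 \<le> Q" "Q \<le> k * \<epsilon>"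
    using tile_bounds[OF w y] by (simp_all add: P_def Q_def k_def)
  have eq: "m * fld \<omega> y $ v = m * y $ v - (1 - P - W) + Q - \<Phi>"
    using fld_lower[OF w yX v] by (simp add: m_def P_def Q_def W_def \<Phi>_def)
  have "(- (\<epsilon> / 2) - P \<le> \<Phi> \<and> W \<le> 3 * \<epsilon> / 2) \<or> (1 - P \<le> \<Phi> \<and> m * \<epsilon> \<le> 1 - P - W)"
  proof (rule O.diff_cases)
    assume e: "up \<omega> - lo \<omega> = {}"
    then have "\<Phi> = 0" "W = 0" unfolding \<Phi>_def W_def e by simp_all
    then show ?thesis using b eps_pos by simp
  next
    fix w' assume e: "up \<omega> - lo \<omega> = {w'}"
    then have w': "w' \<in> up \<omega>" by blast
    have \<Phi>W: "\<Phi> = off_fld \<omega> y w'" "W = y $ w'" unfolding \<Phi>_def W_def e by simp_all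
    show ?thesis
    proof (cases "y $ w' \<le> 3 * \<epsilon> / 2")
      case True
      then show ?thesis using off_fld_ge[OF w y w'] by (simp add: \<Phi>W P_def)
    next
      case False
      then have "h_fun \<epsilon> (y $ w') = 1" "eta V \<epsilon> \<omega> (y $ w') y = 1"
        using eps_pos by (auto intro!: h_fun_eq_1 eta_eq_1)
      then have "1 - P \<le> \<Phi>" using tile_bounds(1)[OF w y] w' by (simp add: \<Phi>W P_def off_fld_diff)
      moreover have "m * \<epsilon> \<le> (\<Sum>u\<in>lo \<omega>. y $ u)"
        unfolding m_def using y by (intro sum_bounded_below) (auto simp: tile_iff[OF w])
      moreover have "(\<Sum>u\<in>lo \<omega>. y $ u) = 1 - P - W"
        using X_sum[OF yX] O.sum_split[of y] by (simp add: O.y_start_def P_def W_def)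
      ultimately show ?thesis by simp
    qed
  qed
  then have "m * fld \<omega> y $ v \<le> - (m * \<epsilon>)"
  proof
    assume "- (\<epsilon> / 2) - P \<le> \<Phi> \<and> W \<le> 3 * \<epsilon> / 2"
    then show ?thesis using eq mv b mke me ke d6 by linarith
  next
    assume "1 - P \<le> \<Phi> \<and> m * \<epsilon> \<le> 1 - P - W"
    then show ?thesis using eq mv b mke me ke d6 by linarith
  qed
  then have "m * fld \<omega> y $ v \<le> m * (- \<epsilon>)" by simp
  then show ?thesis using \<open>0 < m\<close> by (simp only: mult_le_cancel_left_pos)
qed

lemma fld_off: "\<omega> \<in> K \<Longrightarrow> v \<notin> up \<omega> \<Longrightarrow> fld \<omega> y $ v = - g_fun \<epsilon> (y $ v)"
  by (rule tile_ode.tile_field_off[OF tile_ode])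

lemma fld_diff: "w \<in> up \<omega> \<Longrightarrow> w \<notin> lo \<omega> \<Longrightarrow> fld \<omega> y $ w = off_fld \<omega> y w"
  by (simp add: tile_field_def)

lemma fld_off_decreasing:
  assumes "\<omega> \<in> K" "v \<notin> up \<omega>" "\<epsilon> / 8 \<le> y $ v" shows "fld \<omega> y $ v \<le> - (\<epsilon> / 2)"
  using g_fun_ge_half[OF eps_pos assms(3)] by (simp add: fld_off assms)

text \<open>Near \<open>\<epsilon>\<close> the value of \<open>h_fun\<close> is about
  \<open>- \<epsilon> / 2\<close>, and the second vertex \<open>u\<close> caps the other terms near
  0: through \<open>theta\<close> if it is a lower vertex, through the subtracted sum if it is off
  the upper simplex. The width \<open>\<epsilon>\<^sup>2 / 16\<close> offsets the slope of
  \<open>h_fun\<close>, which is of order \<open>1 / \<epsilon>\<close>.\<close>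

lemma fld_diff_decreasing:
  assumes w: "\<omega> \<in> K" and y: "y \<in> Tile \<omega>" and v: "v \<in> up \<omega>" "v \<notin> lo \<omega>" and yv: "\<bar>y $ v - \<epsilon>\<bar> \<le> \<epsilon>\<^sup>2 / 16"
    and u: "(u \<in> lo \<omega> \<and> y $ u \<le> \<epsilon> + \<epsilon>\<^sup>2 / 16) \<or> (u \<notin> up \<omega> \<and> \<epsilon> - \<epsilon>\<^sup>2 / 16 \<le> y $ u)"
  shows "fld \<omega> y $ v \<le> - (\<epsilon> / 8)"
proof -
  have e2: "\<epsilon>\<^sup>2 / 16 \<le> \<epsilon> / 96" using eps_pos eps_le by (simp add: power2_eq_square)
  have "(1 + \<epsilon> / 2) * (2 / \<epsilon>) * \<bar>y $ v - \<epsilon>\<bar> \<le> (1 + \<epsilon> / 2) * (2 / \<epsilon>) * (\<epsilon>\<^sup>2 / 16)"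
    using yv eps_pos by (intro mult_left_mono) auto
  also have "\<dots> = \<epsilon> / 8 + \<epsilon>\<^sup>2 / 16" using eps_pos by (simp add: field_simps power2_eq_square)
  also have "\<dots> \<le> \<epsilon> / 4" using e2 eps_pos by linarith
  finally have h: "h_fun \<epsilon> (y $ v) \<le> - (\<epsilon> / 4)" unfolding h_fun_eq[OF eps_pos] by linarith
  have P: "0 \<le> (\<Sum>u\<in>-up \<omega>. y $ u)" by (rule tile_bounds(2)[OF w y])
  have \<theta>P: "\<theta> \<omega> y - (\<Sum>u\<in>-up \<omega>. y $ u) \<le> \<epsilon>\<^sup>2 / 16"
    using u
  proof
    assume "u \<in> lo \<omega> \<and> y $ u \<le> \<epsilon> + \<epsilon>\<^sup>2 / 16"
    then show ?thesis using theta_le_lower[of u V \<omega> \<epsilon> y] P by linarith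
  next
    assume u': "u \<notin> up \<omega> \<and> \<epsilon> - \<epsilon>\<^sup>2 / 16 \<le> y $ u"
    have "y $ u \<le> (\<Sum>u\<in>-up \<omega>. y $ u)"
      using u' X_nonneg[OF tile_in_X[OF w y]] by (intro member_le_sum) auto
    then show ?thesis using theta_le[of V \<epsilon> \<omega> y] u' by linarith
  qed
  have "\<epsilon> / 4 < \<bar>y $ v\<bar>" using yv e2 eps_pos by linarith
  then have "eta V \<epsilon> \<omega> (y $ v) y = 1" by (rule eta_eq_1)
  then have "fld \<omega> y $ v = h_fun \<epsilon> (y $ v) + (\<theta> \<omega> y - (\<Sum>u\<in>-up \<omega>. y $ u))"
    by (simp add: fld_diff v off_fld_diff)
  then show ?thesis using h \<theta>P e2 eps_pos by linarith
qed

text \<open>A common speed limit for all tiles. For a lower vertex, multiplication by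
  \<open>m\<close> leaves four terms bounded by \<open>m\<close>, 1, 1 and 2, whose sum is at most
  \<open>5 * m\<close>.\<close>

lemma abs_fld_le:
  assumes w: "\<omega> \<in> K" and y: "y \<in> Tile \<omega>" shows "\<bar>fld \<omega> y $ v\<bar> \<le> 5"
proof -
  interpret O: tile_ode V \<epsilon> \<omega> by (rule tile_ode[OF w])
  have yX: "y \<in> X" by (rule tile_in_X[OF w y])
  consider "v \<notin> up \<omega>" | "v \<in> up \<omega>" "v \<notin> lo \<omega>" | "v \<in> lo \<omega>" by blast
  then show ?thesis
  proof cases
    case 1
    then have "0 \<le> g_fun \<epsilon> (y $ v)" "g_fun \<epsilon> (y $ v) \<le> \<epsilon>"
      using y X_nonneg[OF yX] eps_pos by (auto simp: tile_iff[OF w] intro!: g_fun_nonneg g_fun_le)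
    then show ?thesis using 1 eps_le w by (simp add: fld_off)
  next
    case 2
    then show ?thesis using abs_off_fld_le[OF w y, of v] by (simp add: fld_diff)
  next
    case 3
    define m where "m = real (card (lo \<omega>))"
    define P where "P = (\<Sum>u\<in>-up \<omega>. y $ u)"
    define Q where "Q = (\<Sum>u\<in>-up \<omega>. g_fun \<epsilon> (y $ u))"
    define W where "W = (\<Sum>u\<in>up \<omega> - lo \<omega>. y $ u)"
    define \<Phi> where "\<Phi> = (\<Sum>u\<in>up \<omega> - lo \<omega>. off_fld \<omega> y u)"
    have m1: "1 \<le> m" using O.m_ge_1 by (simp add: m_def O.m_def)
    have eq: "m * fld \<omega> y $ v = m * y $ v - (1 - P - W) + Q - \<Phi>"
      using fld_lower[OF w yX 3] by (simp add: m_def P_def Q_def W_def \<Phi>_def)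
    have "(\<Sum>u\<in>lo \<omega>. y $ u) = 1 - P - W"
      using X_sum[OF yX] O.sum_split[of y] by (simp add: O.y_start_def P_def W_def)
    then have S: "0 \<le> 1 - P - W" "1 - P - W \<le> 1"
      using X_sum_le[OF yX, of "lo \<omega>"] sum_nonneg[of "lo \<omega>" "($) y"] X_nonneg[OF yX] by auto
    have Q: "0 \<le> Q" "Q \<le> 1" using tile_bounds(4,5)[OF w y] card_eps[of "-up \<omega>"] by (auto simp: Q_def)
    have "\<bar>\<Phi>\<bar> \<le> 2"
    proof (rule O.diff_cases)
      assume e: "up \<omega> - lo \<omega> = {}"
      show ?thesis unfolding \<Phi>_def e by simp
    next
      fix w' assume e: "up \<omega> - lo \<omega> = {w'}"
      then have "w' \<in> up \<omega>" by blast
      then show ?thesis unfolding \<Phi>_def e using abs_off_fld_le[OF w y] by simp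
    qed
    moreover have "0 \<le> m * y $ v" "m * y $ v \<le> m"
      using X_nonneg[OF yX, of v] X_le_1[OF yX, of v] m1 by auto
    ultimately have "\<bar>m * fld \<omega> y $ v\<bar> \<le> m * 5" using eq S Q m1 by linarith
    then have "m * \<bar>fld \<omega> y $ v\<bar> \<le> m * 5" using m1 by (simp add: abs_mult)
    then show ?thesis using m1 by simp
  qed
qed

text \<open>Near a point on the boundary of a tile, every coordinate which equals \<open>\<epsilon>\<close> at that point decreases, in all
  tiles alike. This is what makes the concatenated flow admissible and continuous.\<close>

lemma transversal_neighbourhood:
  assumes x: "x \<in> X" "x \<notin> inner (\<sigma>min x)"
  obtains r where "0 < r"
    "\<And>\<omega> y v. \<omega> \<in> K \<Longrightarrow> y \<in> Tile \<omega> \<Longrightarrow> dist y x < r \<Longrightarrow> x $ v = \<epsilon> \<Longrightarrow> fld \<omega> y $ v \<le> - (\<epsilon> / 8)"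
    "\<And>y v. dist y x < r \<Longrightarrow> x $ v \<noteq> \<epsilon> \<Longrightarrow> y $ v \<noteq> \<epsilon> \<and> (y $ v < \<epsilon> \<longleftrightarrow> x $ v < \<epsilon>)"
proof -
  \<comment> \<open>The first entry is the width allowed by \<open>fld_diff_decreasing\<close>; the
    others keep coordinates that differ from \<open>\<epsilon>\<close> at \<open>x\<close> on their
    side of \<open>\<epsilon>\<close>.\<close>
  define r where "r = Min (insert (\<epsilon>\<^sup>2 / 16) ((\<lambda>v. \<bar>x $ v - \<epsilon>\<bar>) ` {v. x $ v \<noteq> \<epsilon>}))"
  have "0 < r" using eps_pos by (auto simp: r_def)
  have r1: "r \<le> \<epsilon>\<^sup>2 / 16" unfolding r_def by (rule Min_le) auto
  have e2: "\<epsilon>\<^sup>2 / 16 \<le> \<epsilon> / 96" using eps_pos eps_le by (simp add: power2_eq_square)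
  have r2: "r \<le> \<bar>x $ v - \<epsilon>\<bar>" if "x $ v \<noteq> \<epsilon>" for v unfolding r_def by (rule Min_le) (use that in auto)
  have comp: "\<bar>y $ v - x $ v\<bar> < r" if "dist y x < r" for y v
    using component_le_norm_cart[of "y - x" v] that by (simp add: dist_norm)
  have gap: "y $ v \<noteq> \<epsilon> \<and> (y $ v < \<epsilon> \<longleftrightarrow> x $ v < \<epsilon>)" if "dist y x < r" "x $ v \<noteq> \<epsilon>" for y v
    using comp[OF that(1), of v] r2[OF that(2)] by linarith
  have dec: "fld \<omega> y $ v \<le> - (\<epsilon> / 8)"
    if w: "\<omega> \<in> K" and y: "y \<in> Tile \<omega>" and d: "dist y x < r" and xv: "x $ v = \<epsilon>" for \<omega> y v
  proof -
    have near: "\<bar>y $ u - \<epsilon>\<bar> \<le> \<epsilon>\<^sup>2 / 16" if "x $ u = \<epsilon>" for u using comp[OF d, of u] that r1 by simp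
    consider "v \<notin> up \<omega>" | "v \<in> up \<omega>" "v \<notin> lo \<omega>" | "v \<in> lo \<omega>" by blast
    then show ?thesis
    proof cases
      case 1
      have "\<epsilon> / 8 \<le> y $ v" using near[OF xv] e2 eps_pos by linarith
      from fld_off_decreasing[OF w 1 this] show ?thesis using eps_pos by linarith
    next
      case 2
      have U: "up \<omega> = insert v (lo \<omega>)" by (rule upper_diff_eq[OF w 2])
      \<comment> \<open>The extra vertex decreases only if a second coordinate is near
        \<open>\<epsilon>\<close>. If \<open>v\<close> alone were at \<open>\<epsilon>\<close>, then
        \<open>x\<close> would be interior to the tile of \<open>\<omega>\<close>, hence to its own
        tile.\<close>
      have "\<exists>u. u \<noteq> v \<and> x $ u = \<epsilon>"
      proof (rule ccontr)
        assume n: "\<not> ?thesis"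
        have "\<epsilon> < x $ u" if "u \<in> lo \<omega>" for u
        proof -
          have "x $ u \<noteq> \<epsilon>" using n that 2 by metis
          moreover have "\<epsilon> \<le> y $ u" using y that by (simp add: tile_iff[OF w])
          ultimately show ?thesis using gap[OF d, of u] by linarith
        qed
        moreover have "x $ u < \<epsilon>" if "u \<in> -up \<omega>" for u
        proof -
          have "x $ u \<noteq> \<epsilon>" using n that 2 by (metis ComplD)
          moreover have "y $ u \<le> \<epsilon>" using y that by (simp add: tile_iff[OF w])
          ultimately show ?thesis using gap[OF d, of u] by linarith
        qed
        ultimately have i: "x \<in> inner \<omega>" using x(1) by (simp add: inner_def)
        from tile_inner_unique[OF sigma_min_in_K[OF x(1)] w in_tile_sigma_min[OF x(1)] i]
        have "x \<in> inner (\<sigma>min x)" using i by (simp add: inner_def)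
        then show False using x(2) by blast
      qed
      then obtain u where u: "u \<noteq> v" "x $ u = \<epsilon>" by blast
      have "y $ u \<le> \<epsilon> + \<epsilon>\<^sup>2 / 16" "\<epsilon> - \<epsilon>\<^sup>2 / 16 \<le> y $ u" using near[OF u(2)] by linarith+
      then have "(u \<in> lo \<omega> \<and> y $ u \<le> \<epsilon> + \<epsilon>\<^sup>2 / 16) \<or> (u \<notin> up \<omega> \<and> \<epsilon> - \<epsilon>\<^sup>2 / 16 \<le> y $ u)"
        using u(1) unfolding U by blast
      from fld_diff_decreasing[OF w y 2 near[OF xv] this] show ?thesis .
    next
      case 3
      have "y $ v \<le> 2 * \<epsilon>" using near[OF xv] e2 eps_pos by linarith
      from fld_lower_decreasing[OF w y 3 this] show ?thesis using eps_pos by linarith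
    qed
  qed
  show ?thesis by (rule that[OF \<open>0 < r\<close> dec gap])
qed

lemma closed_tile: "\<omega> \<in> K \<Longrightarrow> closed (Tile \<omega>)"
proof -
  assume w: "\<omega> \<in> K"
  have "closed {x. (\<forall>v\<in>lo \<omega>. \<epsilon> \<le> x $ v) \<and> (\<forall>v\<in>-up \<omega>. x $ v \<le> \<epsilon>)}"
    unfolding Ball_def
    by (intro closed_Collect_conj closed_Collect_all closed_Collect_imp open_Collect_const closed_Collect_le
        continuous_intros)
  then have "closed (X \<inter> {x. (\<forall>v\<in>lo \<omega>. \<epsilon> \<le> x $ v) \<and> (\<forall>v\<in>-up \<omega>. x $ v \<le> \<epsilon>)})"
    by (intro closed_Int closed_X)
  also have "X \<inter> {x. (\<forall>v\<in>lo \<omega>. \<epsilon> \<le> x $ v) \<and> (\<forall>v\<in>-up \<omega>. x $ v \<le> \<epsilon>)} = Tile \<omega>"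
    by (auto simp: tile_iff[OF w])
  finally show "closed (Tile \<omega>)" .
qed

section \<open>Motion inside a flow tile\<close>

abbreviation "flow \<equiv> tile_flow V \<epsilon>"
abbreviation "exit \<equiv> exit_time K V \<epsilon>"

lemma flow_0: "\<omega> \<in> K \<Longrightarrow> x \<in> X \<Longrightarrow> flow \<omega> 0 x = x"
  by (rule tile_ode.tile_flow_0[OF tile_ode X_box])

lemma flow_add:
  "\<omega> \<in> K \<Longrightarrow> x \<in> X \<Longrightarrow> flow \<omega> s x \<in> X \<Longrightarrow> 0 \<le> s \<Longrightarrow> 0 \<le> t \<Longrightarrow> flow \<omega> t (flow \<omega> s x) = flow \<omega> (t + s) x"
  by (rule tile_ode.tile_flow_add[OF tile_ode X_box X_box])

lemma flow_tendsto:
  assumes "\<omega> \<in> K" "\<Xi> \<longlonglongrightarrow> \<xi>" "\<And>n. \<Xi> n \<in> X" "s \<longlonglongrightarrow> t" "\<And>n. 0 \<le> s n"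
  shows "(\<lambda>n. flow \<omega> (s n) (\<Xi> n)) \<longlonglongrightarrow> flow \<omega> t \<xi>"
  by (rule tile_ode.tile_flow_tendsto[OF tile_ode]) (use assms X_box in auto)

lemma flow_increment:
  assumes "\<omega> \<in> K" "x \<in> X" "0 \<le> s" "s \<le> t"
  shows "((\<lambda>r. fld \<omega> (flow \<omega> r x) $ v) has_integral (flow \<omega> t x $ v - flow \<omega> s x $ v)) {s..t}"
  by (rule tile_ode.tile_flow_increment[OF tile_ode X_box]) (use assms in auto)

lemma continuous_on_flow:
  assumes "\<omega> \<in> K" "x \<in> X" shows "continuous_on {0..} (\<lambda>t. flow \<omega> t x)"
  using tile_ode.tile_flow_solution[OF tile_ode X_box] assms by (simp add: integral_solution_def)

lemma flow_off:
  assumes "\<omega> \<in> K" "x \<in> X" "v \<notin> up \<omega>" "0 \<le> t"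
  shows "flow \<omega> t x $ v = decay \<epsilon> (x $ v) t"
  by (rule tile_ode.integral_solution_off[OF tile_ode tile_ode.tile_flow_solution[OF tile_ode X_box]])
    (use assms X_nonneg in auto)

lemma flow_sum:
  assumes "\<omega> \<in> K" "x \<in> X" "0 \<le> t" shows "(\<Sum>v\<in>UNIV. flow \<omega> t x $ v) = 1"
  using tile_ode.integral_solution_sum[OF tile_ode tile_ode.tile_flow_solution[OF tile_ode X_box]]
    X_sum assms by simp

lemma off_fld_nonneg:
  assumes "w \<in> up \<omega>" "y $ w \<le> \<epsilon> / 2" "0 \<le> \<theta> \<omega> y" "(\<Sum>u\<in>-up \<omega>. y $ u) \<le> 1"
  shows "0 \<le> off_fld \<omega> y w"
proof -
  have "h_fun \<epsilon> (y $ w) = 1" using assms(2) eps_pos by (intro h_fun_eq_1) linarith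
  moreover have "0 \<le> eta V \<epsilon> \<omega> (y $ w) y" using eta_bounds[OF eps_pos] by blast
  ultimately show ?thesis unfolding off_fld_diff[OF assms(1)] using assms(3,4) by (intro mult_nonneg_nonneg) auto
qed

lemma flow_off_sum_le:
  assumes w: "\<omega> \<in> K" and x: "x \<in> X" and t: "0 \<le> t"
  shows "(\<Sum>u\<in>-up \<omega>. flow \<omega> t x $ u) \<le> 1"
proof -
  have "(\<Sum>u\<in>-up \<omega>. flow \<omega> t x $ u) \<le> (\<Sum>u\<in>-up \<omega>. x $ u)"
    by (intro sum_mono) (use flow_off[OF w x] decay_le eps_pos X_nonneg[OF x] t in auto)
  then show ?thesis using X_sum_le[OF x, of "-up \<omega>"] by linarith
qed

text \<open>Wherever this coordinate is at most \<open>\<epsilon> / 2\<close>, \<open>h_fun\<close>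
  is 1 and the field is nonnegative. So the coordinate cannot fall after the last time
  \<open>s\<close> at which it was nonnegative.\<close>

lemma flow_diff_nonneg:
  assumes w: "\<omega> \<in> K" and x: "x \<in> X" and v: "v \<in> up \<omega>" "v \<notin> lo \<omega>" and t: "0 \<le> t"
    and stay: "\<And>r u. 0 \<le> r \<Longrightarrow> r \<le> t \<Longrightarrow> u \<in> lo \<omega> \<Longrightarrow> \<epsilon> \<le> flow \<omega> r x $ u"
  shows "0 \<le> flow \<omega> t x $ v"
proof (rule ccontr)
  assume neg: "\<not> ?thesis"
  define A where "A = {r \<in> {0..t}. 0 \<le> flow \<omega> r x $ v}"
  have c: "continuous_on {0..t} (\<lambda>r. flow \<omega> r x $ v)"
    by (intro continuous_intros continuous_on_subset[OF continuous_on_flow[OF w x]]) auto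
  have "closed A" unfolding A_def by (rule continuous_on_closed_Collect_le[OF continuous_on_const c]) simp
  moreover have "bounded A" by (rule bounded_subset[OF bounded_closed_interval[of 0 t]]) (auto simp: A_def)
  ultimately have "compact A" by (simp add: compact_eq_bounded_closed)
  moreover have "0 \<in> A" using flow_0[OF w x] X_nonneg[OF x] t by (simp add: A_def)
  ultimately obtain s where s: "s \<in> A" "\<And>r. r \<in> A \<Longrightarrow> r \<le> s" using compact_attains_sup[of A] by blast
  have st: "0 \<le> s" "s \<le> t" "0 \<le> flow \<omega> s x $ v" using s(1) by (auto simp: A_def)
  have f: "0 \<le> fld \<omega> (flow \<omega> r x) $ v" if r: "s < r" "r \<le> t" for r
  proof -
    have "r \<notin> A" using s(2)[of r] r by auto
    then have "flow \<omega> r x $ v \<le> \<epsilon> / 2" using r st eps_pos by (auto simp: A_def)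
    moreover have "0 \<le> \<theta> \<omega> (flow \<omega> r x)" using stay[of r] r st eps_pos by (intro theta_ge) auto
    ultimately show ?thesis unfolding fld_diff[OF v]
      using r st by (intro off_fld_nonneg v flow_off_sum_le w x) auto
  qed
  \<comment> \<open>The sign of the field is known only after \<open>s\<close>; the value at the
    single time \<open>s\<close> does not affect the integral.\<close>
  have "((\<lambda>r. if r = s then 0 else fld \<omega> (flow \<omega> r x) $ v) has_integral (flow \<omega> t x $ v - flow \<omega> s x $ v)) {s..t}"
    by (rule has_integral_spike_finite[OF _ _ flow_increment[OF w x st(1,2)], of "{s}"]) auto
  then have "0 \<le> flow \<omega> t x $ v - flow \<omega> s x $ v"
    by (rule has_integral_nonneg) (use f in auto)
  then show False using neg st by linarith
qed

text \<open>This is what the factor \<open>eta\<close> is for: an absent vertex must not appear while a vertex off the simplex is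
  present, since the support could leave \<open>K\<close>.\<close>

lemma flow_diff_zero:
  assumes w: "\<omega> \<in> K" and x: "x \<in> X" and v: "v \<in> up \<omega>" "v \<notin> lo \<omega>" and t: "0 \<le> t"
    and xv: "x $ v = 0" and u: "u \<notin> up \<omega>" "0 < flow \<omega> t x $ u"
  shows "flow \<omega> t x $ v = 0"
proof -
  interpret O: tile_ode V \<epsilon> \<omega> by (rule tile_ode[OF w])
  have sol: "integral_solution (fld \<omega>) x (\<lambda>t. flow \<omega> t x)" by (rule O.tile_flow_solution[OF X_box[OF x]])
  have e: "up \<omega> - lo \<omega> = {v}" by (rule O.diff_eq[OF v])
  have y1: "O.y_solution x t (\<lambda>t. \<Sum>w\<in>up \<omega> - lo \<omega>. flow \<omega> t x $ w)"
    by (rule O.integral_solution_y[OF sol X_box[OF x]])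
  obtain T0 where T0: "0 \<le> T0" "\<And>t. 0 \<le> t \<Longrightarrow> O.off_zero x t \<longleftrightarrow> T0 \<le> t" using O.off_zero_threshold[of x] by blast
  have "decay \<epsilon> (x $ u) t \<noteq> 0" using u flow_off[OF w x u(1) t] by simp
  then have "\<not> O.off_zero x t" unfolding O.off_zero_def using u(1) by blast
  then have "t < T0" using T0 t by simp
  then have "\<not> O.off_zero x r" if "r \<in> {0..t}" for r using T0 that by simp
  then have F0: "O.F x r 0 = 0" if "r \<in> {0..t}" for r using that by (simp add: O.F_def O.damp_def)
  \<comment> \<open>Before extinction \<open>damp\<close> is in force and \<open>damp 0 = 0\<close>.
    So the constant 0 solves the scalar equation, and by uniqueness it is the only solution.\<close>
  have y2: "O.y_solution x t (\<lambda>_. 0)"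
    unfolding O.y_solution_def
  proof (intro conjI ballI)
    fix s assume s: "s \<in> {0..t}"
    have "integral {0..s} (\<lambda>r. O.F x r 0) = integral {0..s} (\<lambda>r. 0)"
      by (rule integral_cong) (use F0 s in auto)
    then show "0 = O.y_start x + integral {0..s} (\<lambda>r. O.F x r 0)" unfolding O.y_start_def e using xv by simp
  qed simp
  have "(\<Sum>w\<in>up \<omega> - lo \<omega>. flow \<omega> t x $ w) = 0"
    by (rule O.y_solution_unique[OF X_box[OF x] y1 y2]) (use t in auto)
  then show ?thesis unfolding e by simp
qed

text \<open>Of the conditions that define a tile only those at the lower vertices can fail:
  coordinates off the upper simplex do not increase, the extra one stays nonnegative, the mass is
  preserved and the support remains in \<open>K\<close>.\<close>

lemma flow_stay:
  assumes w: "\<omega> \<in> K" and xt: "x \<in> Tile \<omega>" and t: "0 \<le> t"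
    and stay: "\<And>r u. 0 \<le> r \<Longrightarrow> r \<le> t \<Longrightarrow> u \<in> lo \<omega> \<Longrightarrow> \<epsilon> \<le> flow \<omega> r x $ u"
  shows "flow \<omega> t x \<in> Tile \<omega>"
proof -
  have x: "x \<in> X" by (rule tile_in_X[OF w xt])
  define y where "y = flow \<omega> t x"
  have lo: "\<epsilon> \<le> y $ v" if "v \<in> lo \<omega>" for v using stay[OF t _ that] by (simp add: y_def)
  have off: "y $ v = decay \<epsilon> (x $ v) t" if "v \<notin> up \<omega>" for v unfolding y_def by (rule flow_off[OF w x that t])
  have off_le: "y $ v \<le> x $ v" if "v \<notin> up \<omega>" for v
    unfolding off[OF that] by (rule decay_le[OF eps_pos X_nonneg[OF x] t])
  have nn: "0 \<le> y $ v" for v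
  proof -
    consider "v \<notin> up \<omega>" | "v \<in> up \<omega>" "v \<notin> lo \<omega>" | "v \<in> lo \<omega>" by blast
    then show ?thesis
    proof cases
      case 2
      then show ?thesis unfolding y_def by (rule flow_diff_nonneg[OF w x _ _ t stay])
    qed (use lo[of v] eps_pos off[of v] decay_nonneg in auto)
  qed
  have sub: "{v. 0 < y $ v} \<in> K"
  \<comment> \<open>Once the coordinates off the upper simplex are gone, the support is a face of
    \<open>up \<omega>\<close>. While one of them survives, no new vertex has appeared and the
    support is a face of the initial one.\<close>
  proof (cases "\<forall>u\<in>-up \<omega>. y $ u = 0")
    case True
    then have "{v. 0 < y $ v} \<subseteq> up \<omega>" by force
    moreover have "{v. 0 < y $ v} \<noteq> {}"
    proof -
      obtain v where "v \<in> lo \<omega>" using lower_nonempty[OF w] by blast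
      then have "0 < y $ v" using lo[of v] eps_pos by linarith
      then show ?thesis by blast
    qed
    ultimately show ?thesis using in_K_subset[OF upper_in_K[OF w]] by blast
  next
    case False
    then obtain u where u: "u \<notin> up \<omega>" "0 < y $ u" using nn by (metis ComplD order_le_less)
    have "{v. 0 < y $ v} \<subseteq> {v. 0 < x $ v}"
    proof clarify
      fix v assume yv: "0 < y $ v"
      consider "v \<notin> up \<omega>" | "v \<in> up \<omega>" "v \<notin> lo \<omega>" | "v \<in> lo \<omega>" by blast
      then show "0 < x $ v"
      proof cases
        case 1
        then show ?thesis using off_le[of v] yv by linarith
      next
        case 2
        have "x $ v \<noteq> 0"
        proof
          assume "x $ v = 0"
          from flow_diff_zero[OF w x 2 t this u(1)] u(2) yv show False by (simp add: y_def)
        qed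
        then show ?thesis using X_nonneg[OF x, of v] by simp
      next
        case 3
        then show ?thesis using xt eps_pos by (force simp: tile_iff[OF w])
      qed
    qed
    moreover have "{v. 0 < y $ v} \<noteq> {}" using u by blast
    ultimately show ?thesis using in_K_subset[OF X_support[OF x]] by blast
  qed
  have "y \<in> X" using nn sub flow_sum[OF w x t] by (simp add: realization_def y_def)
  moreover have "y $ v \<le> \<epsilon>" if "v \<in> -up \<omega>" for v
    using off_le[of v] xt that by (force simp: tile_iff[OF w])
  ultimately show ?thesis using lo by (simp add: tile_iff[OF w] y_def)
qed

lemma exit_time_le: "0 < t \<Longrightarrow> flow \<omega> t x \<notin> Tile \<omega> \<Longrightarrow> exit \<omega> x \<le> ereal t"
  unfolding exit_time_def by (rule Inf_lower) blast

text \<open>Tiles are closed, so the exit time itself is included.\<close>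

lemma flow_in_tile:
  assumes w: "\<omega> \<in> K" and x: "x \<in> Tile \<omega>" and t: "0 \<le> t" "ereal t \<le> exit \<omega> x"
  shows "flow \<omega> t x \<in> Tile \<omega>"
proof (cases "t = 0")
  case True
  then show ?thesis using flow_0[OF w tile_in_X[OF w x]] x by simp
next
  case False
  then have "0 < t" using t by simp
  define s where "s n = t - t / real (Suc (Suc n))" for n
  have s: "0 < s n" "s n < t" for n using \<open>0 < t\<close> by (auto simp: s_def field_simps intro: add_pos_nonneg)
  have "(\<lambda>n. t * (1 / real (Suc (Suc n)))) \<longlonglongrightarrow> t * 0"
    using LIMSEQ_Suc[OF LIMSEQ_inverse_real_of_nat] by (intro tendsto_intros) (simp add: inverse_eq_divide)
  then have "(\<lambda>n. t - t / real (Suc (Suc n))) \<longlonglongrightarrow> t - 0" by (intro tendsto_diff tendsto_const) simp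
  then have lim: "s \<longlonglongrightarrow> t" by (simp add: s_def[abs_def])
  have "(\<lambda>n. flow \<omega> (s n) x) \<longlonglongrightarrow> flow \<omega> t x"
    by (rule flow_tendsto[OF w tendsto_const tile_in_X[OF w x] lim]) (use s less_imp_le in blast)
  moreover have "flow \<omega> (s n) x \<in> Tile \<omega>" for n
  proof (rule ccontr)
    assume "flow \<omega> (s n) x \<notin> Tile \<omega>"
    from order_trans[OF t(2) exit_time_le[OF s(1) this]] show False using s(2)[of n] by simp
  qed
  ultimately show ?thesis by (rule closed_sequentially[OF closed_tile[OF w], rotated])
qed

lemma flow_eventually:
  assumes w: "\<omega> \<in> K" and x: "x \<in> X" and t: "0 \<le> t"
    and P: "open P" "flow \<omega> t x \<in> P" and d0: "0 < d0"
  shows "\<exists>d>0. d < d0 \<and> (\<forall>r. t \<le> r \<and> r \<le> t + d \<longrightarrow> flow \<omega> r x \<in> P)"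
proof -
  obtain e where e: "0 < e" "ball (flow \<omega> t x) e \<subseteq> P" using P open_contains_ball by blast
  obtain d where d: "0 < d" "\<And>r. r \<in> {0..} \<Longrightarrow> dist r t < d \<Longrightarrow> dist (flow \<omega> r x) (flow \<omega> t x) < e"
    using continuous_on_flow[OF w x] t e(1) unfolding continuous_on_iff by (metis atLeast_iff)
  show ?thesis
  proof (intro exI[of _ "min d d0 / 2"] conjI allI impI)
    fix r assume r: "t \<le> r \<and> r \<le> t + min d d0 / 2"
    then have "dist r t < d" using d(1) d0 by (simp add: dist_real_def min_def split: if_splits)
    then have "dist (flow \<omega> r x) (flow \<omega> t x) < e" using d(2)[of r] r t by simp
    then show "flow \<omega> r x \<in> P" using e(2) by (auto simp: dist_commute)
  qed (use d(1) d0 in \<open>auto simp: min_def\<close>)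
qed

text \<open>By continuity the lower coordinates stay above \<open>\<epsilon>\<close> for a while,
  which is all that \<open>flow_stay\<close> asks for. Read contrapositively, an exit takes place on
  a lower face.\<close>

lemma exit_progress:
  assumes w: "\<omega> \<in> K" and x: "x \<in> Tile \<omega>" and t: "0 \<le> t" "ereal t \<le> exit \<omega> x"
    and gt: "\<And>v. v \<in> lo \<omega> \<Longrightarrow> \<epsilon> < flow \<omega> t x $ v"
  shows "ereal t < exit \<omega> x"
proof -
  have xX: "x \<in> X" by (rule tile_in_X[OF w x])
  have "open (\<Inter>v\<in>lo \<omega>. {y::real^'v. \<epsilon> < y $ v})"
    by (intro open_INT ballI open_Collect_less continuous_intros) simp
  moreover have "(\<Inter>v\<in>lo \<omega>. {y::real^'v. \<epsilon> < y $ v}) = {y. \<forall>v\<in>lo \<omega>. \<epsilon> < y $ v}" by auto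
  ultimately have op: "open {y::real^'v. \<forall>v\<in>lo \<omega>. \<epsilon> < y $ v}" by simp
  have "flow \<omega> t x \<in> {y. \<forall>v\<in>lo \<omega>. \<epsilon> < y $ v}" using gt by simp
  from flow_eventually[OF w xX t(1) op this zero_less_one] obtain d where d: "0 < d" "\<And>r. t \<le> r \<Longrightarrow> r \<le> t + d \<Longrightarrow> flow \<omega> r x \<in> {y. \<forall>v\<in>lo \<omega>. \<epsilon> < y $ v}"
    by blast
  have ge: "\<epsilon> \<le> flow \<omega> r x $ v" if "0 \<le> r" "r \<le> t + d" "v \<in> lo \<omega>" for r v
  proof (cases "r \<le> t")
    case True
    then have "flow \<omega> r x \<in> Tile \<omega>" using that t order_trans[OF _ t(2), of "ereal r"] by (intro flow_in_tile[OF w x]) auto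
    then show ?thesis using that by (simp add: tile_iff[OF w])
  next
    case False
    then have "flow \<omega> r x \<in> {y. \<forall>v\<in>lo \<omega>. \<epsilon> < y $ v}" using d(2)[of r] that by simp
    then show ?thesis using that by (simp add: less_imp_le)
  qed
  have "ereal (t + d) \<le> exit \<omega> x"
    unfolding exit_time_def
  proof (rule Inf_greatest, clarify)
    fix s assume s: "0 < s" "flow \<omega> s x \<notin> Tile \<omega>"
    show "ereal (t + d) \<le> ereal s"
    proof (rule ccontr)
      assume "\<not> ?thesis"
      then have "flow \<omega> s x \<in> Tile \<omega>" using s by (intro flow_stay[OF w x] ge) auto
      then show False using s by blast
    qed
  qed
  moreover have "ereal t < ereal (t + d)" using d by simp
  ultimately show ?thesis by (rule less_le_trans[rotated])
qed

lemma exit_point: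
  assumes w: "\<omega> \<in> K" and x: "x \<in> Tile \<omega>" and t: "0 \<le> t" "exit \<omega> x = ereal t"
  obtains v where "v \<in> lo \<omega>" "flow \<omega> t x $ v = \<epsilon>"
proof -
  have "flow \<omega> t x \<in> Tile \<omega>" by (rule flow_in_tile[OF w x t(1)]) (simp add: t)
  moreover have "\<exists>v\<in>lo \<omega>. \<not> \<epsilon> < flow \<omega> t x $ v"
  proof (rule ccontr)
    assume "\<not> ?thesis"
    then have "ereal t < exit \<omega> x" by (intro exit_progress[OF w x t(1)]) (auto simp: t)
    then show False by (simp add: t)
  qed
  ultimately show ?thesis using that by (force simp: tile_iff[OF w])
qed

lemma flow_decrease:
  assumes w: "\<omega> \<in> K" and x: "x \<in> X" and st: "0 \<le> s" "s \<le> t"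
    and f: "\<And>r. s \<le> r \<Longrightarrow> r \<le> t \<Longrightarrow> fld \<omega> (flow \<omega> r x) $ v \<le> - c"
  shows "flow \<omega> t x $ v \<le> flow \<omega> s x $ v - c * (t - s)"
proof -
  have "((\<lambda>r. - c) has_integral ((t - s) * (- c))) {s..t}"
    using has_integral_const_real[of "- c" s t] st by simp
  from has_integral_le[OF flow_increment[OF w x st] this]
  have "flow \<omega> t x $ v - flow \<omega> s x $ v \<le> (t - s) * (- c)" using f by simp
  then show ?thesis by (simp add: algebra_simps)
qed

lemma flow_speed:
  assumes w: "\<omega> \<in> K" and x: "x \<in> Tile \<omega>" and t: "0 \<le> t" "ereal t \<le> exit \<omega> x"
  shows "\<bar>flow \<omega> t x $ v - x $ v\<bar> \<le> 5 * t"
proof -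
  have xX: "x \<in> X" by (rule tile_in_X[OF w x])
  have i: "((\<lambda>r. fld \<omega> (flow \<omega> r x) $ v) has_integral (flow \<omega> t x $ v - flow \<omega> 0 x $ v)) (cbox 0 t)"
    using flow_increment[OF w xX order_refl t(1)] by simp
  have "norm (flow \<omega> t x $ v - flow \<omega> 0 x $ v) \<le> 5 * measure lborel (cbox 0 t)"
  proof (rule has_integral_bound[OF _ i])
    fix r assume "r \<in> cbox 0 t"
    then have "flow \<omega> r x \<in> Tile \<omega>" using order_trans[OF _ t(2), of "ereal r"] by (intro flow_in_tile[OF w x]) auto
    then show "norm (fld \<omega> (flow \<omega> r x) $ v) \<le> 5" using abs_fld_le[OF w] by simp
  qed simp
  then show ?thesis using flow_0[OF w xX] t by simp
qed

text \<open>A lower coordinate at \<open>\<epsilon>\<close> would at once fall below it by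
  \<open>fld_lower_decreasing\<close>, although the orbit is still in the tile. Coordinates off the
  upper simplex either vanish or decrease strictly from a value of at most
  \<open>\<epsilon>\<close>.\<close>

lemma flow_inner:
  assumes w: "\<omega> \<in> K" and x: "x \<in> Tile \<omega>" and t: "0 < t" "ereal t < exit \<omega> x"
  shows "flow \<omega> t x \<in> inner \<omega>"
proof -
  have xX: "x \<in> X" by (rule tile_in_X[OF w x])
  have in_tile: "flow \<omega> t x \<in> Tile \<omega>" by (rule flow_in_tile[OF w x]) (use t in auto)
  obtain T where T: "t < T" "ereal T < exit \<omega> x" using t(2) by (metis ereal_dense2 ereal_less_eq(3) less_ereal.simps(1) less_le)
  have "\<epsilon> < flow \<omega> t x $ v" if v: "v \<in> lo \<omega>" for v
  proof (rule ccontr)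
    assume "\<not> ?thesis"
    then have eq: "flow \<omega> t x $ v \<le> \<epsilon>" by simp
    have "open {y::real^'v. y $ v < 2 * \<epsilon>}" by (intro open_Collect_less continuous_intros)
    then obtain d where d: "0 < d" "d < T - t" "\<And>r. t \<le> r \<Longrightarrow> r \<le> t + d \<Longrightarrow> flow \<omega> r x \<in> {y. y $ v < 2 * \<epsilon>}"
      using flow_eventually[OF w xX less_imp_le[OF t(1)], of "{y. y $ v < 2 * \<epsilon>}" "T - t"] eq eps_pos T(1) by auto
    have tl: "flow \<omega> r x \<in> Tile \<omega>" if "t \<le> r" "r \<le> t + d" for r
    proof (rule flow_in_tile[OF w x])
      have "ereal r \<le> ereal T" using that d by simp
      then show "ereal r \<le> exit \<omega> x" using T(2) by (meson less_imp_le order_trans)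
    qed (use that t in simp)
    have "flow \<omega> (t + d) x $ v \<le> flow \<omega> t x $ v - \<epsilon> * (t + d - t)"
    proof (rule flow_decrease[OF w xX])
      fix r assume r: "t \<le> r" "r \<le> t + d"
      show "fld \<omega> (flow \<omega> r x) $ v \<le> - \<epsilon>"
        using d(3)[OF r] by (intro fld_lower_decreasing[OF w tl[OF r] v]) simp
    qed (use t d in auto)
    moreover have "0 < \<epsilon> * d" using eps_pos d by simp
    moreover have "\<epsilon> \<le> flow \<omega> (t + d) x $ v" using tl[of "t + d"] d v by (simp add: tile_iff[OF w])
    ultimately show False using eq by simp
  qed
  moreover have "flow \<omega> t x $ v < \<epsilon>" if v: "v \<in> -up \<omega>" for v
  proof (cases "x $ v = 0")
    case True
    then show ?thesis using flow_off[OF w xX, of v t] v t eps_pos by (simp add: decay_zero)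
  next
    case False
    then have "decay \<epsilon> (x $ v) t < x $ v" using X_nonneg[OF xX, of v] by (intro decay_less eps_pos t) auto
    moreover have "x $ v \<le> \<epsilon>" using x v by (simp add: tile_iff[OF w])
    ultimately show ?thesis using flow_off[OF w xX, of v t] v t by simp
  qed
  ultimately show ?thesis using tile_in_X[OF w in_tile] by (simp add: inner_def)
qed

section \<open>Concatenation\<close>

abbreviation "exit0 p \<equiv> exit (\<sigma>min p) p"
abbreviation "flow0 t p \<equiv> flow (\<sigma>min p) t p"
abbreviation "bp \<equiv> breakpoint K V \<epsilon>"

definition succ :: "real^'v \<Rightarrow> real^'v" where
  "succ p = flow0 (real_of_ereal (exit0 p)) p"

lemma exit_nonneg: "0 \<le> exit \<omega> x"
  unfolding exit_time_def by (rule Inf_greatest) auto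

text \<open>The tile is chosen by \<open>\<sigma>min\<close>, so every lower coordinate of
  \<open>p\<close> is strictly above \<open>\<epsilon>\<close> at time 0.\<close>

lemma exit0_pos: assumes p: "p \<in> X" shows "0 < exit0 p"
proof -
  note w = sigma_min_in_K[OF p]
  have "ereal 0 < exit0 p"
  proof (rule exit_progress[OF w in_tile_sigma_min[OF p]])
    show "\<epsilon> < flow0 0 p $ v" if "v \<in> lo (\<sigma>min p)" for v
      using lower_sigma_min[OF p that] flow_0[OF w p] by simp
    show "ereal 0 \<le> exit0 p" unfolding zero_ereal_def[symmetric] by (rule exit_nonneg)
  qed simp
  then show ?thesis by (simp add: zero_ereal_def)
qed

lemma exit0_cases:
  assumes "p \<in> X"
  obtains "exit0 p = \<infinity>" | T where "exit0 p = ereal T" "0 < T"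
  using exit0_pos[OF assms] by (cases "exit0 p") auto

lemma flow0_tile:
  assumes p: "p \<in> X" and t: "0 \<le> t" "ereal t \<le> exit0 p" shows "flow0 t p \<in> Tile (\<sigma>min p)"
  by (rule flow_in_tile[OF sigma_min_in_K[OF p] in_tile_sigma_min[OF p] t])

lemma flow0_X:
  assumes p: "p \<in> X" and t: "0 \<le> t" "ereal t \<le> exit0 p" shows "flow0 t p \<in> X"
  by (rule tile_in_X[OF sigma_min_in_K[OF p] flow0_tile[OF assms]])

lemma succ_eq: "exit0 p = ereal T \<Longrightarrow> succ p = flow0 T p" by (simp add: succ_def)

lemma succ_X: assumes "p \<in> X" "exit0 p = ereal T" "0 \<le> T" shows "succ p \<in> X"
  unfolding succ_eq[OF assms(2)] by (rule flow0_X) (use assms in auto)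

lemma flow0_speed:
  assumes p: "p \<in> X" and t: "0 \<le> t" "ereal t \<le> exit0 p" shows "dist (flow0 t p) p \<le> 5 * real CARD('v) * t"
  using dist_le_card_cart[of "flow0 t p" p "5 * t"]
    flow_speed[OF sigma_min_in_K[OF p] in_tile_sigma_min[OF p] t] by simp

lemma succ_exit_vertex:
  assumes p: "p \<in> X" and T: "exit0 p = ereal T" "0 < T"
  obtains v where "v \<in> lo (\<sigma>min p)" "succ p $ v = \<epsilon>"
  using exit_point[OF sigma_min_in_K[OF p] in_tile_sigma_min[OF p] less_imp_le[OF T(2)] T(1)]
  unfolding succ_eq[OF T(1)] by blast

lemma succ_not_inner:
  assumes p: "p \<in> X" and T: "exit0 p = ereal T" "0 < T" and w: "\<omega> \<in> K"
  shows "succ p \<notin> inner \<omega>"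
proof
  assume i: "succ p \<in> inner \<omega>"
  have "succ p \<in> Tile (\<sigma>min p)" unfolding succ_eq[OF T(1)] using T by (intro flow0_tile[OF p]) auto
  from tile_inner_unique[OF sigma_min_in_K[OF p] w this i] have "lo (\<sigma>min p) = lo \<omega>" by simp
  moreover obtain v where "v \<in> lo (\<sigma>min p)" "succ p $ v = \<epsilon>" using succ_exit_vertex[OF p T] by blast
  ultimately show False using i by (auto simp: inner_def)
qed

lemma bp_Suc:
  "bp x (Suc k) = (case bp x k of None \<Rightarrow> None | Some (s, p) \<Rightarrow>
     if exit0 p < \<infinity> then Some (s + real_of_ereal (exit0 p), succ p) else None)"
  by (cases "bp x k") (auto simp: succ_def Let_def)

declare breakpoint.simps(2) [simp del]

lemma bp_props: "x \<in> X \<Longrightarrow> bp x k = Some (s, p) \<Longrightarrow> p \<in> X \<and> 0 \<le> s \<and> (0 < k \<longrightarrow> 0 < s)"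
proof (induction k arbitrary: s p)
  case (Suc k)
  then obtain s' p' where b: "bp x k = Some (s', p')" by (auto simp: bp_Suc split: option.splits)
  then have p': "p' \<in> X" "0 \<le> s'" using Suc by auto
  from p'(1) show ?case
  proof (cases rule: exit0_cases)
    case 1
    then show ?thesis using Suc.prems b by (simp add: bp_Suc)
  next
    case (2 T)
    then show ?thesis using Suc.prems b p' succ_X[OF p'(1) 2(1)] by (auto simp: bp_Suc)
  qed
qed auto

text \<open>\<open>breakpoint\<close> recurses at the last step; inductions along the orbit need the
  first step split off instead.\<close>

lemma bp_shift:
  assumes "exit0 x = ereal T"
  shows "bp x (Suc k) = map_option (\<lambda>(s, p). (T + s, p)) (bp (succ x) k)"
proof (induction k)
  case 0
  then show ?case using assms by (simp add: bp_Suc)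
next
  case (Suc k)
  have "bp x (Suc (Suc k)) = (case bp x (Suc k) of None \<Rightarrow> None | Some (s, p) \<Rightarrow>
     if exit0 p < \<infinity> then Some (s + real_of_ereal (exit0 p), succ p) else None)" by (rule bp_Suc)
  then show ?case
    unfolding Suc.IH bp_Suc[of "succ x" k] by (cases "bp (succ x) k") auto
qed

section \<open>Exit times do not accumulate\<close>

lemma inner_neighbourhood:
  assumes "x \<in> inner \<omega>"
  obtains r where "0 < r" "\<And>y. y \<in> X \<Longrightarrow> dist y x < r \<Longrightarrow> y \<in> inner \<omega>"
proof -
  have t: "((\<lambda>y. y $ v) \<longlongrightarrow> x $ v) (nhds x)" for v by (intro tendsto_intros filterlim_ident)
  have "eventually (\<lambda>y. \<epsilon> < y $ v) (nhds x)" if "v \<in> lo \<omega>" for v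
    using assms that by (intro order_tendstoD(1)[OF t]) (auto simp: inner_def)
  then have e1: "eventually (\<lambda>y. \<forall>v\<in>lo \<omega>. \<epsilon> < y $ v) (nhds x)" by (intro eventually_ball_finite) auto
  have "eventually (\<lambda>y. y $ v < \<epsilon>) (nhds x)" if "v \<in> -up \<omega>" for v
    using assms that by (intro order_tendstoD(2)[OF t]) (auto simp: inner_def)
  then have e2: "eventually (\<lambda>y. \<forall>v\<in>-up \<omega>. y $ v < \<epsilon>) (nhds x)" by (intro eventually_ball_finite) auto
  from e1 e2 have "eventually (\<lambda>y. y \<in> X \<longrightarrow> y \<in> inner \<omega>) (nhds x)"
    by eventually_elim (simp add: inner_def)
  then show ?thesis unfolding eventually_nhds_metric using that by blast
qed

lemma infinitely_many_exits:
  fixes p :: "nat \<Rightarrow> real^'v" and s T :: "nat \<Rightarrow> real"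
  assumes p: "\<And>k. p k \<in> X" and T: "\<And>k. exit0 (p k) = ereal (T k)" "\<And>k. 0 < T k"
    and ps: "\<And>k. p (Suc k) = succ (p k)" and s: "\<And>k. s (Suc k) = s k + T k" and B: "\<And>k. s k \<le> B"
  shows False
proof -
  have "s k \<le> s (Suc k)" for k using s T(2)[of k] by simp
  then have inc: "incseq s" by (rule incseq_SucI)
  obtain S where S: "s \<longlonglongrightarrow> S" "\<And>k. s k \<le> S" using incseq_convergent[OF inc] B by blast
  have piece: "dist (flow0 t (p k)) (p k) \<le> 5 * real CARD('v) * t" if "0 \<le> t" "t \<le> T k" for t k
    using flow0_speed[OF p that(1)] that T(1)[of k] by simp
  have step: "dist (p (k + n)) (p k) \<le> 5 * real CARD('v) * (s (k + n) - s k)" for k n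
  proof (induction n)
    case (Suc n)
    have "dist (p (k + Suc n)) (p (k + n)) \<le> 5 * real CARD('v) * T (k + n)"
      using piece[of "T (k + n)" "k + n"] T(2)[of "k + n"] by (simp add: ps succ_eq[OF T(1)])
    then have "dist (p (k + Suc n)) (p k) \<le> 5 * real CARD('v) * T (k + n) + 5 * real CARD('v) * (s (k + n) - s k)"
      using dist_triangle[of "p (k + Suc n)" "p k" "p (k + n)"] Suc.IH by linarith
    then show ?case by (simp add: s algebra_simps)
  qed simp
  have tail: "dist (p j) (p k) \<le> 5 * real CARD('v) * (S - s k)" if "k \<le> j" for j k
  proof -
    have "dist (p j) (p k) \<le> 5 * real CARD('v) * (s j - s k)" using step[of k "j - k"] that by simp
    also have "\<dots> \<le> 5 * real CARD('v) * (S - s k)" using S(2)[of j] by (intro mult_left_mono) auto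
    finally show ?thesis .
  qed
  have "(\<lambda>k. 5 * real CARD('v) * (S - s k)) \<longlonglongrightarrow> 5 * real CARD('v) * (S - S)" by (intro tendsto_intros S)
  then have tail0: "(\<lambda>k. 5 * real CARD('v) * (S - s k)) \<longlonglongrightarrow> 0" by simp
  have small: "\<exists>N. \<forall>k\<ge>N. 5 * real CARD('v) * (S - s k) < e" if "0 < e" for e
    using order_tendstoD(2)[OF tail0 that] by (simp add: eventually_sequentially)
  \<comment> \<open>The speed limit turns convergence of the exit times into convergence of the exit
    points.\<close>
  have "Cauchy p"
  proof (rule metric_CauchyI)
    fix e :: real assume "0 < e"
    then obtain N where N: "5 * real CARD('v) * (S - s N) < e / 2" using small[of "e / 2"] by auto
    have "dist (p m) (p n) < e" if "N \<le> m" "N \<le> n" for m n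
      using tail[OF that(1)] tail[OF that(2)] N dist_triangle2[of "p m" "p n" "p N"] by linarith
    then show "\<exists>M. \<forall>m\<ge>M. \<forall>n\<ge>M. dist (p m) (p n) < e" by blast
  qed
  then obtain x where x: "p \<longlonglongrightarrow> x" using Cauchy_convergent convergent_def by blast
  have xX: "x \<in> X" by (rule closed_sequentially[OF closed_X p x])
  define \<omega> where "\<omega> = \<sigma>min x"
  have w: "\<omega> \<in> K" unfolding \<omega>_def by (rule sigma_min_in_K[OF xX])
  \<comment> \<open>Otherwise all late exit points would be interior to one tile, whereas an exit
    point is interior to no tile by \<open>succ_not_inner\<close>.\<close>
  have "x \<notin> inner \<omega>"
  proof
    assume i: "x \<in> inner \<omega>"
    obtain d where d: "0 < d" "\<And>y. y \<in> X \<Longrightarrow> dist y x < d \<Longrightarrow> y \<in> inner \<omega>"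
      using inner_neighbourhood[OF i] by blast
    obtain N where "\<And>k. N \<le> k \<Longrightarrow> dist (p k) x < d" using metric_LIMSEQ_D[OF x d(1)] by blast
    then have "p k \<in> inner \<omega>" if "N \<le> k" for k using d(2) p that by simp
    then have "succ (p N) \<in> inner \<omega>" using ps[of N] by (metis le_SucI order_refl)
    then show False using succ_not_inner[OF p T w] by blast
  qed
  then obtain r where r: "0 < r"
    "\<And>\<omega> y v. \<omega> \<in> K \<Longrightarrow> y \<in> Tile \<omega> \<Longrightarrow> dist y x < r \<Longrightarrow> x $ v = \<epsilon> \<Longrightarrow> fld \<omega> y $ v \<le> - (\<epsilon> / 8)"
    "\<And>y v. dist y x < r \<Longrightarrow> x $ v \<noteq> \<epsilon> \<Longrightarrow> y $ v \<noteq> \<epsilon> \<and> (y $ v < \<epsilon> \<longleftrightarrow> x $ v < \<epsilon>)"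
    using transversal_neighbourhood[OF xX] unfolding \<omega>_def by blast
  obtain N1 where N1: "\<And>k. N1 \<le> k \<Longrightarrow> 5 * real CARD('v) * (S - s k) < r / 2" using small[of "r / 2"] r(1) by auto
  obtain N2 where N2: "\<And>k. N2 \<le> k \<Longrightarrow> dist (p k) x < r / 2"
    using metric_LIMSEQ_D[OF x, of "r / 2"] r(1) by auto
  define N where "N = max N1 N2"
  have near: "dist (flow0 t (p k)) x < r" if "N \<le> k" "0 \<le> t" "t \<le> T k" for k t
  proof -
    have "T k \<le> S - s k" using s[of k] S(2)[of "Suc k"] by simp
    then have "5 * real CARD('v) * t \<le> 5 * real CARD('v) * (S - s k)" using that by (intro mult_left_mono) auto
    moreover have "N1 \<le> k" using that by (simp add: N_def)
    ultimately have "dist (flow0 t (p k)) (p k) < r / 2" using piece[OF that(2,3)] N1[of k] by linarith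
    moreover have "dist (p k) x < r / 2" using N2[of k] that by (simp add: N_def)
    ultimately show ?thesis using dist_triangle[of "flow0 t (p k)" x "p k"] by linarith
  qed
  have dec: "p (Suc k) $ v < p k $ v" if k: "N \<le> k" and v: "x $ v = \<epsilon>" for k v
  proof -
    note pk = p[of k]
    have "flow0 (T k) (p k) $ v \<le> flow0 0 (p k) $ v - \<epsilon> / 8 * (T k - 0)"
    proof (rule flow_decrease[OF sigma_min_in_K[OF pk] pk])
      fix t assume t: "0 \<le> t" "t \<le> T k"
      show "fld (\<sigma>min (p k)) (flow0 t (p k)) $ v \<le> - (\<epsilon> / 8)"
        using t T(1)[of k] by (intro r(2) sigma_min_in_K[OF pk] flow0_tile[OF pk] near k v) auto
    qed (use T(2)[of k] in auto)
    moreover have "0 < \<epsilon> / 8 * T k" using eps_pos T(2)[of k] by simp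
    ultimately show ?thesis using flow_0[OF sigma_min_in_K[OF pk] pk] by (simp add: ps succ_eq[OF T(1)])
  qed
  have "\<exists>v. p (Suc k) $ v = \<epsilon>" for k using succ_exit_vertex[OF p T] ps by metis
  then obtain vk where vk: "\<And>k. p (Suc k) $ vk k = \<epsilon>" by metis
  have xv: "x $ vk k = \<epsilon>" if "N \<le> k" for k
    using r(3)[of "p (Suc k)" "vk k"] vk[of k] N2[of "Suc k"] that r(1) by (force simp: N_def)
  \<comment> \<open>There are only finitely many vertices, so one of them has coordinate exactly
    \<open>\<epsilon>\<close> at two different exit points. Its coordinate decreases strictly in
    between, a contradiction.\<close>
  have "\<not> inj_on vk {N..}" by (metis finite_imageD finite infinite_Ici)
  then obtain k j where kj: "N \<le> k" "k < j" "vk k = vk j"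
    unfolding inj_on_def by (metis atLeast_iff nat_neq_iff)
  have anti: "p (Suc k + n) $ vk k \<le> p (Suc k) $ vk k" for n
  proof (induction n)
    case (Suc n)
    then show ?case using dec[OF _ xv[OF kj(1)], of "Suc k + n"] kj(1) by simp
  qed simp
  have "p (Suc j) $ vk k < p j $ vk k" by (rule dec[OF _ xv[OF kj(1)]]) (use kj in simp)
  also have "\<dots> \<le> p (Suc k) $ vk k" using anti[of "j - Suc k"] kj by simp
  finally show False using vk[of k] vk[of j] kj(3) by simp
qed

lemma lifetime_infinite: assumes x: "x \<in> X" shows "lifetime K V \<epsilon> x = \<infinity>"
proof (cases "\<exists>k. bp x k = None")
  case True
  then show ?thesis by (simp add: lifetime_def)
next
  case False
  define s where "s k = fst (the (bp x k))" for k
  define p where "p k = snd (the (bp x k))" for k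
  have bk: "bp x k = Some (s k, p k)" for k using False by (auto simp: s_def p_def)
  have pX: "p k \<in> X" for k using bp_props[OF x bk] by simp
  have fin: "exit0 (p k) < \<infinity>" for k
    using bk[of "Suc k"] bk[of k] by (auto simp: bp_Suc split: if_splits)
  define T where "T k = real_of_ereal (exit0 (p k))" for k
  have T: "exit0 (p k) = ereal (T k)" "0 < T k" for k
    using exit0_pos[OF pX[of k]] fin[of k] unfolding T_def by (cases "exit0 (p k)"; simp)+
  have "(SUP k. ereal (s k)) = \<infinity>"
  proof (rule SUP_PInfty, rule ccontr)
    fix n :: nat assume "\<not> (\<exists>i\<in>UNIV. ereal (real n) \<le> ereal (s i))"
    then have "s k \<le> real n" for k by (auto simp: not_le intro: less_imp_le)
    moreover have "p (Suc k) = succ (p k)" "s (Suc k) = s k + T k" for k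
      using bk[of "Suc k"] bk[of k] fin[of k] by (auto simp: bp_Suc T_def)
    ultimately show False by (intro infinitely_many_exits[where p = p and T = T and s = s and B = "real n"] pX T) simp_all
  qed
  then show ?thesis using False by (simp add: lifetime_def s_def)
qed

section \<open>The concatenated flow is well defined\<close>

definition piece :: "real^'v \<Rightarrow> nat \<Rightarrow> real \<Rightarrow> real^'v \<Rightarrow> bool" where
  "piece x k t y \<longleftrightarrow>
    (\<exists>s p. bp x k = Some (s, p) \<and> s \<le> t \<and> ereal (t - s) \<le> exit0 p \<and> y = flow0 (t - s) p)"

abbreviation "\<phi> \<equiv> concat_flow K V \<epsilon>"

lemma concat_flow_piece: "\<phi> t x = (THE y. \<exists>k. piece x k t y)"
  unfolding concat_flow_def piece_def by simp

lemma piece_0: "piece x 0 t y \<longleftrightarrow> 0 \<le> t \<and> ereal t \<le> exit0 x \<and> y = flow0 t x"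
  by (auto simp: piece_def)

lemma piece_Suc:
  assumes "exit0 x = ereal T" shows "piece x (Suc k) t y \<longleftrightarrow> piece (succ x) k (t - T) y"
  by (auto simp: piece_def bp_shift[OF assms] algebra_simps)

lemma bp_Suc_infinite: "exit0 x = \<infinity> \<Longrightarrow> bp x (Suc k) = None"
  by (induction k) (simp_all add: bp_Suc)

lemma piece_before: "bp x k = Some (s, p) \<Longrightarrow> x \<in> X \<Longrightarrow> 0 \<le> t \<Longrightarrow> t < s \<Longrightarrow> \<exists>j y. piece x j t y"
proof (induction k arbitrary: s p)
  case (Suc k)
  then obtain s' p' where b: "bp x k = Some (s', p')" by (auto simp: bp_Suc split: option.splits)
  then have e: "exit0 p' < \<infinity>" "s = s' + real_of_ereal (exit0 p')" using Suc.prems by (auto simp: bp_Suc split: if_splits)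
  have "p' \<in> X" using bp_props[OF Suc.prems(2) b] by simp
  show ?case
  proof (cases "s' \<le> t")
    case True
    have "ereal (t - s') \<le> exit0 p'"
      using e Suc.prems(4) exit0_pos[OF \<open>p' \<in> X\<close>] by (cases "exit0 p'") auto
    then show ?thesis using True b by (auto simp: piece_def)
  next
    case False
    then show ?thesis using Suc.IH[OF b Suc.prems(2,3)] by simp
  qed
qed auto

text \<open>If the recursion stops, the last piece has infinite length; otherwise
  \<open>lifetime_infinite\<close> provides a breakpoint beyond \<open>t\<close>.\<close>

lemma piece_exists: assumes x: "x \<in> X" and t: "0 \<le> t" shows "\<exists>k y. piece x k t y"
proof (cases "\<exists>k. bp x k = None")
  case True
  define k where "k = (LEAST k. bp x k = None)"
  have k: "bp x k = None" unfolding k_def by (rule LeastI_ex[OF True])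
  then obtain j where j: "k = Suc j" by (cases k) auto
  have "bp x j \<noteq> None" using not_less_Least[of j "\<lambda>k. bp x k = None"] j by (simp add: k_def)
  then obtain s p where b: "bp x j = Some (s, p)" by auto
  then have "exit0 p = \<infinity>" using k j by (auto simp: bp_Suc split: if_splits)
  show ?thesis
  proof (cases "s \<le> t")
    case True
    then show ?thesis using b \<open>exit0 p = \<infinity>\<close> by (auto simp: piece_def intro!: exI[of _ j])
  next
    case False
    then show ?thesis using piece_before[OF b x t] by simp
  qed
next
  case False
  then have "(SUP k. ereal (fst (the (bp x k)))) = \<infinity>" 
    using lifetime_infinite[OF x] unfolding lifetime_def by (simp only: if_False)
  then have "ereal t < (SUP k. ereal (fst (the (bp x k))))" by simp
  then obtain k where "t < fst (the (bp x k))" by (auto simp: less_SUP_iff)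
  moreover obtain s p where "bp x k = Some (s, p)" using False by fastforce
  ultimately show ?thesis using piece_before[OF _ x t, of k s p] by simp
qed

text \<open>The first piece ends at \<open>T\<close> and every other one starts at \<open>T\<close>
  or later, so they can share only the time \<open>T\<close>. As breakpoint times after the initial
  one are positive, the other piece is then the second one, at its starting point
  \<open>succ x\<close>.\<close>

lemma piece_0_Suc:
  assumes x: "x \<in> X" and "piece x 0 t y" "piece x (Suc k) t y'" shows "y = y'"
  using x
proof (cases rule: exit0_cases)
  case 1
  then show ?thesis using assms(3) by (simp add: piece_def bp_Suc_infinite)
next
  case (2 T)
  have sX: "succ x \<in> X" by (rule succ_X[OF x 2(1)]) (use 2 in simp)
  have "piece (succ x) k (t - T) y'" using assms(3) by (simp only: piece_Suc[OF 2(1)])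
  then obtain s p where sp: "bp (succ x) k = Some (s, p)" "s \<le> t - T" "y' = flow0 (t - T - s) p"
    unfolding piece_def by blast
  have tT: "t \<le> T" "y = flow0 t x" using assms(2) 2 by (simp_all add: piece_0)
  have "s = 0" "t = T" using bp_props[OF sX sp(1)] sp(2) tT by auto
  moreover have "k = 0" using bp_props[OF sX sp(1)] \<open>s = 0\<close> by auto
  ultimately show ?thesis using sp tT flow_0[OF sigma_min_in_K[OF sX] sX] by (simp add: succ_eq[OF 2(1)])
qed

lemma piece_unique: "x \<in> X \<Longrightarrow> piece x k t y \<Longrightarrow> piece x k' t y' \<Longrightarrow> y = y'"
proof (induction k arbitrary: x t k')
  case 0
  then show ?case
  proof (cases k')
    case (Suc j)
    then show ?thesis using 0 piece_0_Suc by blast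
  qed (simp add: piece_0)
next
  case (Suc k)
  show ?case
  proof (cases k')
    case 0
    then show ?thesis using Suc.prems piece_0_Suc[OF Suc.prems(1), of t y' k y] by simp
  next
    case s: (Suc j)
    from Suc.prems(1) show ?thesis
    proof (cases rule: exit0_cases)
      case 1
      then show ?thesis using Suc.prems(2) by (simp add: piece_def bp_Suc_infinite)
    next
      case (2 T)
      have "succ x \<in> X" by (rule succ_X[OF Suc.prems(1) 2(1)]) (use 2 in simp)
      then show ?thesis using Suc.IH[of "succ x" "t - T" j] Suc.prems(2,3) unfolding s piece_Suc[OF 2(1)] by blast
    qed
  qed
qed

lemma concat_flow_eq: "x \<in> X \<Longrightarrow> piece x k t y \<Longrightarrow> \<phi> t x = y"
  unfolding concat_flow_piece by (rule the_equality) (use piece_unique in blast)+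

lemma concat_flow_first: "x \<in> X \<Longrightarrow> 0 \<le> t \<Longrightarrow> ereal t \<le> exit0 x \<Longrightarrow> \<phi> t x = flow0 t x"
  by (rule concat_flow_eq[of x 0]) (simp_all add: piece_0)

lemma concat_flow_rec:
  assumes x: "x \<in> X" and T: "exit0 x = ereal T" "T \<le> t" shows "\<phi> t x = \<phi> (t - T) (succ x)"
proof -
  have "0 < T" using exit0_pos[OF x] T by simp
  have sX: "succ x \<in> X" by (rule succ_X[OF x T(1)]) (use \<open>0 < T\<close> in simp)
  obtain k y where y: "piece (succ x) k (t - T) y" using piece_exists[OF sX, of "t - T"] T(2) by auto
  then have "\<phi> (t - T) (succ x) = y" by (rule concat_flow_eq[OF sX])
  moreover have "\<phi> t x = y" by (rule concat_flow_eq[OF x, of "Suc k"]) (simp add: piece_Suc[OF T(1)] y)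
  ultimately show ?thesis by simp
qed

text \<open>Each time lies in a piece of finite index, so it suffices to treat the first piece and
  to pass from \<open>succ x\<close> back to \<open>x\<close>. Breakpoints then disappear from the
  arguments.\<close>

lemma concat_flow_induct [consumes 2, case_names first step]:
  assumes "x \<in> X" "0 \<le> t"
    and first: "\<And>x t. x \<in> X \<Longrightarrow> 0 \<le> t \<Longrightarrow> ereal t \<le> exit0 x \<Longrightarrow> P t x"
    and step: "\<And>x t T. x \<in> X \<Longrightarrow> exit0 x = ereal T \<Longrightarrow> 0 < T \<Longrightarrow> T \<le> t \<Longrightarrow> succ x \<in> X \<Longrightarrow>
      P (t - T) (succ x) \<Longrightarrow> P t x"
  shows "P t x"
proof -
  obtain k y where "piece x k t y" using piece_exists[OF assms(1,2)] by blast
  then show ?thesis using assms(1,2)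
  proof (induction k arbitrary: x t)
    case 0
    then show ?case by (intro first) (simp_all add: piece_0)
  next
    case (Suc k)
    from Suc.prems(2) show ?case
    proof (cases rule: exit0_cases)
      case 1
      then show ?thesis using Suc.prems(1) by (simp add: piece_def bp_Suc_infinite)
    next
      case (2 T)
      have sX: "succ x \<in> X" by (rule succ_X[OF Suc.prems(2) 2(1)]) (use 2 in simp)
      have pc: "piece (succ x) k (t - T) y" using Suc.prems(1) piece_Suc[OF 2(1)] by simp
      then obtain s p where "bp (succ x) k = Some (s, p)" "s \<le> t - T" unfolding piece_def by blast
      then have "T \<le> t" using bp_props[OF sX] by fastforce
      then show ?thesis using Suc.IH[OF pc sX] 2 sX by (intro step[OF Suc.prems(2) 2]) simp_all
    qed
  qed
qed

lemma concat_flow_0: "x \<in> X \<Longrightarrow> \<phi> 0 x = x"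
  using concat_flow_first[of x 0] exit_nonneg flow_0[OF sigma_min_in_K] by (simp flip: zero_ereal_def)

lemma concat_flow_X: "x \<in> X \<Longrightarrow> 0 \<le> t \<Longrightarrow> \<phi> t x \<in> X"
proof (induction t x rule: concat_flow_induct)
  case (first x t)
  then show ?case by (simp add: concat_flow_first flow0_X)
next
  case (step x t T)
  then show ?case by (simp add: concat_flow_rec[of x T])
qed

lemma concat_flow_speed: "x \<in> X \<Longrightarrow> 0 \<le> t \<Longrightarrow> dist (\<phi> t x) x \<le> 5 * real CARD('v) * t"
proof (induction t x rule: concat_flow_induct)
  case (first x t)
  then show ?case by (simp only: concat_flow_first flow0_speed)
next
  case (step x t T)
  have "dist (succ x) x \<le> 5 * real CARD('v) * T"
    unfolding succ_eq[OF step(2)] using step by (intro flow0_speed) auto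
  moreover have "dist (\<phi> t x) (succ x) \<le> 5 * real CARD('v) * (t - T)"
    unfolding concat_flow_rec[OF step(1,2,4)] by (rule step)
  ultimately have "dist (\<phi> t x) x \<le> 5 * real CARD('v) * (t - T) + 5 * real CARD('v) * T"
    using dist_triangle[of "\<phi> t x" x "succ x"] by linarith
  then show ?case by (simp add: algebra_simps)
qed

section \<open>The semigroup law\<close>

lemma tile_field_cong: "lo \<omega> = lo \<omega>' \<Longrightarrow> up \<omega> = up \<omega>' \<Longrightarrow> fld \<omega> = fld \<omega>'"
  by (simp add: tile_field_def[abs_def] field_off_lower_def[abs_def] eta_def[abs_def] theta_def[abs_def] cong: if_cong)

lemma flow_cong: "lo \<omega> = lo \<omega>' \<Longrightarrow> up \<omega> = up \<omega>' \<Longrightarrow> flow \<omega> = flow \<omega>'"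
  using tile_field_cong[of \<omega> \<omega>'] by (simp add: tile_flow_def[abs_def])

lemma tile_cong: "lo \<omega> = lo \<omega>' \<Longrightarrow> up \<omega> = up \<omega>' \<Longrightarrow> Tile \<omega> = Tile \<omega>'"
  by (simp add: tile_def)

lemma exit_cong: "lo \<omega> = lo \<omega>' \<Longrightarrow> up \<omega> = up \<omega>' \<Longrightarrow> exit \<omega> = exit \<omega>'"
  using flow_cong[of \<omega> \<omega>'] tile_cong[of \<omega> \<omega>'] by (simp add: exit_time_def[abs_def])

lemma le_exit_iff: "ereal a \<le> exit \<omega> x \<longleftrightarrow> (\<forall>r. 0 < r \<and> r < a \<longrightarrow> flow \<omega> r x \<in> Tile \<omega>)"
proof
  assume a: "ereal a \<le> exit \<omega> x"
  show "\<forall>r. 0 < r \<and> r < a \<longrightarrow> flow \<omega> r x \<in> Tile \<omega>"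
  proof (intro allI impI, rule ccontr)
    fix r assume "0 < r \<and> r < a" "flow \<omega> r x \<notin> Tile \<omega>"
    then show False using order_trans[OF a exit_time_le[of r \<omega> x]] by simp
  qed
next
  assume "\<forall>r. 0 < r \<and> r < a \<longrightarrow> flow \<omega> r x \<in> Tile \<omega>"
  then show "ereal a \<le> exit \<omega> x" unfolding exit_time_def by (intro Inf_greatest) force
qed

lemma exit_shift:
  assumes w: "\<omega> \<in> K" and x: "x \<in> Tile \<omega>" and s: "0 \<le> s" "ereal s \<le> exit \<omega> x" and a: "0 \<le> a"
  shows "ereal a \<le> exit \<omega> (flow \<omega> s x) \<longleftrightarrow> ereal (a + s) \<le> exit \<omega> x"
proof -
  have xX: "x \<in> X" by (rule tile_in_X[OF w x])
  have sX: "flow \<omega> s x \<in> X" by (rule tile_in_X[OF w flow_in_tile[OF w x s]])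
  have add: "flow \<omega> r (flow \<omega> s x) = flow \<omega> (r + s) x" if "0 < r" for r
    by (rule flow_add[OF w xX sX s(1)]) (use that in simp)
  have pre: "flow \<omega> r x \<in> Tile \<omega>" if "0 < r" "r \<le> s" for r
    by (rule flow_in_tile[OF w x _ order_trans[OF _ s(2)]]) (use that in auto)
  show ?thesis
    unfolding le_exit_iff
  proof
    assume A: "\<forall>r. 0 < r \<and> r < a \<longrightarrow> flow \<omega> r (flow \<omega> s x) \<in> Tile \<omega>"
    show "\<forall>r. 0 < r \<and> r < a + s \<longrightarrow> flow \<omega> r x \<in> Tile \<omega>"
    proof (intro allI impI)
      fix r assume r: "0 < r \<and> r < a + s"
      show "flow \<omega> r x \<in> Tile \<omega>"
        using pre[of r] A[rule_format, of "r - s"] add[of "r - s"] r by (cases "r \<le> s") auto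
    qed
  next
    assume "\<forall>r. 0 < r \<and> r < a + s \<longrightarrow> flow \<omega> r x \<in> Tile \<omega>"
    then show "\<forall>r. 0 < r \<and> r < a \<longrightarrow> flow \<omega> r (flow \<omega> s x) \<in> Tile \<omega>"
      using add s(1) by auto
  qed
qed

lemma exit_shift_eq:
  assumes w: "\<omega> \<in> K" and x: "x \<in> Tile \<omega>" and s: "0 \<le> s" "ereal s \<le> exit \<omega> x"
    and T: "exit \<omega> (flow \<omega> s x) = ereal T"
  shows "exit \<omega> x = ereal (T + s)"
proof (rule antisym)
  have T0: "0 \<le> T" using exit_nonneg[of \<omega> "flow \<omega> s x"] T by simp
  show "ereal (T + s) \<le> exit \<omega> x" using exit_shift[OF w x s T0] T by simp
  show "exit \<omega> x \<le> ereal (T + s)"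
  proof (rule ccontr)
    assume "\<not> ?thesis"
    then obtain b where b: "T + s < b" "ereal b \<le> exit \<omega> x"
      by (metis ereal_dense2 less_ereal.simps(1) not_le less_imp_le)
    then have "ereal (b - s) \<le> exit \<omega> (flow \<omega> s x)" using exit_shift[OF w x s, of "b - s"] T0 by simp
    then show False using T b by simp
  qed
qed

lemma sigma_min_inner:
  assumes w: "\<omega> \<in> K" and x: "x \<in> inner \<omega>"
  shows "lo (\<sigma>min x) = lo \<omega> \<and> up (\<sigma>min x) = up \<omega>"
proof -
  have "x \<in> X" using x by (simp add: inner_def)
  then show ?thesis by (intro tile_inner_unique[OF sigma_min_in_K w in_tile_sigma_min x])
qed

text \<open>The delicate case is a restart in the middle of the first piece, where
  \<open>\<sigma>min\<close> may have become a different simplex. By \<open>flow_inner\<close> the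
  new point is interior to the tile, so that simplex belongs to the same vector and has the same
  tile and flow; the exit time is merely shifted.\<close>

lemma concat_flow_add:
  "x \<in> X \<Longrightarrow> 0 \<le> s \<Longrightarrow> 0 \<le> t \<Longrightarrow> \<phi> t (\<phi> s x) = \<phi> (t + s) x"
proof (induction s x rule: concat_flow_induct)
  case (first x s)
  note x = first(1)
  note w = sigma_min_in_K[OF x]
  note xt = in_tile_sigma_min[OF x]
  have eq: "\<phi> s x = flow0 s x" by (rule concat_flow_first[OF first(1-3)])
  consider "s = 0" | "0 < s" "ereal s < exit0 x" | "ereal s = exit0 x" using first by fastforce
  then show ?case
  proof cases
    case 1
    then show ?thesis by (simp add: concat_flow_0 x)
  next
    case 2
    define x' where "x' = flow0 s x"
    have x': "x' \<in> X" unfolding x'_def by (rule flow0_X[OF first(1-3)])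
    have "x' \<in> inner (\<sigma>min x)" unfolding x'_def by (rule flow_inner[OF w xt 2])
    from sigma_min_inner[OF w this] have same: "flow (\<sigma>min x') = flow (\<sigma>min x)" "exit (\<sigma>min x') = exit (\<sigma>min x)"
      by (auto intro!: flow_cong exit_cong)
    have add: "flow0 r x' = flow0 (r + s) x" if "0 \<le> r" for r
      unfolding same unfolding x'_def
      by (rule flow_add[OF w x _ first(2) that]) (use x' in \<open>simp add: x'_def\<close>)
    have shift: "ereal r \<le> exit0 x' \<longleftrightarrow> ereal (r + s) \<le> exit0 x" if "0 \<le> r" for r
      unfolding same unfolding x'_def by (rule exit_shift[OF w xt first(2,3) that])
    show ?thesis
    proof (cases "ereal t \<le> exit0 x'")
      case True
      have "\<phi> t x' = flow0 (t + s) x" using concat_flow_first[OF x' first(4) True] add[OF first(4)] by simp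
      moreover have "\<phi> (t + s) x = flow0 (t + s) x"
        by (rule concat_flow_first[OF x]) (use True shift[OF first(4)] first in auto)
      ultimately show ?thesis by (simp add: eq x'_def)
    next
      case False
      then obtain T where T: "exit0 x' = ereal T" "0 < T" using exit0_cases[OF x'] by (metis ereal_less_eq(1))
      have Tt: "T \<le> t" using False T by simp
      have ex: "exit0 x = ereal (T + s)"
        by (rule exit_shift_eq[OF w xt first(2,3)]) (use T same x'_def in simp)
      have "succ x' = succ x" unfolding succ_eq[OF T(1)] succ_eq[OF ex] using add T by simp
      then have "\<phi> t x' = \<phi> (t - T) (succ x)" using concat_flow_rec[OF x' T(1) Tt] by simp
      moreover have "\<phi> (t + s) x = \<phi> (t + s - (T + s)) (succ x)" by (rule concat_flow_rec[OF x ex]) (use Tt in simp)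
      ultimately show ?thesis by (simp add: eq x'_def)
    qed
  next
    case 3
    have e: "exit0 x = ereal s" using 3 by simp
    then show ?thesis using concat_flow_rec[OF x e, of "t + s"] first(4) by (simp add: eq succ_eq)
  qed
next
  case (step x s T)
  then show ?case
    using concat_flow_rec[OF step(1,2), of s] concat_flow_rec[OF step(1,2), of "t + s"] by (simp add: algebra_simps)
qed

text \<open>The rate is assumed in all tiles alike, so it survives every passage from one tile to
  the next.\<close>

lemma concat_flow_decrease:
  assumes dec: "\<And>\<omega> y. \<omega> \<in> K \<Longrightarrow> y \<in> Tile \<omega> \<Longrightarrow> dist y z < r \<Longrightarrow> fld \<omega> y $ v \<le> - c"
  shows "x \<in> X \<Longrightarrow> 0 \<le> t \<Longrightarrow> (\<And>s. 0 \<le> s \<Longrightarrow> s \<le> t \<Longrightarrow> dist (\<phi> s x) z < r) \<Longrightarrow> \<phi> t x $ v \<le> x $ v - c * t"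
proof (induction t x rule: concat_flow_induct)
  case (first x t)
  note w = sigma_min_in_K[OF first(1)]
  have le: "ereal s \<le> exit0 x" if "s \<le> t" for s using that first(3) by (auto intro: order_trans[of _ "ereal t"])
  have eq: "\<phi> s x = flow0 s x" if "0 \<le> s" "s \<le> t" for s
    by (rule concat_flow_first[OF first(1) that(1) le[OF that(2)]])
  have "flow0 t x $ v \<le> flow0 0 x $ v - c * (t - 0)"
  proof (rule flow_decrease[OF w first(1) order_refl first(2)])
    fix s assume s: "0 \<le> s" "s \<le> t"
    show "fld (\<sigma>min x) (flow0 s x) $ v \<le> - c"
      using first(4)[OF s] eq[OF s] by (intro dec w flow0_tile first(1) s(1) le s(2)) simp
  qed
  then show ?case using eq[of t] first(2) flow_0[OF w first(1)] by simp
next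
  case (step x t T)
  note w = sigma_min_in_K[OF step(1)]
  have eq: "\<phi> s x = flow0 s x" if "0 \<le> s" "s \<le> T" for s
    using that step(2) by (intro concat_flow_first step(1)) auto
  have "flow0 T x $ v \<le> flow0 0 x $ v - c * (T - 0)"
  proof (rule flow_decrease[OF w step(1) order_refl less_imp_le[OF step(3)]])
    fix s assume s: "0 \<le> s" "s \<le> T"
    show "fld (\<sigma>min x) (flow0 s x) $ v \<le> - c"
      using step.prems[of s] eq[OF s] s step(2,4) by (intro dec w flow0_tile step(1) s(1)) auto
  qed
  then have 1: "succ x $ v \<le> x $ v - c * T" using flow_0[OF w step(1)] by (simp add: succ_eq[OF step(2)])
  have "\<phi> (t - T) (succ x) $ v \<le> succ x $ v - c * (t - T)"
  proof (rule step.IH)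
    fix s assume s: "0 \<le> s" "s \<le> t - T"
    then show "dist (\<phi> s (succ x)) z < r"
      using concat_flow_rec[OF step(1,2), of "s + T"] step.prems[of "s + T"] step(3) by simp
  qed
  then show ?case using 1 concat_flow_rec[OF step(1,2,4)] by (simp add: algebra_simps)
qed

text \<open>Right after time 0 the orbit is interior to the tile of \<open>\<sigma>min x\<close>,
  and an interior point determines its tile.\<close>

lemma concat_flow_tile_unique:
  assumes w: "\<omega> \<in> K" and x: "x \<in> X" and d: "0 < d" and stay: "\<And>r. 0 < r \<Longrightarrow> r < d \<Longrightarrow> \<phi> r x \<in> Tile \<omega>"
  shows "lo \<omega> = lo (\<sigma>min x) \<and> up \<omega> = up (\<sigma>min x)"
proof -
  obtain e where e: "0 < e" "ereal e < exit0 x"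
    using exit0_pos[OF x] by (metis ereal_dense2 less_ereal.simps(1) zero_ereal_def)
  define r where "r = min e (d / 2)"
  have r: "0 < r" "r < d" "ereal r \<le> ereal e" using e d by (auto simp: r_def)
  have rlt: "ereal r < exit0 x" using r(3) e(2) by (rule order_le_less_trans)
  have "\<phi> r x = flow0 r x" by (rule concat_flow_first[OF x]) (use r rlt in auto)
  moreover have "flow0 r x \<in> inner (\<sigma>min x)"
    by (rule flow_inner[OF sigma_min_in_K[OF x] in_tile_sigma_min[OF x] r(1) rlt])
  ultimately show ?thesis using tile_inner_unique[OF w sigma_min_in_K[OF x] stay[OF r(1,2)]] by simp
qed

text \<open>Right after an exit the trajectory is in the interior of another tile, so it cannot remain in the old one.\<close>

lemma concat_flow_in_tile:
  assumes w: "\<omega> \<in> K" and x: "x \<in> X" and t: "0 \<le> t" and stay: "\<And>r. 0 \<le> r \<Longrightarrow> r \<le> t \<Longrightarrow> \<phi> r x \<in> Tile \<omega>"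
  shows "\<phi> t x = flow \<omega> t x"
proof (cases "t = 0")
  case True
  then show ?thesis by (simp add: concat_flow_0 flow_0 w x)
next
  case False
  then have "0 < t" using t by simp
  have same: "lo \<omega> = lo (\<sigma>min x) \<and> up \<omega> = up (\<sigma>min x)"
    by (rule concat_flow_tile_unique[OF w x \<open>0 < t\<close>]) (rule stay; simp)
  have "ereal t \<le> exit0 x"
  proof (rule ccontr)
    assume n: "\<not> ?thesis"
    then obtain T where T: "exit0 x = ereal T" "0 < T" using exit0_cases[OF x] by (metis ereal_less_eq(1))
    have Tt: "T < t" using n T by simp
    have sX: "succ x \<in> X" by (rule succ_X[OF x T(1)]) (use T in simp)
    have "lo \<omega> = lo (\<sigma>min (succ x)) \<and> up \<omega> = up (\<sigma>min (succ x))"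
    proof (rule concat_flow_tile_unique[OF w sX, of "t - T"])
      fix r assume r: "0 < r" "r < t - T"
      have "\<phi> r (succ x) = \<phi> (r + T) x" using concat_flow_rec[OF x T(1), of "r + T"] r by simp
      then show "\<phi> r (succ x) \<in> Tile \<omega>" using stay[of "r + T"] r T by simp
    qed (use Tt in simp)
    then have "lo (\<sigma>min (succ x)) = lo (\<sigma>min x)" using same by simp
    moreover obtain v where "v \<in> lo (\<sigma>min x)" "succ x $ v = \<epsilon>" using succ_exit_vertex[OF x T] by blast
    ultimately show False using lower_sigma_min[OF sX, of v] by simp
  qed
  then have "\<phi> t x = flow0 t x" by (rule concat_flow_first[OF x t])
  also have "flow (\<sigma>min x) = flow \<omega>" using same by (intro flow_cong) auto
  finally show ?thesis .
qed

text \<open>In the boundary case a coordinate that is \<open>\<epsilon>\<close> at \<open>x\<close>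
  exceeds \<open>\<epsilon>\<close> at \<open>y\<close> by at most \<open>dist y x\<close>. Falling
  at rate \<open>\<epsilon> / 8\<close>, it is back at \<open>\<epsilon>\<close> or below after the
  time \<open>8 / \<epsilon> * dist y x\<close>. The other coordinates keep their side of
  \<open>\<epsilon>\<close> near \<open>x\<close>.\<close>

lemma concat_flow_enters:
  assumes x: "x \<in> X"
  obtains d r c where "0 < d" "0 < r" "0 \<le> c"
    "\<And>y t. y \<in> X \<Longrightarrow> dist y x < r \<Longrightarrow> c * dist y x \<le> t \<Longrightarrow> t \<le> d \<Longrightarrow> \<phi> t y \<in> Tile (\<sigma>min x)"
proof -
  note w = sigma_min_in_K[OF x]
  have cpos: "0 < 5 * real CARD('v)" by simp
  \<comment> \<open>The time bound is what an orbit at the maximal speed \<open>5 * CARD('v)\<close>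
    takes to travel the distance \<open>r / 2\<close>.\<close>
  have near: "dist (\<phi> t y) x < r" if "y \<in> X" "dist y x < r / 2" "0 \<le> t" "t \<le> r / 2 / (5 * real CARD('v))" for t y r
  proof -
    have "5 * real CARD('v) * t \<le> 5 * real CARD('v) * (r / 2 / (5 * real CARD('v)))"
      by (rule mult_left_mono[OF that(4)]) simp
    also have "\<dots> = r / 2" by simp
    finally show ?thesis
      using concat_flow_speed[OF that(1,3)] that(2) dist_triangle[of "\<phi> t y" x y] by linarith
  qed
  show ?thesis
  proof (cases "x \<in> inner (\<sigma>min x)")
    case True
    then obtain r where r: "0 < r" "\<And>y. y \<in> X \<Longrightarrow> dist y x < r \<Longrightarrow> y \<in> inner (\<sigma>min x)"
      using inner_neighbourhood by blast
    show ?thesis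
    proof (rule that[of "r / 2 / (5 * real CARD('v))" "r / 2" 0])
      fix y t assume y: "y \<in> X" "dist y x < r / 2" "0 * dist y x \<le> t" "t \<le> r / 2 / (5 * real CARD('v))"
      then have "\<phi> t y \<in> inner (\<sigma>min x)" by (intro r(2) concat_flow_X near) auto
      then show "\<phi> t y \<in> Tile (\<sigma>min x)" by (auto simp: inner_def tile_iff[OF w] less_imp_le)
    qed (use r(1) in auto)
  next
    case False
    then obtain r where r: "0 < r"
      "\<And>\<omega> y v. \<omega> \<in> K \<Longrightarrow> y \<in> Tile \<omega> \<Longrightarrow> dist y x < r \<Longrightarrow> x $ v = \<epsilon> \<Longrightarrow> fld \<omega> y $ v \<le> - (\<epsilon> / 8)"
      "\<And>y v. dist y x < r \<Longrightarrow> x $ v \<noteq> \<epsilon> \<Longrightarrow> y $ v \<noteq> \<epsilon> \<and> (y $ v < \<epsilon> \<longleftrightarrow> x $ v < \<epsilon>)"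
      using transversal_neighbourhood[OF x] by blast
    show ?thesis
    proof (rule that[of "r / 2 / (5 * real CARD('v))" "r / 2" "8 / \<epsilon>"])
      fix y t assume y: "y \<in> X" "dist y x < r / 2" and t: "8 / \<epsilon> * dist y x \<le> t" "t \<le> r / 2 / (5 * real CARD('v))"
      have t0: "0 \<le> t" using t(1) eps_pos by (meson divide_nonneg_pos mult_nonneg_nonneg order_trans zero_le_dist zero_le_numeral)
      have nr: "dist (\<phi> s y) x < r" if "0 \<le> s" "s \<le> t" for s by (rule near[OF y that(1)]) (use that t in linarith)
      have le: "\<phi> t y $ v \<le> \<epsilon>" if v: "x $ v = \<epsilon>" for v
      proof -
        have "\<phi> t y $ v \<le> y $ v - \<epsilon> / 8 * t"
          by (rule concat_flow_decrease[OF r(2) y(1) t0 nr]) (auto simp: v)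
        moreover have "dist y x \<le> \<epsilon> / 8 * t" using t(1) eps_pos by (simp add: field_simps)
        moreover have "y $ v \<le> \<epsilon> + dist y x"
          using component_le_norm_cart[of "y - x" v] v by (simp add: dist_norm)
        ultimately show ?thesis by linarith
      qed
      have "\<epsilon> \<le> \<phi> t y $ v" if "v \<in> lo (\<sigma>min x)" for v
        using lower_sigma_min[OF x that] r(3)[OF nr[OF t0 order_refl], of v] by simp
      moreover have "\<phi> t y $ v \<le> \<epsilon>" if "v \<in> -up (\<sigma>min x)" for v
      proof -
        have "x $ v \<le> \<epsilon>" using in_tile_sigma_min[OF x] that by (simp add: tile_iff[OF w])
        then show ?thesis using le[of v] r(3)[OF nr[OF t0 order_refl], of v] by fastforce
      qed
      ultimately show "\<phi> t y \<in> Tile (\<sigma>min x)" using concat_flow_X[OF y(1) t0] by (simp add: tile_iff[OF w])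
    qed (use r(1) eps_pos in auto)
  qed
qed

section \<open>Continuity of the concatenated flow\<close>

definition continuous_at_time :: "real \<Rightarrow> real^'v \<Rightarrow> bool" where
  "continuous_at_time t x \<longleftrightarrow>
    (\<forall>\<Xi>. (\<forall>n. \<Xi> n \<in> X) \<longrightarrow> \<Xi> \<longlonglongrightarrow> x \<longrightarrow> (\<lambda>n. \<phi> t (\<Xi> n)) \<longlonglongrightarrow> \<phi> t x)"

text \<open>Nearby orbits are followed for the time \<open>\<tau> n\<close>, proportional to their
  distance from \<open>x\<close>, until they are in the tile of \<open>\<sigma>min x\<close>. They
  move little in that time, so \<open>q n\<close> still tends to \<open>x\<close>; from then on all
  of them obey the same continuous tile flow.\<close>

lemma continuous_at_short_time:
  assumes x: "x \<in> X"
  obtains d where "0 < d" "\<And>t. 0 \<le> t \<Longrightarrow> t \<le> d \<Longrightarrow> continuous_at_time t x"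
proof -
  note w = sigma_min_in_K[OF x]
  obtain d r c where d: "0 < d" and r: "0 < r" and c: "0 \<le> c"
    and enters: "\<And>y t. y \<in> X \<Longrightarrow> dist y x < r \<Longrightarrow> c * dist y x \<le> t \<Longrightarrow> t \<le> d \<Longrightarrow> \<phi> t y \<in> Tile (\<sigma>min x)"
    using concat_flow_enters[OF x] by blast
  have "continuous_at_time t x" if t: "0 \<le> t" "t \<le> d" for t
  proof (cases "t = 0")
    case True
    then show ?thesis by (simp add: continuous_at_time_def concat_flow_0 x)
  next
    case False
    then have tpos: "0 < t" using t by simp
    show ?thesis
      unfolding continuous_at_time_def
    proof (intro allI impI)
      fix \<Xi> assume \<Xi>: "\<forall>n. \<Xi> n \<in> X" "\<Xi> \<longlonglongrightarrow> x"
      define \<tau> where "\<tau> n = c * dist (\<Xi> n) x" for n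
      have \<tau>0: "0 \<le> \<tau> n" for n using c by (simp add: \<tau>_def)
      have "(\<lambda>n. c * dist (\<Xi> n) x) \<longlonglongrightarrow> c * dist x x" by (intro tendsto_intros \<Xi>)
      then have \<tau>lim: "\<tau> \<longlonglongrightarrow> 0" by (simp add: \<tau>_def[abs_def])
      define q where "q n = \<phi> (\<tau> n) (\<Xi> n)" for n
      have qX: "q n \<in> X" for n unfolding q_def using \<Xi>(1) \<tau>0 by (intro concat_flow_X) auto
      have "(\<lambda>n. dist (q n) (\<Xi> n)) \<longlonglongrightarrow> 0"
      proof (rule Lim_null_comparison)
        show "\<forall>\<^sub>F n in sequentially. norm (dist (q n) (\<Xi> n)) \<le> 5 * real CARD('v) * \<tau> n"
          using \<Xi>(1) \<tau>0 by (simp add: q_def concat_flow_speed)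
        have "(\<lambda>n. 5 * real CARD('v) * \<tau> n) \<longlonglongrightarrow> 5 * real CARD('v) * 0" by (intro tendsto_intros \<tau>lim)
        then show "(\<lambda>n. 5 * real CARD('v) * \<tau> n) \<longlonglongrightarrow> 0" by simp
      qed
      moreover have "(\<lambda>n. dist (\<Xi> n) x) \<longlonglongrightarrow> 0" by (rule tendsto_dist_iff[THEN iffD1, OF \<Xi>(2)])
      ultimately have "(\<lambda>n. dist (q n) (\<Xi> n) + dist (\<Xi> n) x) \<longlonglongrightarrow> 0 + 0" by (rule tendsto_add)
      then have "(\<lambda>n. dist (q n) (\<Xi> n) + dist (\<Xi> n) x) \<longlonglongrightarrow> 0" by simp
      then have "(\<lambda>n. dist (q n) x) \<longlonglongrightarrow> 0"
        by (rule Lim_null_comparison[rotated]) (simp add: dist_triangle)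
      then have qlim: "q \<longlonglongrightarrow> x" by (rule tendsto_dist_iff[THEN iffD2])
      have "(\<lambda>n. max 0 (t - \<tau> n)) \<longlonglongrightarrow> max 0 (t - 0)" by (intro tendsto_intros \<tau>lim)
      then have slim: "(\<lambda>n. max 0 (t - \<tau> n)) \<longlonglongrightarrow> t" using tpos by simp
      have flim: "(\<lambda>n. flow (\<sigma>min x) (max 0 (t - \<tau> n)) (q n)) \<longlonglongrightarrow> flow (\<sigma>min x) t x"
        by (rule flow_tendsto[OF w qlim qX slim]) simp
      have e1: "\<forall>\<^sub>F n in sequentially. \<tau> n < t" by (rule order_tendstoD(2)[OF \<tau>lim tpos])
      have e2: "\<forall>\<^sub>F n in sequentially. dist (\<Xi> n) x < r" by (rule tendstoD[OF \<Xi>(2) r])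
      have eq: "\<forall>\<^sub>F n in sequentially. flow (\<sigma>min x) (max 0 (t - \<tau> n)) (q n) = \<phi> t (\<Xi> n)"
        using e1 e2
      proof eventually_elim
        case (elim n)
        have \<Xi>n: "\<Xi> n \<in> X" using \<Xi>(1) by simp
        have "\<phi> (t - \<tau> n) (q n) = flow (\<sigma>min x) (t - \<tau> n) (q n)"
        proof (rule concat_flow_in_tile[OF w qX])
          fix s assume s: "0 \<le> s" "s \<le> t - \<tau> n"
          have "\<phi> s (q n) = \<phi> (s + \<tau> n) (\<Xi> n)" unfolding q_def by (rule concat_flow_add[OF \<Xi>n \<tau>0 s(1)])
          then show "\<phi> s (q n) \<in> Tile (\<sigma>min x)"
            using enters[OF \<Xi>n elim(2), of "s + \<tau> n"] s t by (simp add: \<tau>_def)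
        qed (use elim in simp)
        moreover have "\<phi> (t - \<tau> n) (q n) = \<phi> (t - \<tau> n + \<tau> n) (\<Xi> n)"
          unfolding q_def by (rule concat_flow_add[OF \<Xi>n \<tau>0]) (use elim in simp)
        ultimately show ?case using elim by simp
      qed
      have "\<phi> t x = flow (\<sigma>min x) t x"
        by (rule concat_flow_in_tile[OF w x t(1)]) (use enters[OF x] r t in auto)
      then show "(\<lambda>n. \<phi> t (\<Xi> n)) \<longlonglongrightarrow> \<phi> t x" using Lim_transform_eventually[OF flim eq] by simp
    qed
  qed
  then show ?thesis using that d by blast
qed

lemma concat_flow_lipschitz:
  assumes x: "x \<in> X" and "0 \<le> s" "s \<le> t" shows "dist (\<phi> t x) (\<phi> s x) \<le> 5 * real CARD('v) * (t - s)"
  using concat_flow_speed[OF concat_flow_X[OF x assms(2)], of "t - s"] concat_flow_add[OF x assms(2), of "t - s"] assms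
  by simp

text \<open>All orbits share one Lipschitz constant in time, so continuity at times slightly before
  \<open>t\<close> carries over to \<open>t\<close> by an estimate in three parts.\<close>

lemma continuous_at_time_closed:
  assumes x: "x \<in> X" and t: "0 \<le> t" and lt: "\<And>s. 0 \<le> s \<Longrightarrow> s < t \<Longrightarrow> continuous_at_time s x"
  shows "continuous_at_time t x"
proof (cases "t = 0")
  case True
  then show ?thesis by (simp add: continuous_at_time_def concat_flow_0 x)
next
  case False
  then have tpos: "0 < t" using t by simp
  show ?thesis
    unfolding continuous_at_time_def
  proof (intro allI impI)
    fix \<Xi> assume \<Xi>: "\<forall>n. \<Xi> n \<in> X" "\<Xi> \<longlonglongrightarrow> x"
    show "(\<lambda>n. \<phi> t (\<Xi> n)) \<longlonglongrightarrow> \<phi> t x"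
    proof (rule tendstoI)
      fix e :: real assume e: "0 < e"
      define a where "a = e / 3 / (5 * real CARD('v))"
      have a: "0 < a" "5 * real CARD('v) * a = e / 3" using e by (simp_all add: a_def)
      define s where "s = max 0 (t - a)"
      have s: "0 \<le> s" "s < t" "t - s \<le> a" using tpos a by (auto simp: s_def)
      have le: "5 * real CARD('v) * (t - s) \<le> e / 3" unfolding a(2)[symmetric] by (rule mult_left_mono[OF s(3)]) simp
      have "(\<lambda>n. \<phi> s (\<Xi> n)) \<longlonglongrightarrow> \<phi> s x" using lt[OF s(1,2)] \<Xi> by (simp add: continuous_at_time_def)
      then have "\<forall>\<^sub>F n in sequentially. dist (\<phi> s (\<Xi> n)) (\<phi> s x) < e / 3" by (rule tendstoD) (use e in simp)
      then show "\<forall>\<^sub>F n in sequentially. dist (\<phi> t (\<Xi> n)) (\<phi> t x) < e"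
      proof eventually_elim
        case (elim n)
        have "dist (\<phi> t (\<Xi> n)) (\<phi> s (\<Xi> n)) \<le> e / 3"
          using concat_flow_lipschitz[of "\<Xi> n" s t] \<Xi>(1) s le by fastforce
        moreover have "dist (\<phi> t x) (\<phi> s x) \<le> e / 3" using concat_flow_lipschitz[OF x, of s t] s le by linarith
        ultimately show ?case
          using elim dist_triangle[of "\<phi> t (\<Xi> n)" "\<phi> t x" "\<phi> s (\<Xi> n)"] dist_triangle2[of "\<phi> s (\<Xi> n)" "\<phi> t x" "\<phi> s x"]
          by linarith
      qed
    qed
  qed
qed

text \<open>At the infimum \<open>t1\<close> of the bad times continuity still holds by
  \<open>continuous_at_time_closed\<close>. The short-time statement at the point reached then
  carries it past \<open>t1\<close>, by the semigroup law.\<close>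

lemma continuous_at_all_times:
  assumes x: "x \<in> X" and t: "0 \<le> t" shows "continuous_at_time t x"
proof (rule ccontr)
  assume n: "\<not> ?thesis"
  define B where "B = {t. 0 \<le> t \<and> \<not> continuous_at_time t x}"
  have B: "B \<noteq> {}" "bdd_below B" using n t by (auto simp: B_def)
  define t1 where "t1 = Inf B"
  have t1: "0 \<le> t1" unfolding t1_def by (rule cInf_greatest[OF B(1)]) (simp add: B_def)
  have below: "continuous_at_time s x" if "0 \<le> s" "s < t1" for s
    using cInf_lower[OF _ B(2), of s] that by (auto simp: t1_def B_def)
  have at: "continuous_at_time t1 x" by (rule continuous_at_time_closed[OF x t1 below])
  define z where "z = \<phi> t1 x"
  have z: "z \<in> X" unfolding z_def by (rule concat_flow_X[OF x t1])
  obtain d where d: "0 < d" "\<And>t. 0 \<le> t \<Longrightarrow> t \<le> d \<Longrightarrow> continuous_at_time t z"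
    using continuous_at_short_time[OF z] by blast
  have above: "continuous_at_time (r + t1) x" if r: "0 \<le> r" "r \<le> d" for r
    unfolding continuous_at_time_def
  proof (intro allI impI)
    fix \<Xi> assume \<Xi>: "\<forall>n. \<Xi> n \<in> X" "\<Xi> \<longlonglongrightarrow> x"
    have "(\<lambda>n. \<phi> t1 (\<Xi> n)) \<longlonglongrightarrow> z" using at \<Xi> by (simp add: continuous_at_time_def z_def)
    moreover have "\<phi> t1 (\<Xi> n) \<in> X" for n using \<Xi>(1) t1 by (intro concat_flow_X) auto
    ultimately have "(\<lambda>n. \<phi> r (\<phi> t1 (\<Xi> n))) \<longlonglongrightarrow> \<phi> r z" using d(2)[OF r] by (simp add: continuous_at_time_def)
    then show "(\<lambda>n. \<phi> (r + t1) (\<Xi> n)) \<longlonglongrightarrow> \<phi> (r + t1) x"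
      using \<Xi>(1) x t1 r(1) by (simp add: concat_flow_add z_def)
  qed
  obtain b where b: "b \<in> B" "b < t1 + d"
    using cInf_lessD[OF B(1), of "t1 + d"] d(1) by (auto simp: t1_def)
  have "continuous_at_time b x"
    using below[of b] above[of "b - t1"] b by (cases "b < t1") (auto simp: B_def)
  then show False using b by (simp add: B_def)
qed

lemma continuous_on_concat_flow: "continuous_on ({0..} \<times> X) (\<lambda>(t, x). \<phi> t x)"
  unfolding continuous_on_sequentially
proof (intro ballI allI impI)
  fix P :: "nat \<Rightarrow> real \<times> (real^'v)" and p
  assume p: "p \<in> {0..} \<times> X" and P: "(\<forall>n. P n \<in> {0..} \<times> X) \<and> P \<longlonglongrightarrow> p"
  obtain t x where tx: "p = (t, x)" by (cases p)
  define s where "s n = fst (P n)" for n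
  define \<Xi> where "\<Xi> n = snd (P n)" for n
  have Pn: "P n = (s n, \<Xi> n)" for n by (simp add: s_def \<Xi>_def)
  have t: "0 \<le> t" and x: "x \<in> X" using p tx by auto
  have mem: "0 \<le> s n" "\<Xi> n \<in> X" for n using P unfolding Pn by auto
  have slim: "s \<longlonglongrightarrow> t" using tendsto_fst[of P p sequentially] P by (simp add: s_def[abs_def] tx)
  have \<Xi>lim: "\<Xi> \<longlonglongrightarrow> x" using tendsto_snd[of P p sequentially] P by (simp add: \<Xi>_def[abs_def] tx)
  have A: "(\<lambda>n. \<phi> t (\<Xi> n)) \<longlonglongrightarrow> \<phi> t x"
    using continuous_at_all_times[OF x t] mem \<Xi>lim by (simp add: continuous_at_time_def)
  have "(\<lambda>n. 5 * real CARD('v) * \<bar>s n - t\<bar>) \<longlonglongrightarrow> 5 * real CARD('v) * \<bar>t - t\<bar>" by (intro tendsto_intros slim)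
  then have z: "(\<lambda>n. 5 * real CARD('v) * \<bar>s n - t\<bar>) \<longlonglongrightarrow> 0" by simp
  have "dist (\<phi> (s n) (\<Xi> n)) (\<phi> t (\<Xi> n)) \<le> 5 * real CARD('v) * \<bar>s n - t\<bar>" for n
    using concat_flow_lipschitz[of "\<Xi> n" "s n" t] concat_flow_lipschitz[of "\<Xi> n" t "s n"] mem t
    by (cases "s n \<le> t") (simp_all add: dist_commute)
  then have "(\<lambda>n. \<phi> (s n) (\<Xi> n) - \<phi> t (\<Xi> n)) \<longlonglongrightarrow> 0"
    by (intro Lim_null_comparison[OF _ z]) (simp add: dist_norm)
  from tendsto_add[OF this A] show "((\<lambda>(t, x). \<phi> t x) \<circ> P) \<longlonglongrightarrow> (\<lambda>(t, x). \<phi> t x) p"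
    by (simp add: o_def Pn tx)
qed

section \<open>Strong admissibility\<close>

lemma continuous_semiflow_concat_flow: "continuous_semiflow X \<phi>"
  unfolding continuous_semiflow_def
  using concat_flow_X continuous_on_concat_flow concat_flow_0 concat_flow_add by auto

lemma semiflow_solutionD:
  "semiflow_solution X \<phi> I \<gamma> \<Longrightarrow> 0 \<le> s \<Longrightarrow> t \<in> I \<Longrightarrow> s + t \<in> I \<Longrightarrow> \<phi> s (\<gamma> t) = \<gamma> (s + t)"
  by (simp add: semiflow_solution_def)

lemma admissible_concat_flow: "admissible K V \<epsilon> \<phi>"
  unfolding admissible_def
proof (intro conjI ballI impI allI)
  show "continuous_semiflow X \<phi>" by (rule continuous_semiflow_concat_flow)
  fix x a b \<gamma>
  assume x: "x \<in> X" and two: "2 \<le> card {C \<in> flow_tiles K V \<epsilon>. x \<in> C}"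
    and sol: "a \<le> 0 \<and> 0 < b \<and> solution_through X \<phi> {a..b} \<gamma> x"
  then have ab: "a \<le> 0" "0 < b" and g: "semiflow_solution X \<phi> {a..b} \<gamma>" and g0: "\<gamma> 0 = x"
    by (auto simp: solution_through_def)
  have gX: "\<gamma> t \<in> X" if "t \<in> {a..b}" for t using g that by (auto simp: semiflow_solution_def)
  obtain r where r: "0 < r"
    "\<And>\<omega> y v. \<omega> \<in> K \<Longrightarrow> y \<in> Tile \<omega> \<Longrightarrow> dist y x < r \<Longrightarrow> x $ v = \<epsilon> \<Longrightarrow> fld \<omega> y $ v \<le> - (\<epsilon> / 8)"
    "\<And>y v. dist y x < r \<Longrightarrow> x $ v \<noteq> \<epsilon> \<Longrightarrow> y $ v \<noteq> \<epsilon> \<and> (y $ v < \<epsilon> \<longleftrightarrow> x $ v < \<epsilon>)"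
    using transversal_neighbourhood[OF x two_tiles_not_inner[OF x two]] by blast
  \<comment> \<open>At the maximal speed an orbit through \<open>x\<close> stays within
    \<open>r\<close> of \<open>x\<close> for times of modulus below \<open>e\<close>. For negative
    \<open>t\<close> the speed bound is applied to the orbit from \<open>\<gamma> t\<close> to
    \<open>x\<close>.\<close>
  define e where "e = r / (5 * real CARD('v))"
  have e: "0 < e" using r(1) by (simp add: e_def)
  have near: "dist (\<gamma> t) x < r" if t: "t \<in> {a..b}" "\<bar>t\<bar> < e" for t
  proof -
    have "dist (\<gamma> t) x \<le> 5 * real CARD('v) * \<bar>t\<bar>"
    proof (cases "0 \<le> t")
      case True
      then have "\<gamma> t = \<phi> t x" using semiflow_solutionD[OF g True, of 0] t ab g0 by simp
      then show ?thesis using concat_flow_speed[OF x True] True by simp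
    next
      case False
      then have "x = \<phi> (- t) (\<gamma> t)" using semiflow_solutionD[OF g, of "- t" t] t ab g0 by simp
      then show ?thesis using concat_flow_speed[OF gX[OF t(1)], of "- t"] False by (simp add: dist_commute)
    qed
    also have "\<dots> < 5 * real CARD('v) * e" using t(2) by (intro mult_strict_left_mono) auto
    also have "\<dots> = r" by (simp add: e_def)
    finally show ?thesis .
  qed
  have dec: "\<gamma> t $ v \<le> \<gamma> s $ v - \<epsilon> / 8 * (t - s)"
    if st: "s \<in> {a..b}" "t \<in> {a..b}" "s \<le> t" "\<bar>s\<bar> < e" "\<bar>t\<bar> < e" and v: "x $ v = \<epsilon>" for s t v
  proof -
    have eq: "\<phi> q (\<gamma> s) = \<gamma> (q + s)" if "0 \<le> q" "q \<le> t - s" for q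
      using that st by (intro semiflow_solutionD[OF g]) auto
    have "\<phi> (t - s) (\<gamma> s) $ v \<le> \<gamma> s $ v - \<epsilon> / 8 * (t - s)"
    proof (rule concat_flow_decrease[OF r(2)])
      fix q assume q: "0 \<le> q" "q \<le> t - s"
      show "dist (\<phi> q (\<gamma> s)) x < r" unfolding eq[OF q] using q st by (intro near) auto
    qed (use st v gX in auto)
    then show ?thesis using eq[of "t - s"] st by simp
  qed
  have mem0: "0 \<in> {a..b}" using ab by simp
  show "\<exists>U. openin (top_of_set {a..b}) U \<and> 0 \<in> U \<and>
      (\<forall>t\<in>U. t < 0 \<longrightarrow> \<gamma> t \<in> cell K \<epsilon> (\<sigma>max x)) \<and> (\<forall>t\<in>U. t > 0 \<longrightarrow> \<gamma> t \<in> cell K \<epsilon> (\<sigma>min x))"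
  proof (intro exI[of _ "{a..b} \<inter> {-e<..<e}"] conjI ballI impI)
    show "openin (top_of_set {a..b}) ({a..b} \<inter> {-e<..<e})" by (rule openin_open_Int) simp
    show "0 \<in> {a..b} \<inter> {-e<..<e}" using e ab by simp
  next
    fix t assume t: "t \<in> {a..b} \<inter> {-e<..<e}" "t < 0"
    then have t': "t \<in> {a..b}" "\<bar>t\<bar> < e" by auto
    have E: "\<epsilon> < \<gamma> t $ v" if v: "x $ v = \<epsilon>" for v
    proof -
      have "\<epsilon> \<le> \<gamma> t $ v - \<epsilon> / 8 * (0 - t)" using dec[OF t'(1) mem0 _ t'(2) _ v] t e g0 v by simp
      moreover have "0 < \<epsilon> / 8 * (0 - t)" using eps_pos t(2) by (intro mult_pos_pos) auto
      ultimately show ?thesis by linarith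
    qed
    show "\<gamma> t \<in> cell K \<epsilon> (\<sigma>max x)"
      unfolding cell_def sigma_max_def
    proof (intro CollectI conjI ballI allI impI gX t'(1))
      fix v assume "v \<in> {v. \<epsilon> \<le> x $ v}"
      then show "\<epsilon> < \<gamma> t $ v" using E[of v] r(3)[OF near[OF t'], of v] by (cases "x $ v = \<epsilon>") auto
    next
      fix v assume "v \<notin> {v. \<epsilon> \<le> x $ v}"
      then show "\<gamma> t $ v < \<epsilon>" using r(3)[OF near[OF t'], of v] by auto
    qed
  next
    fix t assume t: "t \<in> {a..b} \<inter> {-e<..<e}" "0 < t"
    then have t': "t \<in> {a..b}" "\<bar>t\<bar> < e" by auto
    have E: "\<gamma> t $ v < \<epsilon>" if v: "x $ v = \<epsilon>" for v
    proof -
      have "\<gamma> t $ v \<le> \<epsilon> - \<epsilon> / 8 * (t - 0)" using dec[OF mem0 t'(1) _ _ t'(2) v] t e g0 v by simp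
      moreover have "0 < \<epsilon> / 8 * (t - 0)" using eps_pos t(2) by simp
      ultimately show ?thesis by linarith
    qed
    show "\<gamma> t \<in> cell K \<epsilon> (\<sigma>min x)"
      unfolding cell_def sigma_min_def
    proof (intro CollectI conjI ballI allI impI gX t'(1))
      fix v assume "v \<in> {v. \<epsilon> < x $ v}"
      then show "\<epsilon> < \<gamma> t $ v" using r(3)[OF near[OF t'], of v] by auto
    next
      fix v assume "v \<notin> {v. \<epsilon> < x $ v}"
      then show "\<gamma> t $ v < \<epsilon>" using E[of v] r(3)[OF near[OF t'], of v] by (cases "x $ v = \<epsilon>") auto
    qed
  qed
qed

section \<open>Arrow tiles are left in forward and in backward time\<close>

definition deviation :: "'v set \<Rightarrow> real^'v \<Rightarrow> 'v \<Rightarrow> real" where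
  "deviation \<omega> x v = x $ v - (\<Sum>u\<in>lo \<omega>. x $ u) / real (card (lo \<omega>))"

lemma flow_deviation:
  assumes w: "\<omega> \<in> K" and x: "x \<in> X" and t: "0 \<le> t" and v: "v \<in> lo \<omega>"
  shows "deviation \<omega> (flow \<omega> t x) v = exp t * deviation \<omega> x v"
  using tile_ode.integral_solution_deviation[OF tile_ode[OF w] tile_ode.tile_flow_solution[OF tile_ode[OF w] X_box[OF x]] t v]
  by (simp add: deviation_def tile_ode.m_def[OF tile_ode[OF w]])

lemma abs_deviation_le:
  assumes w: "\<omega> \<in> K" and x: "x \<in> X" shows "\<bar>deviation \<omega> x v\<bar> \<le> 1"
proof -
  have m: "1 \<le> real (card (lo \<omega>))" using lower_nonempty[OF w] by (simp add: Suc_le_eq card_gt_0_iff)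
  have "0 \<le> (\<Sum>u\<in>lo \<omega>. x $ u)" using X_nonneg[OF x] by (intro sum_nonneg) auto
  moreover have "(\<Sum>u\<in>lo \<omega>. x $ u) \<le> 1 * real (card (lo \<omega>))" using X_sum_le[OF x, of "lo \<omega>"] m by simp
  ultimately have "0 \<le> (\<Sum>u\<in>lo \<omega>. x $ u) / real (card (lo \<omega>))" "(\<Sum>u\<in>lo \<omega>. x $ u) / real (card (lo \<omega>)) \<le> 1"
    using m by (auto simp: divide_le_eq)
  then show ?thesis using X_nonneg[OF x, of v] X_le_1[OF x, of v] unfolding deviation_def by linarith
qed

text \<open>Away from \<open>\<epsilon>\<close> the term \<open>h_fun\<close> is 1. Near
  \<open>\<epsilon>\<close> the lower vertices carry nearly all mass and have mean at least
  \<open>4 * \<epsilon>\<close>. Balance puts each of them at \<open>2 * \<epsilon>\<close> or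
  above, so \<open>theta\<close> reaches its cap \<open>\<epsilon>\<close> and outweighs the dip of
  \<open>h_fun\<close> to \<open>- \<epsilon> / 2\<close>.\<close>

lemma arrow_field_ge:
  assumes w: "\<omega> \<in> K" and v: "v \<in> up \<omega>" "v \<notin> lo \<omega>" and y: "y \<in> Tile \<omega>"
    and off: "\<And>u. u \<notin> up \<omega> \<Longrightarrow> y $ u = 0" and dev: "\<And>u. u \<in> lo \<omega> \<Longrightarrow> \<bar>deviation \<omega> y u\<bar> \<le> 2 * \<epsilon>"
  shows "\<epsilon> / 2 \<le> fld \<omega> y $ v"
proof -
  have yX: "y \<in> X" by (rule tile_in_X[OF w y])
  have P: "(\<Sum>u\<in>-up \<omega>. y $ u) = 0" using off by (intro sum.neutral) auto
  have "(\<Sum>u\<in>-up \<omega>. (y $ u)\<^sup>2) = 0" using off by (intro sum.neutral) auto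
  then have eta: "eta V \<epsilon> \<omega> (y $ v) y = 1" by (simp add: eta_def)
  have f: "fld \<omega> y $ v = h_fun \<epsilon> (y $ v) + \<theta> \<omega> y" by (simp add: fld_diff v off_fld_diff eta P)
  show ?thesis
  proof (cases "\<epsilon> / 2 \<le> \<bar>y $ v - \<epsilon>\<bar>")
    case True
    then show ?thesis using f h_fun_eq_1[OF True] tile_bounds(1)[OF w y] eps_le eps_pos by simp
  next
    case False
    then have yv: "y $ v \<le> 3 * \<epsilon> / 2" by linarith
    define m where "m = real (card (lo \<omega>))"
    have m: "1 \<le> m" using lower_nonempty[OF w] by (simp add: m_def Suc_le_eq card_gt_0_iff)
    have e: "up \<omega> - lo \<omega> = {v}" by (rule tile_ode.diff_eq[OF tile_ode[OF w] v])
    have S: "(\<Sum>u\<in>lo \<omega>. y $ u) = 1 - y $ v"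
      using X_sum[OF yX] P tile_ode.sum_split[OF tile_ode[OF w], of y]
      unfolding tile_ode.y_start_def[OF tile_ode[OF w]] e by simp
    have "6 * (m * \<epsilon>) < 1" using card_eps[of "lo \<omega>"] by (simp add: m_def)
    moreover have "\<epsilon> \<le> m * \<epsilon>" using m eps_pos by simp
    ultimately have "m * (4 * \<epsilon>) \<le> (\<Sum>u\<in>lo \<omega>. y $ u)" using S yv by linarith
    then have mean: "4 * \<epsilon> \<le> (\<Sum>u\<in>lo \<omega>. y $ u) / m" using m by (simp add: le_divide_eq mult.commute)
    have "\<epsilon> \<le> \<theta> \<omega> y"
    proof (rule theta_ge)
      fix u assume "u \<in> lo \<omega>"
      then show "\<epsilon> \<le> y $ u - \<epsilon>" using dev[of u] mean unfolding deviation_def m_def[symmetric] by linarith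
    qed simp
    then show ?thesis using f h_fun_ge[OF eps_pos, of "y $ v"] by linarith
  qed
qed

text \<open>Once the coordinates off the simplex have died out and the point is almost balanced, the coordinate of the
  arrow's extra vertex grows at a definite rate, so the tile cannot be occupied for long.\<close>

lemma arrow_tile_time_bound:
  assumes w: "\<omega> \<in> K" and v: "v \<in> up \<omega>" "v \<notin> lo \<omega>" and x: "x \<in> X"
    and stay: "\<And>s. 0 \<le> s \<Longrightarrow> s \<le> 4 / \<epsilon> \<Longrightarrow> flow \<omega> s x \<in> Tile \<omega>"
    and off: "\<And>s u. 0 \<le> s \<Longrightarrow> s \<le> 4 / \<epsilon> \<Longrightarrow> u \<notin> up \<omega> \<Longrightarrow> flow \<omega> s x $ u = 0"
    and dev: "\<And>s u. 0 \<le> s \<Longrightarrow> s \<le> 4 / \<epsilon> \<Longrightarrow> u \<in> lo \<omega> \<Longrightarrow> \<bar>deviation \<omega> (flow \<omega> s x) u\<bar> \<le> 2 * \<epsilon>"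
  shows False
proof -
  \<comment> \<open>At rate \<open>\<epsilon> / 2\<close> the coordinate would gain 2 in this time,
    but it is confined to the unit interval.\<close>
  define T where "T = 4 / \<epsilon>"
  have T: "0 \<le> T" "\<epsilon> / 2 * T = 2" using eps_pos by (simp_all add: T_def)
  have "((\<lambda>_. \<epsilon> / 2) has_integral ((T - 0) * (\<epsilon> / 2))) {0..T}"
    using has_integral_const_real[of "\<epsilon> / 2" 0 T] T by simp
  from has_integral_le[OF this flow_increment[OF w x order_refl T(1), of v]]
  have "(T - 0) * (\<epsilon> / 2) \<le> flow \<omega> T x $ v - flow \<omega> 0 x $ v"
    using arrow_field_ge[OF w v stay off dev] by (simp add: T_def)
  moreover have "flow \<omega> T x $ v \<le> 1" using X_le_1[OF tile_in_X[OF w stay]] T by (simp add: T_def)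
  ultimately show False using T X_nonneg[OF x, of v] flow_0[OF w x] by (simp add: mult.commute)
qed

text \<open>The time in which \<open>decay\<close> takes the value 1 to 0; it serves every point of
  \<open>X\<close>, whose coordinates are at most 1.\<close>

definition extinction_time :: real where
  "extinction_time = 3 / (2 * (root 3 \<epsilon>)\<^sup>2)"

lemma extinction_time_nonneg: "0 \<le> extinction_time" by (simp add: extinction_time_def)

lemma flow_extinction:
  assumes w: "\<omega> \<in> K" and x: "x \<in> X" and u: "u \<notin> up \<omega>" and t: "extinction_time \<le> t"
  shows "flow \<omega> t x $ u = 0"
proof -
  have t0: "0 \<le> t" using t extinction_time_nonneg by linarith
  have "root 3 (x $ u) \<le> root 3 1" using X_le_1[OF x] by (subst real_root_le_iff) auto
  then have "(root 3 (x $ u))\<^sup>2 \<le> 1" using X_nonneg[OF x, of u] by (simp add: power_le_one)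
  also have "1 = 2/3 * (root 3 \<epsilon>)\<^sup>2 * extinction_time" using eps_pos by (simp add: extinction_time_def)
  also have "\<dots> \<le> 2/3 * (root 3 \<epsilon>)\<^sup>2 * t" using t by (intro mult_left_mono) auto
  finally show ?thesis using flow_off[OF w x u t0] by (simp add: decay_eq_0_iff)
qed

lemma arrow_vertex:
  assumes "\<omega> \<in> K" "lo \<omega> \<noteq> up \<omega>" obtains v where "v \<in> up \<omega>" "v \<notin> lo \<omega>"
  using assms lower_subset_upper by blast

lemma arrow_tile_forward_exit:
  assumes w: "\<omega> \<in> K" and arrow: "lo \<omega> \<noteq> up \<omega>" and x: "x \<in> X"
    and stay: "\<And>t. 0 \<le> t \<Longrightarrow> \<phi> t x \<in> Tile \<omega>"
  shows False
proof -
  obtain v where v: "v \<in> up \<omega>" "v \<notin> lo \<omega>" using arrow_vertex[OF w arrow] by blast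
  have eq: "\<phi> t x = flow \<omega> t x" if "0 \<le> t" for t by (rule concat_flow_in_tile[OF w x that stay])
  have stay': "flow \<omega> t x \<in> Tile \<omega>" if "0 \<le> t" for t using stay[OF that] eq[OF that] by simp
  \<comment> \<open>From \<open>z\<close> on all coordinates off the upper simplex are 0.\<close>
  define z where "z = flow \<omega> extinction_time x"
  have z: "z \<in> X" unfolding z_def by (rule tile_in_X[OF w stay'[OF extinction_time_nonneg]])
  have zf: "flow \<omega> s z = flow \<omega> (s + extinction_time) x" if "0 \<le> s" for s
    unfolding z_def
    by (rule flow_add[OF w x _ extinction_time_nonneg that]) (use z in \<open>simp add: z_def\<close>)
  have zt: "flow \<omega> s z \<in> Tile \<omega>" if "0 \<le> s" for s
    unfolding zf[OF that] using that extinction_time_nonneg by (intro stay') simp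
  have bal: "deviation \<omega> z u = 0" if u: "u \<in> lo \<omega>" for u
  proof (rule ccontr)
    assume "deviation \<omega> z u \<noteq> 0"
    define D where "D = \<bar>deviation \<omega> z u\<bar>"
    have D: "0 < D" using \<open>deviation \<omega> z u \<noteq> 0\<close> by (simp add: D_def)
    \<comment> \<open>By time \<open>1 / D\<close> a nonzero deviation of size \<open>D\<close> has
      grown to at least \<open>D + 1\<close>, but deviations in \<open>X\<close> are at most
      1.\<close>
    have "\<bar>deviation \<omega> (flow \<omega> (1 / D) z) u\<bar> = exp (1 / D) * D"
      using flow_deviation[OF w z _ u, of "1 / D"] D by (simp add: D_def abs_mult)
    moreover have "\<bar>deviation \<omega> (flow \<omega> (1 / D) z) u\<bar> \<le> 1"
      using zt[of "1 / D"] D by (intro abs_deviation_le[OF w] tile_in_X[OF w]) simp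
    moreover have "(1 + 1 / D) * D \<le> exp (1 / D) * D"
      using D by (intro mult_right_mono exp_ge_add_one_self) auto
    moreover have "(1 + 1 / D) * D = D + 1" using D by (simp add: field_simps)
    ultimately show False using D by linarith
  qed
  show False
  proof (rule arrow_tile_time_bound[OF w v z])
    fix s u assume s: "0 \<le> s" "s \<le> 4 / \<epsilon>"
    show "flow \<omega> s z \<in> Tile \<omega>" by (rule zt[OF s(1)])
    show "flow \<omega> s z $ u = 0" if "u \<notin> up \<omega>"
      unfolding zf[OF s(1)] using s by (intro flow_extinction[OF w x that]) simp
    show "\<bar>deviation \<omega> (flow \<omega> s z) u\<bar> \<le> 2 * \<epsilon>" if "u \<in> lo \<omega>"
      using flow_deviation[OF w z s(1) that] bal[OF that] eps_pos by simp
  qed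
qed

lemma arrow_tile_backward_exit:
  assumes w: "\<omega> \<in> K" and arrow: "lo \<omega> \<noteq> up \<omega>"
    and g: "semiflow_solution X \<phi> I \<gamma>" and I: "{..0} \<subseteq> I" and stay: "\<And>t. t \<le> 0 \<Longrightarrow> \<gamma> t \<in> Tile \<omega>"
  shows False
proof -
  obtain v where v: "v \<in> up \<omega>" "v \<notin> lo \<omega>" using arrow_vertex[OF w arrow] by blast
  have X: "\<gamma> t \<in> X" if "t \<le> 0" for t by (rule tile_in_X[OF w stay[OF that]])
  have eq: "flow \<omega> s (\<gamma> t) = \<gamma> (s + t)" if "0 \<le> s" "s + t \<le> 0" for s t
  proof -
    have p: "\<phi> q (\<gamma> t) = \<gamma> (q + t)" if "0 \<le> q" "q \<le> s" for q
      using that \<open>s + t \<le> 0\<close> I by (intro semiflow_solutionD[OF g]) auto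
    have "\<phi> s (\<gamma> t) = flow \<omega> s (\<gamma> t)"
    proof (rule concat_flow_in_tile[OF w X that(1)])
      show "\<phi> r (\<gamma> t) \<in> Tile \<omega>" if "0 \<le> r" "r \<le> s" for r
        unfolding p[OF that] using that \<open>s + t \<le> 0\<close> by (intro stay) simp
    qed (use that in simp)
    then show ?thesis using p[of s] that by simp
  qed
  \<comment> \<open>With an unlimited past, extinction took place before any given time.\<close>
  have off: "\<gamma> t $ u = 0" if "u \<notin> up \<omega>" "t \<le> 0" for u t
    using flow_extinction[OF w X that(1) order_refl, of "t - extinction_time"] eq[of extinction_time "t - extinction_time"]
      that extinction_time_nonneg by simp
  \<comment> \<open>Deviations at time 0 are at most 1, so at time \<open>t\<close> they are at most
    \<open>exp t\<close>. For \<open>t \<le> - S\<close> this is at most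
    \<open>1 / S = 2 * \<epsilon>\<close>.\<close>
  define S where "S = 1 / (2 * \<epsilon>)"
  have S: "0 < S" using eps_pos by (simp add: S_def)
  have dev: "\<bar>deviation \<omega> (\<gamma> t) u\<bar> \<le> 2 * \<epsilon>" if u: "u \<in> lo \<omega>" and t: "t \<le> - S" for u t
  proof -
    have t0: "t \<le> 0" "0 \<le> - t" using t S by linarith+
    have "exp (- t) * \<bar>deviation \<omega> (\<gamma> t) u\<bar> = \<bar>deviation \<omega> (\<gamma> 0) u\<bar>"
      using flow_deviation[OF w X[OF t0(1)] t0(2) u] eq[of "- t" t] t0 by (simp add: abs_mult)
    also have "\<dots> \<le> 1" by (rule abs_deviation_le[OF w X]) simp
    finally have le: "exp (- t) * \<bar>deviation \<omega> (\<gamma> t) u\<bar> \<le> 1" .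
    have "S \<le> exp (- t)" using exp_ge_add_one_self[of "- t"] t by linarith
    then have "S * \<bar>deviation \<omega> (\<gamma> t) u\<bar> \<le> exp (- t) * \<bar>deviation \<omega> (\<gamma> t) u\<bar>" by (rule mult_right_mono) simp
    then have "S * \<bar>deviation \<omega> (\<gamma> t) u\<bar> \<le> 1" using le by linarith
    then show ?thesis using eps_pos by (simp add: S_def field_simps)
  qed
  \<comment> \<open>The whole time span required by \<open>arrow_tile_time_bound\<close> then lies
    before \<open>- S\<close>.\<close>
  define t0 where "t0 = - S - 4 / \<epsilon>"
  have "0 < 4 / \<epsilon>" using eps_pos by simp
  then have t0: "t0 \<le> 0" using S unfolding t0_def by linarith
  have sh: "flow \<omega> s (\<gamma> t0) = \<gamma> (s + t0)" "s + t0 \<le> - S" "s + t0 \<le> 0" if "0 \<le> s" "s \<le> 4 / \<epsilon>" for s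
  proof -
    show "s + t0 \<le> - S" "s + t0 \<le> 0" using that S by (simp_all add: t0_def)
    then show "flow \<omega> s (\<gamma> t0) = \<gamma> (s + t0)" using that by (intro eq)
  qed
  show False
    by (rule arrow_tile_time_bound[OF w v X[OF t0]]) (simp_all add: sh stay off dev)
qed

lemma strongly_admissible_concat_flow: "strongly_admissible K V \<epsilon> \<phi>"
  unfolding strongly_admissible_def
proof (intro conjI ballI allI impI admissible_concat_flow)
  fix C x \<gamma> assume C: "C \<in> arrow_flow_tiles K V \<epsilon>" "x \<in> C" and g: "solution_through X \<phi> {0..} \<gamma> x"
  obtain \<omega> where w: "\<omega> \<in> K" "lo \<omega> \<noteq> up \<omega>" "C = Tile \<omega>" using C(1) by (auto simp: arrow_flow_tiles_def)
  have x: "x \<in> X" using C(2) w by (auto intro: tile_in_X)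
  have "\<phi> t x = \<gamma> t" if "0 \<le> t" for t
    using semiflow_solutionD[of "{0..}" \<gamma> t 0] g that by (simp add: solution_through_def)
  then show "\<exists>t\<ge>0. \<gamma> t \<notin> C" using arrow_tile_forward_exit[OF w(1,2) x] w(3) by metis
next
  fix C x I \<gamma> assume C: "C \<in> arrow_flow_tiles K V \<epsilon>" "x \<in> C"
    and g: "solution_through X \<phi> I \<gamma> x \<and> {..0} \<subseteq> I"
  obtain \<omega> where w: "\<omega> \<in> K" "lo \<omega> \<noteq> up \<omega>" "C = Tile \<omega>" using C(1) by (auto simp: arrow_flow_tiles_def)
  show "\<exists>t\<le>0. \<gamma> t \<notin> C"
    using arrow_tile_backward_exit[OF w(1,2), of I \<gamma>] g w(3) unfolding solution_through_def by blast
qed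

end

theorem theorem2p3:
  fixes K :: "'v::finite set set" and V :: "'v set set set" and \<epsilon> :: real
  assumes "abstract_complex K"
    and "vertices K = UNIV"
    and "combinatorial_vector_field K V"
    and "0 < \<epsilon>" and "\<epsilon> < 1 / (6 * real (card (vertices K)))"
  shows "(\<forall>x\<in>realization K. lifetime K V \<epsilon> x = \<infinity>) \<and>
    (\<forall>t\<ge>0. \<forall>x\<in>realization K. concat_flow K V \<epsilon> t x \<in> realization K) \<and>
    continuous_on ({0..} \<times> realization K) (\<lambda>(t, x). concat_flow K V \<epsilon> t x) \<and>
    (\<forall>t\<ge>0. \<forall>s\<ge>0. \<forall>x\<in>realization K.
       concat_flow K V \<epsilon> t (concat_flow K V \<epsilon> s x) = concat_flow K V \<epsilon> (t + s) x) \<and>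
    strongly_admissible K V \<epsilon> (concat_flow K V \<epsilon>)"
proof -
  \<comment> \<open>As all indices are vertices, the bound on \<open>\<epsilon>\<close> is the one
    in terms of \<open>CARD('v)\<close>.\<close>
  interpret tiled_complex K V \<epsilon>
    by unfold_locales (use assms in simp_all)
  show ?thesis
    using lifetime_infinite concat_flow_X continuous_on_concat_flow concat_flow_add strongly_admissible_concat_flow
    by blast
qed

end
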